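(* Fix a real number $\theta\neq0$, and let $\Delta(x)$ be the error term in the asymptotic formula for $\sum^*_{n\le x}|\tau(n,\theta)|^2$ and $\lambda(\theta)$ the constant, both defined in the context. For any $\epsilon>0$ put $$\mathcal{A}_1=\{x\ge1:\Delta(x)>(\lambda(\theta)-\epsilon)x^{1/4}\},\qquad \mathcal{A}_2=\{x\ge1:\Delta(x)<(-\lambda(\theta)+\epsilon)x^{1/4}\}.$$ Then, as $T\to\infty$, $$\mathfrak{m}(\mathcal{A}_j\cap[T,2T])=\Omega\left(T^{1/2}(\log T)^{-12}\right)\qquad\text{for } j=1,2.$$
   Context: $\tau(n,\theta)=\sum_{d\mid n}d^{i\theta}$. For $\Re(s)>1$, $$D(s)=\sum_{n\ge1}\frac{|\tau(n,\theta)|^2}{n^s}=\frac{\zeta^2(s)\zeta(s+i\theta)\zeta(s-i\theta)}{\zeta(2s)},$$ and $D$ also denotes its meromorphic continuation. The error term is $$\Delta(x)=\sum^*_{n\le x}|\tau(n,\theta)|^2-\sum_{\rho\in\{1,1+i\theta,1-i\theta\}}\mathrm{Res}_{s=\rho}\frac{D(s)x^s}{s};$$ the subtracted main term has the form $\omega_1(\theta)x\log x+\omega_2(\theta)x\cos(\theta\log x)+\omega_3(\theta)x$ with constants $\omega_i(\theta)$ depending only on $\theta$. Here $\sum^*_{n\le x}$ means that when $x\in\mathbb{N}$ the last term $n=x$ is counted with weight $\frac12$. A known bound (Hall and Tenenbaum) is $\Delta(x)=O_\theta(x^{1/2}\log^6x)$. Let $2s_0=\frac12+i\,14.134\ldots$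 be the nontrivial zero of $\zeta$ with least positive imaginary part, and $\lambda(\theta)=|s_0|^{-1}\left|\mathrm{Res}_{s=s_0}D(s)\right|$. $\mathfrak{m}$ is Lebesgue measure on $\mathbb{R}$. For nonnegative $F$ and positive $f$, $F(T)=\Omega(f(T))$ as $T\to\infty$ means $\limsup_{T\to\infty}F(T)/f(T)>0$. *)

theory Defs
  imports "HOL-Complex_Analysis.Complex_Analysis"
begin

(* A function that is nicely_meromorphic_on UNIV takes its limit value at every removable
   singularity and the value 0 at every pole.  With this normalisation the meromorphic
   continuation is unique as a function on the complex plane, see
   halfplane_continuation_eqI below. *)
definition halfplane_continuation :: "(complex \<Rightarrow> complex) \<Rightarrow> complex \<Rightarrow> complex" where
  "halfplane_continuation f =
     (THE g. g nicely_meromorphic_on UNIV \<and> (\<forall>s. Re s > 1 \<longrightarrow> g s = f s))"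

definition dirichlet_series :: "(nat \<Rightarrow> complex) \<Rightarrow> complex \<Rightarrow> complex" where
  "dirichlet_series a s = (\<Sum>n. a (Suc n) / of_nat (Suc n) powr s)"

definition zeta :: "complex \<Rightarrow> complex" where
  "zeta = halfplane_continuation (dirichlet_series (\<lambda>_. 1))"

definition tau :: "nat \<Rightarrow> real \<Rightarrow> complex" where
  "tau n \<theta> = (\<Sum>d | d dvd n. of_nat d powr (\<i> * of_real \<theta>))"

definition D :: "real \<Rightarrow> complex \<Rightarrow> complex" where
  "D \<theta> = halfplane_continuation (dirichlet_series (\<lambda>n. of_real ((cmod (tau n \<theta>))\<^sup>2)))"

definition sum_star :: "(nat \<Rightarrow> real) \<Rightarrow> real \<Rightarrow> real" where
  "sum_star a x = (\<Sum>n | 0 < n \<and> real n \<le> x. (if real n = x then 1 / 2 else 1) * a n)"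

(* The sum of the three residues is real for x > 0, since D(cnj s) = cnj (D s); Re only
   changes the type. *)
definition Delta :: "real \<Rightarrow> real \<Rightarrow> real" where
  "Delta \<theta> x = sum_star (\<lambda>n. (cmod (tau n \<theta>))\<^sup>2) x
     - Re (\<Sum>\<rho>\<in>{1, 1 + \<i> * of_real \<theta>, 1 - \<i> * of_real \<theta>}.
             residue (\<lambda>s. D \<theta> s * of_real x powr s / s) \<rho>)"

definition nontrivial_zero :: "complex \<Rightarrow> bool" where
  "nontrivial_zero z \<longleftrightarrow> zeta z = 0 \<and> 0 < Re z \<and> Re z < 1"

(* The zero 1/2 + 14.134...i. *)
definition lowest_nontrivial_zero :: "complex \<Rightarrow> bool" where
  "lowest_nontrivial_zero z \<longleftrightarrow> nontrivial_zero z \<and> Re z = 1 / 2 \<and> 0 < Im z \<and>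
     (\<forall>w. nontrivial_zero w \<and> 0 < Im w \<longrightarrow> Im z \<le> Im w)"

definition lambda :: "complex \<Rightarrow> real \<Rightarrow> real" where
  "lambda s0 \<theta> = cmod (residue (D \<theta>) s0) / cmod s0"

definition A1 :: "complex \<Rightarrow> real \<Rightarrow> real \<Rightarrow> real set" where
  "A1 s0 \<theta> \<epsilon> = {x. x \<ge> 1 \<and> Delta \<theta> x > (lambda s0 \<theta> - \<epsilon>) * x powr (1 / 4)}"

definition A2 :: "complex \<Rightarrow> real \<Rightarrow> real \<Rightarrow> real set" where
  "A2 s0 \<theta> \<epsilon> = {x. x \<ge> 1 \<and> Delta \<theta> x < (- lambda s0 \<theta> + \<epsilon>) * x powr (1 / 4)}"

(* The Hardy-Littlewood Omega (limsup > 0); the bigomega of HOL-Library.Landau_Symbols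
   is the stronger Knuth version, which requires an eventual lower bound. *)
definition is_Omega :: "(real \<Rightarrow> real) \<Rightarrow> (real \<Rightarrow> real) \<Rightarrow> bool" where
  "is_Omega F f \<longleftrightarrow> Limsup at_top (\<lambda>T. ereal (F T / f T)) > 0"

lemma nicely_meromorphic_eqI:
  assumes g: "g nicely_meromorphic_on UNIV" and h: "h nicely_meromorphic_on UNIV"
    and eq: "\<And>s. Re s > 1 \<Longrightarrow> g s = h s"
  shows "g = h"
proof
  fix z :: complex
  let ?d = "\<lambda>z. g z - h z"
  have gm: "g meromorphic_on UNIV" and hm: "h meromorphic_on UNIV"
    using g h by (auto simp: nicely_meromorphic_on_def)
  have dm: "?d meromorphic_on UNIV"
    using gm hm by (intro meromorphic_intros)
  have "eventually (\<lambda>s. s \<in> {s. Re s > 1}) (nhds 2)"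
    by (intro eventually_nhds_in_open open_halfspace_Re_gt) auto
  hence "eventually (\<lambda>s. ?d s = 0) (nhds 2)"
    by eventually_elim (auto simp: eq)
  hence "eventually (\<lambda>s. ?d s = 0) (at 2)"
    unfolding eventually_at_filter by (rule eventually_mono) simp
  hence "\<not> eventually (\<lambda>s. ?d s \<noteq> 0) (at 2)"
    using eventually_happens[OF eventually_conj[of "\<lambda>s. ?d s = 0" "at 2" "\<lambda>s. ?d s \<noteq> 0"]]
      trivial_limit_at[of "2 :: complex"] by blast
  hence "\<not> eventually (\<lambda>s. ?d s \<noteq> 0) (cosparse UNIV)"
    by (auto simp: eventually_cosparse_open_eq)
  hence "eventually (\<lambda>s. ?d s = 0) (cosparse UNIV)"
    using meromorphic_imp_constant_or_avoid[OF dm, of 0] by auto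
  hence ev: "eventually (\<lambda>s. g s = h s) (at z)"
    by (auto simp: eventually_cosparse_open_eq)
  have gz: "(is_pole g z \<and> g z = 0) \<or> g \<midarrow>z\<rightarrow> g z"
    and hz: "(is_pole h z \<and> h z = 0) \<or> h \<midarrow>z\<rightarrow> h z"
    using g h by (auto simp: nicely_meromorphic_on_def)
  have pole: "is_pole g z \<longleftrightarrow> is_pole h z"
    by (rule is_pole_cong[OF ev refl])
  have lim: "g \<midarrow>z\<rightarrow> c \<longleftrightarrow> h \<midarrow>z\<rightarrow> c" for c
    by (rule tendsto_cong[OF ev])
  show "g z = h z"
  proof (cases "is_pole g z")
    case True
    hence "\<not> g \<midarrow>z\<rightarrow> g z" "\<not> h \<midarrow>z\<rightarrow> h z"
      using pole unfolding is_pole_def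
      by (metis not_tendsto_and_filterlim_at_infinity trivial_limit_at)+
    with gz hz show ?thesis by simp
  next
    case False
    with gz hz pole lim have "g \<midarrow>z\<rightarrow> g z" "g \<midarrow>z\<rightarrow> h z" by blast+
    thus ?thesis by (rule LIM_unique)
  qed
qed

lemma halfplane_continuation_eqI:
  assumes "g nicely_meromorphic_on UNIV" and "\<And>s. Re s > 1 \<Longrightarrow> g s = f s"
  shows "halfplane_continuation f = g"
  unfolding halfplane_continuation_def
  by (rule the_equality) (use assms nicely_meromorphic_eqI in auto)

end

theory Submission
  imports Defs "HOL-Real_Asymp.Real_Asymp"
begin

text \<open>
  Put \<open>\<kappa> = \<lambda>(\<theta>) - \<epsilon>\<close> and \<open>f(x) = \<kappa> x\<^bsup>1/4\<^esup> \<mp> \<Delta>(x)\<close>, and suppose that \<open>f < 0\<close> holds in \<open>[T, 2T]\<close> only on a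
  set of measure at most \<open>T\<^bsup>1/2\<^esup>\<close> for large \<open>T\<close>. The summatory function is monotone and the main term
  has slope \<open>O(x\<^bsup>1/8\<^esup>)\<close>, so a value \<open>f(x) = -W\<close> forces \<open>f < 0\<close> on an interval of length about
  \<open>W x\<^bsup>-1/8\<^esup>\<close> to one side of \<open>x\<close>; hence \<open>f(x) \<ge> -C x\<^bsup>5/8\<^esup>\<close>, and the Mellin transform of the negative part
  of \<open>f\<close> is holomorphic in \<open>Re s > 1/8\<close>. The transform of \<open>f\<close> is
  \<open>\<kappa>/(s - 1/4) \<mp> (D(s)/s - polar parts)\<close>, which is regular at all real \<open>s > 1/4\<close>, so by Landau's theorem
  the transform \<open>F\<close> of the positive part converges for \<open>Re s > 1/4\<close>. There
  \<open>|F(s)| \<le> F(Re s)\<close>; comparing both sides at \<open>s = s\<^sub>0 + d\<close> as \<open>d \<rightarrow> 0\<close> gives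
  \<open>|Res D(s\<^sub>0)| / |s\<^sub>0| \<le> \<kappa>\<close>, which contradicts \<open>\<kappa> < \<lambda>(\<theta>)\<close>.
\<close>

section \<open>Laplace transforms of nonnegative functions\<close>

text \<open>Zeros of zeta(2s) may give D poles anywhere in 1/4 < Re s < 1/2, so the identities are
  carried in product form \<open>F * Q = N\<close> with \<open>Q\<close> holomorphic, and a division
  takes place only where \<open>Q\<close> is known not to vanish. Landau's theorem asks for
  regularity on the real axis alone, and (2s - 1) zeta(2s) has no zero at real s > 0. For the same
  reason the terms from the poles 1 +- i theta may enter with undetermined coefficients, whereas
  those from the double pole at 1 must be exact.

  The exponent 1/8 stands for any a in (0, 1/4), chosen to dominate a logarithm: slope O(x^a) gives
  f >= -C x^(1/2 + a), and over a set of measure O(T^(1/2)) in each [T, 2T] the integral of x^(1/2 +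
  a - c - 1) converges for c > a. The transform of the negative part is therefore regular on both
  sides of Re s = 1/4.

  No sign of \<open>\<kappa>\<close> is assumed: d F(1/4 + d) >= 0 tends to \<open>\<kappa>\<close>,
  which forces \<open>\<kappa> \<ge> 0\<close>. The order of the pole of D at s0 is not assumed
  either: the bound on d |D(s0 + d)| excludes a pole of higher order.\<close>

text \<open>Expanding exp(-(s - a) L) in powers of s - a, the absolute values of the terms add up to
  exp(-(Re a - |s - a|) L), which is at most the integrable exp(-b L). This one majorant justifies
  integration term by term, even on the closed disc that touches the line Re s = b.\<close>

lemma laplace_power_series:
  fixes M :: "'a measure" and L :: "'a \<Rightarrow> real" and a :: complex and b :: real
  assumes meas[measurable]: "L \<in> borel_measurable M" and nonneg: "\<And>w. L w \<ge> 0"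
    and int: "integrable M (\<lambda>w. exp (- b * L w))"
    and s: "norm (s - a) \<le> Re a - b"
  shows "(\<lambda>k. (\<integral>w. exp (- a * of_real (L w)) * (- of_real (L w)) ^ k /\<^sub>R fact k \<partial>M) * (s - a) ^ k)
           sums (\<integral>w. exp (- s * L w) \<partial>M)"
    and "integrable M (\<lambda>w. exp (- s * of_real (L w)))"
proof -
  define f where "f k w = exp (- a * L w) * (- L w * (s - a)) ^ k /\<^sub>R fact k" for k w
  have fn: "norm (f k w) = exp (- Re a * L w) * ((L w * norm (s - a)) ^ k / fact k)" for k w
    using nonneg[of w] unfolding f_def
    by (simp add: norm_mult norm_power norm_divide divide_inverse)
  have fn_sums: "(\<lambda>k. norm (f k w)) sums (exp (- Re a * L w) * exp (L w * norm (s - a)))" for w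
    unfolding fn using exp_converges[of "L w * norm (s - a)"]
    by (intro sums_mult) (simp add: divide_inverse mult.commute)
  have dom: "exp (- Re a * L w) * exp (L w * norm (s - a)) \<le> exp (- b * L w)" for w
  proof -
    have "L w * norm (s - a) \<le> L w * (Re a - b)"
      using nonneg[of w] s by (intro mult_left_mono) auto
    thus ?thesis unfolding exp_add[symmetric] by (simp add: algebra_simps)
  qed
  have part: "(\<Sum>k<n. norm (f k w)) \<le> exp (- b * L w)" for n w
    using sum_le_suminf[OF sums_summable[OF fn_sums[of w]], of "{..<n}"] dom[of w]
      sums_unique[OF fn_sums[of w]] by simp
  have fb: "norm (f k w) \<le> exp (- b * L w)" for k w
  proof -
    have "norm (f k w) \<le> (\<Sum>k<Suc k. norm (f k w))"
      by (simp add: sum_nonneg)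
    thus ?thesis using part[of w "Suc k"] by linarith
  qed
  have [measurable]: "f k \<in> borel_measurable M" for k
    unfolding f_def by measurable
  have fi: "integrable M (f k)" for k
    by (rule Bochner_Integration.integrable_bound[OF int]) (use fb in auto)
  have ae: "AE w in M. summable (\<lambda>k. norm (f k w))"
    using fn_sums sums_summable by blast
  have sm: "summable (\<lambda>k. \<integral>w. norm (f k w) \<partial>M)"
  proof (rule summableI_nonneg_bounded)
    fix n
    have "(\<Sum>k<n. \<integral>w. norm (f k w) \<partial>M) = (\<integral>w. (\<Sum>k<n. norm (f k w)) \<partial>M)"
      using fi by (subst Bochner_Integration.integral_sum) auto
    also have "\<dots> \<le> (\<integral>w. exp (- b * L w) \<partial>M)"
      using fi int part by (intro integral_mono Bochner_Integration.integrable_sum) auto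
    finally show "(\<Sum>k<n. \<integral>w. norm (f k w) \<partial>M) \<le> (\<integral>w. exp (- b * L w) \<partial>M)" .
  qed auto
  have sumf: "(\<Sum>k. f k w) = exp (- s * L w)" for w
  proof -
    have "(\<lambda>k. f k w) sums (exp (- a * L w) * exp (- L w * (s - a)))"
      unfolding f_def using exp_converges[of "- complex_of_real (L w) * (s - a)"]
      by (simp flip: mult_scaleR_right) (intro sums_mult)
    also have "exp (- a * L w) * exp (- L w * (s - a)) = exp (- s * L w)"
      unfolding exp_add[symmetric] by (simp add: algebra_simps)
    finally show ?thesis by (rule sums_unique[symmetric])
  qed
  have *: "integral\<^sup>L M (f k) = (\<integral>w. exp (- a * of_real (L w)) * (- of_real (L w)) ^ k /\<^sub>R fact k \<partial>M) * (s - a) ^ k" for k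
  proof -
    have "f k = (\<lambda>w. (exp (- a * of_real (L w)) * (- of_real (L w)) ^ k /\<^sub>R fact k) * (s - a) ^ k)"
      unfolding f_def power_mult_distrib by (simp add: scaleR_conv_of_real mult_ac)
    thus ?thesis by (simp only: integral_mult_left_zero)
  qed
  show "(\<lambda>k. (\<integral>w. exp (- a * of_real (L w)) * (- of_real (L w)) ^ k /\<^sub>R fact k \<partial>M) * (s - a) ^ k)
           sums (\<integral>w. exp (- s * L w) \<partial>M)"
    using sums_integral[OF fi ae sm] unfolding sumf * .
  show "integrable M (\<lambda>w. exp (- s * of_real (L w)))"
    using integrable_suminf[OF fi ae sm] unfolding sumf .
qed

lemma power_div_fact_le_exp:
  fixes x :: real
  assumes "x \<ge> 0"
  shows "x ^ k / fact k \<le> exp x"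
proof -
  have "(\<Sum>n\<in>{k}. x ^ n /\<^sub>R fact n) \<le> (\<Sum>n. x ^ n /\<^sub>R fact n)"
    by (rule sum_le_suminf[OF summable_exp_generic]) (use assms in auto)
  thus ?thesis by (simp add: exp_def divide_inverse_commute)
qed

lemma laplace_mono:
  fixes M :: "'a measure" and L :: "'a \<Rightarrow> real"
  assumes "L \<in> borel_measurable M" "\<And>w. L w \<ge> 0"
    and "integrable M (\<lambda>w. exp (- b * L w))" and "b \<le> c"
  shows "integrable M (\<lambda>w. exp (- c * L w))"
  using assms by (intro Bochner_Integration.integrable_bound[OF assms(3)]) (auto intro!: mult_right_mono)

text \<open>Holomorphy is read off the local power series: around z the radius r = (Re z - b) / 2
  leaves the exponent Re z - r > b for the majorant.\<close>

lemma laplace_holomorphic: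
  fixes M :: "'a measure" and L :: "'a \<Rightarrow> real"
  assumes "L \<in> borel_measurable M" "\<And>w. L w \<ge> 0"
    and "\<And>c. c > b \<Longrightarrow> integrable M (\<lambda>w. exp (- c * L w))"
  shows "(\<lambda>s. \<integral>w. exp (- s * of_real (L w)) \<partial>M) holomorphic_on {s. Re s > b}"
proof (rule holomorphic_onI)
  fix z :: complex assume z: "z \<in> {s. Re s > b}"
  define r where "r = (Re z - b) / 2"
  have r: "r > 0" "Re z - r > b" using z unfolding r_def by (auto simp: field_simps)
  have "(\<lambda>s. \<integral>w. exp (- s * of_real (L w)) \<partial>M) holomorphic_on ball z r"
    by (rule power_series_holomorphic[OF laplace_power_series(1)[OF assms(1,2) assms(3)[OF r(2)]]])
      (auto simp: dist_norm norm_minus_commute)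
  hence "(\<lambda>s. \<integral>w. exp (- s * of_real (L w)) \<partial>M) field_differentiable at z"
    using r by (auto simp: holomorphic_on_open field_differentiable_def)
  thus "(\<lambda>s. \<integral>w. exp (- s * of_real (L w)) \<partial>M) field_differentiable at z within {s. Re s > b}"
    using field_differentiable_at_within by blast
qed


text \<open>The product form allows zeros of \<open>Q\<close> in the half-plane. The real points to
  the right of \<open>x0\<close> accumulate at \<open>x0\<close>, so the identity theorem spreads
  the equation from the real ray.\<close>

lemma holomorphic_quotient_identity:
  fixes F Q N :: "complex \<Rightarrow> complex"
  assumes "F holomorphic_on {s. Re s > c}" "Q holomorphic_on {s. Re s > c}"
    and "N holomorphic_on {s. Re s > c}"
    and eq: "\<And>x. x > b \<Longrightarrow> F (of_real x) * Q (of_real x) = N (of_real x)"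
    and s: "Re s > c"
  shows "F s * Q s = N s"
proof -
  define x0 where "x0 = max b c + 1"
  have "(of_real x0 :: complex) islimpt (of_real ` {x0..})"
  proof (rule islimpt_sequential[THEN iffD2], intro exI conjI allI)
    show "(complex_of_real (x0 + inverse (real (Suc n)))) \<in> of_real ` {x0..} - {of_real x0}" for n
      by (auto simp del: of_real_add of_real_inverse)
    have "(\<lambda>n. x0 + inverse (real (Suc n))) \<longlonglongrightarrow> x0 + 0"
      by (intro tendsto_intros LIMSEQ_inverse_real_of_nat)
    thus "(\<lambda>n. complex_of_real (x0 + inverse (real (Suc n)))) \<longlonglongrightarrow> complex_of_real x0"
      by (intro tendsto_of_real) auto
  qed
  hence "F s * Q s - N s = 0"
  proof (rule analytic_continuation[rotated 5, where f = "\<lambda>s. F s * Q s - N s" and S = "{s. Re s > c}"])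
    show "of_real ` {x0..} \<subseteq> {s. Re s > c}" "complex_of_real x0 \<in> {s. Re s > c}"
      by (auto simp: x0_def)
    show "F w * Q w - N w = 0" if "w \<in> of_real ` {x0..}" for w
      using that eq by (auto simp: x0_def)
    show "(\<lambda>s. F s * Q s - N s) holomorphic_on {s. c < Re s}"
      by (intro holomorphic_intros assms)
    show "connected {s. c < Re s}"
      by (intro convex_connected convex_halfspace_Re_gt)
  qed (use s in \<open>auto intro: open_halfspace_Re_gt\<close>)
  thus ?thesis by simp
qed

text \<open>Landau's theorem: a nonnegative integral converges up to its first real singularity.
  The expansion of the continuation about a point to the right of the abscissa has terms of one
  sign at real points to the left, so it can be integrated back term by term.\<close>

theorem landau_laplace:
  fixes M :: "'a measure" and L :: "'a \<Rightarrow> real" and N Q :: "complex \<Rightarrow> complex"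
  defines "F \<equiv> \<lambda>s. \<integral>w. exp (- s * of_real (L w)) \<partial>M"
  assumes meas[measurable]: "L \<in> borel_measurable M" and nonneg: "\<And>w. L w \<ge> 0"
    and int: "\<And>c. c > b \<Longrightarrow> integrable M (\<lambda>w. exp (- c * L w))"
    and N: "N holomorphic_on {s. Re s > \<alpha>}" and Q: "Q holomorphic_on {s. Re s > \<alpha>}"
    and eq: "\<And>x. x > b \<Longrightarrow> F (of_real x) * Q (of_real x) = N (of_real x)"
    and reg: "\<And>x. x > \<alpha> \<Longrightarrow> \<exists>h. h analytic_on {of_real x} \<and>
                (\<forall>\<^sub>F s in at (of_real x). Q s \<noteq> 0 \<and> h s = N s / Q s)"
    and x: "x > \<alpha>"
  shows "integrable M (\<lambda>w. exp (- x * L w))"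
proof (rule ccontr)
  assume x_not: "\<not> integrable M (\<lambda>w. exp (- x * L w))"
  \<comment> \<open>\<open>c\<close> is the abscissa of convergence. Divergence at \<open>x\<close>
    gives c >= x > \<open>\<alpha>\<close>, so \<open>reg\<close> applies at \<open>c\<close>
    itself.\<close>
  define B where "B = {c. c \<ge> x \<and> integrable M (\<lambda>w. exp (- c * L w))}"
  define c where "c = Inf B"
  have B_ne: "max x b + 1 \<in> B" unfolding B_def by (rule CollectI, intro conjI int) auto
  have B_bdd: "bdd_below B" unfolding B_def by (auto intro: bdd_belowI[of _ x])
  have cx: "c \<ge> x" unfolding c_def by (rule cInf_greatest) (use B_ne B_def in auto)
  have above: "integrable M (\<lambda>w. exp (- d * L w))" if "d > c" for d
  proof -
    have "B \<noteq> {}" using B_ne by blast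
    from cInf_lessD[OF this that[unfolded c_def]] obtain e where "e \<in> B" "e < d" ..
    thus ?thesis using laplace_mono[OF meas nonneg, of e d] by (auto simp: B_def)
  qed
  have below: "\<not> integrable M (\<lambda>w. exp (- d * L w))" if "d < c" for d
  proof
    assume d: "integrable M (\<lambda>w. exp (- d * L w))"
    show False
    proof (cases "d \<ge> x")
      case True
      hence "d \<in> B" using d by (auto simp: B_def)
      hence "c \<le> d" unfolding c_def using B_bdd by (rule cInf_lower)
      thus False using that by simp
    next
      case False
      thus False using laplace_mono[OF meas nonneg d, of x] x_not by auto
    qed
  qed
  have c\<alpha>: "c > \<alpha>" using cx x by simp
  have Fhol: "F holomorphic_on {s. Re s > c}"
    unfolding F_def by (rule laplace_holomorphic[OF meas nonneg above])
  have FQ: "F s * Q s = N s" if "Re s > c" for s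
    by (rule holomorphic_quotient_identity[OF Fhol _ _ eq that])
      (use c\<alpha> in \<open>auto intro: holomorphic_on_subset[OF N] holomorphic_on_subset[OF Q]\<close>)
  obtain h where h: "h analytic_on {of_real c}"
    and hev: "\<forall>\<^sub>F s in at (of_real c). Q s \<noteq> 0 \<and> h s = N s / Q s"
    using reg[OF c\<alpha>] by blast
  obtain r1 where r1: "r1 > 0" "h holomorphic_on ball (of_real c) r1"
    using h by (auto simp: analytic_on_def)
  obtain r2 where r2: "r2 > 0"
      "\<And>s. s \<noteq> of_real c \<Longrightarrow> dist s (of_real c) < r2 \<Longrightarrow> Q s \<noteq> 0 \<and> h s = N s / Q s"
    using hev unfolding eventually_at by auto
  define r where "r = min r1 r2"
  \<comment> \<open>The disc of radius 3r/4 about \<open>a\<close> lies in the regular disc about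
    \<open>c\<close> and reaches left to c - r/2. The disc of radius r/8 about \<open>a\<close>
    stays in Re s > c, where the integral represents \<open>h\<close>.\<close>
  define a where "a = c + r / 4"
  have r: "r > 0" using r1 r2 by (auto simp: r_def)
  have sub: "ball (of_real a) (3 * r / 4) \<subseteq> ball (complex_of_real c) r"
  proof
    fix z assume "z \<in> ball (complex_of_real a) (3 * r / 4)"
    moreover have "dist (complex_of_real c) (complex_of_real a) = r / 4"
      using r by (simp add: a_def dist_norm)
    ultimately show "z \<in> ball (complex_of_real c) r"
      using dist_triangle[of "complex_of_real c" z "complex_of_real a"] r by simp
  qed
  have hhol: "h holomorphic_on ball (of_real a) (3 * r / 4)"
    using r1(2) sub by (rule_tac holomorphic_on_subset) (auto simp: r_def)
  have Fh: "F z = h z" if "z \<in> ball (of_real a) (r / 8)" for z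
  proof -
    have z: "Re z > c"
      using that abs_Re_le_cmod[of "of_real a - z"] r by (auto simp: a_def dist_norm)
    have "z \<in> ball (of_real a) (3 * r / 4)" using that r by simp
    hence "z \<in> ball (of_real c) r" using sub by blast
    hence "Q z \<noteq> 0 \<and> h z = N z / Q z"
      using z by (intro r2(2)) (auto simp: r_def dist_commute)
    thus ?thesis using FQ[OF z] by (auto simp: field_simps)
  qed
  define co :: "nat \<Rightarrow> complex" where "co k = (\<integral>w. exp (- of_real a * of_real (L w)) * (- of_real (L w)) ^ k /\<^sub>R fact k \<partial>M)" for k
  define co' where "co' k = (deriv ^^ k) h (of_real a) / fact k" for k :: nat
  \<comment> \<open>The Taylor coefficients of \<open>h\<close>, valid on the large disc, and the
    integral coefficients, valid on the small one, coincide by uniqueness of expansions.\<close>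
  have "(\<lambda>u. h (of_real a + u)) has_fps_expansion Abs_fps co'"
  proof (rule has_fps_expansionI)
    have "\<forall>\<^sub>F u in nhds 0. u \<in> ball (0::complex) (3 * r / 4)"
      using r by (intro eventually_nhds_in_open) auto
    thus "\<forall>\<^sub>F u in nhds 0. (\<lambda>n. fps_nth (Abs_fps co') n * u ^ n) sums h (of_real a + u)"
    proof eventually_elim
      case (elim u)
      thus ?case using holomorphic_power_series[OF hhol, of "of_real a + u"]
        by (simp add: co'_def dist_norm)
    qed
  qed
  moreover have "(\<lambda>u. h (of_real a + u)) has_fps_expansion Abs_fps co"
  proof (rule has_fps_expansionI)
    have "\<forall>\<^sub>F u in nhds 0. u \<in> ball (0::complex) (r / 8)"
      using r by (intro eventually_nhds_in_open) auto
    thus "\<forall>\<^sub>F u in nhds 0. (\<lambda>n. fps_nth (Abs_fps co) n * u ^ n) sums h (of_real a + u)"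
    proof eventually_elim
      case (elim u)
      have "(\<lambda>k. co k * ((of_real a + u) - of_real a) ^ k) sums F (of_real a + u)"
        unfolding co_def F_def
      proof (rule laplace_power_series(1)[OF meas nonneg])
        show "integrable M (\<lambda>w. exp (- (c + r / 8) * L w))" using r by (intro above) simp
      qed (use elim r in \<open>auto simp: a_def\<close>)
      thus ?case using Fh[of "of_real a + u"] elim by (simp add: dist_norm)
    qed
  qed
  ultimately have "Abs_fps co' = Abs_fps co"
    by (rule fps_expansion_unique_complex)
  hence co': "co' = co" by (simp add: fun_eq_iff fps_eq_iff)
  \<comment> \<open>These are the terms of the expansion at a - r/2 = c - r/4, a point left of the
    abscissa: the signs of (-L)^k and (-r/2)^k cancel, so every term is nonnegative.\<close>
  define f where "f k w = exp (- a * L w) * (L w * (r / 2)) ^ k / fact k" for k w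
  have f0: "f k w \<ge> 0" for k w using nonneg[of w] r by (auto simp: f_def)
  have fi: "integrable M (f k)" for k
  proof (rule Bochner_Integration.integrable_bound)
    \<comment> \<open>The factor 4 is (r/2) / (r/8): the power of L r/8 is absorbed by exp(L r/8),
      and a - r/8 = c + r/8 is still an exponent of convergence.\<close>
    show "integrable M (\<lambda>w. 4 ^ k * exp (- (c + r / 8) * L w))"
      using r by (intro integrable_mult_right above) auto
    show "f k \<in> borel_measurable M" unfolding f_def by measurable
    have "norm (f k w) \<le> norm (4 ^ k * exp (- (c + r / 8) * L w))" for w
    proof -
      have "(L w * (r / 8)) ^ k / fact k \<le> exp (L w * (r / 8))"
        using nonneg[of w] r by (intro power_div_fact_le_exp) simp
      hence "exp (- a * L w) * (4 ^ k * ((L w * (r / 8)) ^ k / fact k))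
          \<le> exp (- a * L w) * (4 ^ k * exp (L w * (r / 8)))"
        by (intro mult_left_mono) auto
      moreover have "(L w * (r / 2)) ^ k = 4 ^ k * (L w * (r / 8)) ^ k"
        unfolding power_mult_distrib[symmetric] by (simp add: mult_ac)
      ultimately have "f k w \<le> exp (- a * L w) * (4 ^ k * exp (L w * (r / 8)))"
        unfolding f_def by simp
      also have "\<dots> = 4 ^ k * exp (- (c + r / 8) * L w)"
        by (simp add: a_def algebra_simps flip: exp_add)
      finally show ?thesis using f0[of k w] by simp
    qed
    thus "AE w in M. norm (f k w) \<le> norm (4 ^ k * exp (- (c + r / 8) * L w))" by blast
  qed
  have fsum: "(\<lambda>k. f k w) sums exp (- (c - r / 4) * L w)" for w
  proof -
    have "f k w = exp (- a * L w) * ((L w * (r / 2)) ^ k /\<^sub>R fact k)" for k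
      unfolding f_def real_scaleR_def divide_inverse by (simp only: mult_ac)
    hence "(\<lambda>k. f k w) sums (exp (- a * L w) * exp (L w * (r / 2)))"
      using sums_mult[OF exp_converges[of "L w * (r / 2)"], of "exp (- a * L w)"] by presburger
    also have "exp (- a * L w) * exp (L w * (r / 2)) = exp (- (c - r / 4) * L w)"
      unfolding exp_add[symmetric] by (simp add: a_def algebra_simps)
    finally show ?thesis .
  qed
  have co_f: "co k * (- of_real (r / 2)) ^ k = of_real (integral\<^sup>L M (f k))" for k
  proof -
    have "of_real (integral\<^sup>L M (f k)) = (\<integral>w. complex_of_real (f k w) \<partial>M)"
      by simp
    also have "\<dots> = (\<integral>w. (exp (- of_real a * of_real (L w)) * (- of_real (L w)) ^ k /\<^sub>R fact k) * (- of_real (r / 2)) ^ k \<partial>M)"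
    proof (rule Bochner_Integration.integral_cong[OF refl])
      fix w
      have 1: "(- complex_of_real (L w)) ^ k * (- complex_of_real (r / 2)) ^ k = of_real ((L w * (r / 2)) ^ k)"
        unfolding power_mult_distrib[symmetric] by simp
      have 2: "exp (- of_real a * complex_of_real (L w)) = of_real (exp (- a * L w))"
        by (simp flip: exp_of_real)
      have "(exp (- of_real a * of_real (L w)) * (- complex_of_real (L w)) ^ k /\<^sub>R fact k) * (- of_real (r / 2)) ^ k
          = exp (- of_real a * of_real (L w)) * ((- of_real (L w)) ^ k * (- of_real (r / 2)) ^ k) /\<^sub>R fact k"
        by (simp only: scaleR_conv_of_real mult_ac)
      also have "\<dots> = of_real (f k w)"
        unfolding 1 2 f_def scaleR_conv_of_real by (simp add: field_simps)
      finally show "complex_of_real (f k w) = (exp (- of_real a * of_real (L w)) * (- of_real (L w)) ^ k /\<^sub>R fact k) * (- of_real (r / 2)) ^ k" ..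
    qed
    also have "\<dots> = co k * (- of_real (r / 2)) ^ k"
      unfolding co_def by (rule integral_mult_left_zero)
    finally show ?thesis by simp
  qed
  have "(\<lambda>n. co n * (- of_real (r / 2)) ^ n) sums h (of_real a - of_real (r / 2))"
    using holomorphic_power_series[OF hhol, of "of_real a - of_real (r / 2)"] r
    unfolding co'_def[symmetric] co' by (simp add: dist_norm)
  hence "summable (\<lambda>k. complex_of_real (integral\<^sup>L M (f k)))"
    unfolding co_f by (rule sums_summable)
  hence "summable (\<lambda>k. integral\<^sup>L M (f k))"
    by (subst (asm) summable_of_real_iff)
  \<comment> \<open>Since the terms are nonnegative, convergence of the sum of their integrals makes
    their pointwise sum integrable, which is exp(-(c - r/4) L): a contradiction to the choice of
    \<open>c\<close>.\<close>
  hence "summable (\<lambda>k. \<integral>w. norm (f k w) \<partial>M)"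
    using f0 by simp
  moreover have "AE w in M. summable (\<lambda>k. norm (f k w))"
    using fsum f0 by (auto intro!: sums_summable)
  ultimately have "integrable M (\<lambda>w. \<Sum>k. f k w)"
    using fi by (intro integrable_suminf)
  hence "integrable M (\<lambda>w. exp (- (c - r / 4) * L w))"
    using fsum[THEN sums_unique] by simp
  thus False using below[of "c - r / 4"] r by auto
qed

section \<open>Functions with sparse negative set\<close>

text \<open>Dyadic decomposition: the block [2^k, 2^(k+1)] contributes at most 2^(-qk) times K
  2^(k/2), a geometric series of ratio 2^(1/2 - q) < 1.\<close>

lemma sparse_set_powr_integrable:
  fixes A :: "real set" and K q :: real
  assumes [measurable]: "A \<in> sets borel" and A: "A \<subseteq> {1..}" and q: "q > 1 / 2"
    and sparse: "\<And>T. T \<ge> 1 \<Longrightarrow> measure lborel (A \<inter> {T..2 * T}) \<le> K * T powr (1 / 2)"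
  shows "integrable lborel (\<lambda>x. indicator A x * x powr - q)"
proof (rule integrableI_nonneg)
  define r where "r = (2::real) powr (1 / 2 - q)"
  have r: "0 < r" "r < 1"
    using q by (auto simp: r_def powr_less_one)
  have K: "K \<ge> 0"
    using order_trans[OF measure_nonneg sparse[of 1]] by simp
  have cover: "ennreal (indicator A x * x powr - q)
      \<le> (\<Sum>k. ennreal (2 powr (- q * real k)) * indicator (A \<inter> {2 ^ k..2 * 2 ^ k}) x)" for x
  proof (cases "x \<in> A")
    case True
    hence x: "x \<ge> 1" using A by auto
    define k where "k = nat \<lfloor>log 2 x\<rfloor>"
    have lx: "log 2 x \<ge> 0" using x by simp
    have "2 powr real k \<le> x" "x < 2 powr (real k + 1)"
      using x lx by (auto simp: k_def powr_le_iff less_powr_iff)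
    hence k: "2 ^ k \<le> x" "x \<le> 2 * 2 ^ k"
      by (auto simp: powr_realpow powr_add)
    have "x powr - q \<le> (2 ^ k) powr - q"
      using k(1) q by (intro powr_mono2') auto
    also have "(2 ^ k) powr - q = 2 powr (- q * real k)"
      by (simp add: powr_realpow[symmetric] powr_powr mult.commute)
    finally have "ennreal (x powr - q) \<le> ennreal (2 powr (- q * real k))"
      by (rule ennreal_leI)
    also have "\<dots> = ennreal (2 powr (- q * real k)) * indicator (A \<inter> {2 ^ k..2 * 2 ^ k}) x"
      using True k by simp
    also have "\<dots> = sum (\<lambda>k. ennreal (2 powr (- q * real k)) * indicator (A \<inter> {2 ^ k..2 * 2 ^ k}) x) {k}"
      by (subst sum.insert) (simp_all only: finite.emptyI empty_iff not_False_eq_True sum.empty add_0_right)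
    also have "\<dots> \<le> (\<Sum>k. ennreal (2 powr (- q * real k)) * indicator (A \<inter> {2 ^ k..2 * 2 ^ k}) x)"
      by (rule sum_le_suminf) auto
    finally show ?thesis using True by simp
  qed auto
  have block: "ennreal (2 powr (- q * real k)) * emeasure lborel (A \<inter> {2 ^ k..2 * 2 ^ k})
      \<le> ennreal (K * r ^ k)" for k
  proof -
    have fin: "emeasure lborel (A \<inter> {2 ^ k..2 * 2 ^ k}) \<noteq> \<infinity>"
      using emeasure_mono[of "A \<inter> {2 ^ k..2 * 2 ^ k}" "{2 ^ k..2 * 2 ^ k::real}" lborel]
      by (auto simp: top_unique)
    have "measure lborel (A \<inter> {2 ^ k..2 * 2 ^ k}) \<le> K * (2 ^ k) powr (1 / 2)"
      by (rule sparse) simp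
    also have "(2 ^ k) powr (1 / 2) = (2::real) powr (real k / 2)"
      by (simp add: powr_realpow[symmetric] powr_powr)
    finally have "2 powr (- q * real k) * measure lborel (A \<inter> {2 ^ k..2 * 2 ^ k})
        \<le> 2 powr (- q * real k) * (K * 2 powr (real k / 2))"
      by (intro mult_left_mono) auto
    also have "\<dots> = K * (2 powr (- q * real k) * 2 powr (real k / 2))"
      by simp
    also have "2 powr (- q * real k) * 2 powr (real k / 2) = r ^ k"
      unfolding r_def by (simp add: powr_power algebra_simps flip: powr_add)
    finally show ?thesis
      using fin by (simp add: emeasure_eq_ennreal_measure ennreal_mult[symmetric] ennreal_leI)
  qed
  have "(\<integral>\<^sup>+x. ennreal (indicator A x * x powr - q) \<partial>lborel)
      \<le> (\<integral>\<^sup>+x. (\<Sum>k. ennreal (2 powr (- q * real k)) * indicator (A \<inter> {2 ^ k..2 * 2 ^ k}) x) \<partial>lborel)"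
    by (intro nn_integral_mono cover)
  also have "\<dots> = (\<Sum>k. \<integral>\<^sup>+x. ennreal (2 powr (- q * real k)) * indicator (A \<inter> {2 ^ k..2 * 2 ^ k}) x \<partial>lborel)"
    by (intro nn_integral_suminf) measurable
  also have "\<dots> = (\<Sum>k. ennreal (2 powr (- q * real k)) * emeasure lborel (A \<inter> {2 ^ k..2 * 2 ^ k}))"
    by (subst nn_integral_cmult_indicator) auto
  also have "\<dots> \<le> (\<Sum>k. ennreal (K * r ^ k))"
    by (intro suminf_le block) auto
  also have "\<dots> = ennreal (\<Sum>k. K * r ^ k)"
    using r K by (intro suminf_ennreal2 summable_mult summable_geometric) auto
  also have "\<dots> < \<infinity>" by simp
  finally show "(\<integral>\<^sup>+x. ennreal (indicator A x * x powr - q) \<partial>lborel) < \<infinity>" .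
qed auto

text \<open>If \<open>f\<close> cannot increase quickly in one direction, then a very negative value persists over a
  long interval.\<close>

lemma sparse_negative_set_lower_bound:
  fixes f :: "real \<Rightarrow> real" and \<sigma> B K :: real
  defines "A \<equiv> {x. x \<ge> 1 \<and> f x < 0}"
  assumes [measurable]: "f \<in> borel_measurable borel" and B: "B > 0"
    and \<sigma>: "\<sigma> = 1 \<or> \<sigma> = -1"
    and slope: "\<And>x y. x \<ge> 2 \<Longrightarrow> x / 2 \<le> y \<Longrightarrow> y \<le> 2 * x \<Longrightarrow> \<sigma> * (y - x) \<ge> 0 \<Longrightarrow>
                  f y \<le> f x + B * x powr (1 / 8) * \<bar>y - x\<bar>"
    and local: "\<And>X. \<exists>C. \<forall>x\<in>{1..X}. f x \<ge> - C"
    and sparse: "\<And>T. T \<ge> 1 \<Longrightarrow> measure lborel (A \<inter> {T..2 * T}) \<le> K * T powr (1 / 2)"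
  obtains C where "C \<ge> 0" "\<And>x. x \<ge> 1 \<Longrightarrow> f x \<ge> - C * x powr (5 / 8)"
proof -
  \<comment> \<open>Beyond (2K)^2 one has K x^(1/2) < x/2, so the interval length
    \<open>\<delta>\<close> cannot be its cap x/2 and must be the quantity proportional to
    W.\<close>
  define X where "X = max 2 ((2 * K)\<^sup>2)"
  obtain C0 where C0: "\<And>x. x \<in> {1..X} \<Longrightarrow> f x \<ge> - C0" using local by blast
  have K: "K \<ge> 0"
    using order_trans[OF measure_nonneg sparse[of 1]] by simp
  define C where "C = max \<bar>C0\<bar> (2 * B * K)"
  have [measurable]: "A \<in> sets borel" unfolding A_def by measurable
  have main: "f x \<ge> - (2 * B * K) * x powr (5 / 8)" if x: "x > X" for x
  proof (rule ccontr)
    assume neg: "\<not> f x \<ge> - (2 * B * K) * x powr (5 / 8)"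
    have x2: "x > 2" "x > (2 * K)\<^sup>2" using x by (auto simp: X_def)
    define W where "W = - f x"
    have W: "W > 2 * B * K * x powr (5 / 8)" using neg by (simp add: W_def)
    hence W0: "W > 0" using B K by (smt (verit) mult_nonneg_nonneg powr_ge_zero)
    \<comment> \<open>Over this length f rises by at most W/2 and stays negative; the cap x/2 keeps
      the interval where \<open>slope\<close> applies.\<close>
    define \<delta> where "\<delta> = min (x / 2) (W / (2 * B * x powr (1 / 8)))"
    \<comment> \<open>\<open>J\<close> lies on the side of \<open>x\<close> on which growth is
      controlled, and \<open>T\<close> is chosen so that \<open>J\<close> falls into a single block
      [T, 2T].\<close>
    define J where "J = (if \<sigma> = 1 then {x..x + \<delta>} else {x - \<delta>..x})"
    define T where "T = (if \<sigma> = 1 then x else x / 2)"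
    have \<delta>0: "\<delta> > 0" using x2 W0 B by (auto simp: \<delta>_def)
    have \<delta>x: "\<delta> \<le> x / 2" by (auto simp: \<delta>_def)
    have \<delta>W: "B * x powr (1 / 8) * \<delta> \<le> W / 2"
    proof -
      have "B * x powr (1 / 8) * \<delta> \<le> B * x powr (1 / 8) * (W / (2 * B * x powr (1 / 8)))"
        using B by (intro mult_left_mono) (auto simp: \<delta>_def)
      also have "\<dots> = W / 2" using B x2 by (simp add: field_simps)
      finally show ?thesis .
    qed
    have J_neg: "f y < 0" if y: "y \<in> J" for y
    proof -
      have "f y \<le> f x + B * x powr (1 / 8) * \<bar>y - x\<bar>"
        using y \<delta>x \<delta>0 x2 \<sigma> by (intro slope) (auto simp: J_def split: if_splits)
      also have "B * x powr (1 / 8) * \<bar>y - x\<bar> \<le> B * x powr (1 / 8) * \<delta>"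
        using y B by (intro mult_left_mono) (auto simp: J_def split: if_splits)
      finally show ?thesis using \<delta>W W0 by (simp add: W_def)
    qed
    have sub: "J \<subseteq> A \<inter> {T..2 * T}"
      using J_neg x2 \<delta>x \<delta>0 by (auto simp: J_def T_def A_def split: if_splits)
    have "\<delta> = measure lborel J" using \<delta>0 by (auto simp: J_def)
    also have "\<dots> \<le> measure lborel (A \<inter> {T..2 * T})"
    proof (rule measure_mono_fmeasurable[OF sub])
      show "A \<inter> {T..2 * T} \<in> fmeasurable lborel"
        by (rule fmeasurableI2[of "{T..2 * T}"]) (use x2 \<delta>0 in \<open>auto simp: fmeasurable_def T_def\<close>)
    qed (auto simp: J_def)
    also have "\<dots> \<le> K * T powr (1 / 2)" using x2 by (intro sparse) (auto simp: T_def)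
    also have "\<dots> \<le> K * x powr (1 / 2)"
      using x2 K by (intro mult_left_mono powr_mono2) (auto simp: T_def)
    finally have \<delta>le: "\<delta> \<le> K * x powr (1 / 2)" .
    have "K * x powr (1 / 2) < x / 2"
    proof -
      have "2 * K < sqrt x" using x2 by (intro real_less_rsqrt) auto
      hence "2 * K * sqrt x < sqrt x * sqrt x" using x2 by (intro mult_strict_right_mono) auto
      thus ?thesis using x2 by (simp add: powr_half_sqrt)
    qed
    hence "W / (2 * B * x powr (1 / 8)) \<le> K * x powr (1 / 2)"
      using \<delta>le by (auto simp: \<delta>_def min_def split: if_splits)
    hence "W \<le> K * x powr (1 / 2) * (2 * B * x powr (1 / 8))"
      using B x2 by (simp add: pos_divide_le_eq)
    also have "\<dots> = 2 * B * K * (x powr (1 / 2) * x powr (1 / 8))" by simp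
    also have "x powr (1 / 2) * x powr (1 / 8) = x powr (5 / 8)"
      by (simp flip: powr_add)
    finally show False using W by simp
  qed
  have "f x \<ge> - C * x powr (5 / 8)" if x: "x \<ge> 1" for x
  proof (cases "x > X")
    case True
    have "2 * B * K * x powr (5 / 8) \<le> C * x powr (5 / 8)"
      by (intro mult_right_mono) (auto simp: C_def)
    thus ?thesis using main[OF True] by simp
  next
    case False
    have "1 \<le> x powr (5 / 8)" using x by (simp add: ge_one_powr_ge_zero)
    hence "\<bar>C0\<bar> * 1 \<le> C * x powr (5 / 8)" by (intro mult_mono) (auto simp: C_def)
    thus ?thesis using C0[of x] x False by auto
  qed
  moreover have "C \<ge> 0" by (simp add: C_def)
  ultimately show ?thesis using that by blast
qed


text \<open>This is the analytic core: a sparse negative set makes the pole \<open>\<kappa>\<close>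
  at 1/4 dominate the growth of P/Q towards any other point 1/4 + i t0. The assumption
  \<open>reg\<close> includes the endpoint 1/4 because P/Q must stay bounded there when d F(1/4 + d)
  is evaluated in the limit; nothing is assumed about P/Q off the real axis.\<close>

lemma one_sided_pole_bound:
  fixes f :: "real \<Rightarrow> real" and P Q :: "complex \<Rightarrow> complex" and \<kappa> t0 \<sigma> B K e :: real
  assumes [measurable]: "f \<in> borel_measurable borel" and B: "B > 0"
    and \<sigma>: "\<sigma> = 1 \<or> \<sigma> = -1"
    and slope: "\<And>x y. x \<ge> 2 \<Longrightarrow> x / 2 \<le> y \<Longrightarrow> y \<le> 2 * x \<Longrightarrow> \<sigma> * (y - x) \<ge> 0 \<Longrightarrow>
                  f y \<le> f x + B * x powr (1 / 8) * \<bar>y - x\<bar>"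
    and local: "\<And>X. \<exists>C. \<forall>x\<in>{1..X}. f x \<ge> - C"
    and sparse: "\<And>T. T \<ge> 1 \<Longrightarrow>
                   measure lborel ({x. x \<ge> 1 \<and> f x < 0} \<inter> {T..2 * T}) \<le> K * T powr (1 / 2)"
    and int: "\<And>c. c > 1 \<Longrightarrow> set_integrable lborel {1..} (\<lambda>x. f x * x powr (- c - 1))"
    and mellin: "\<And>c. c > 1 \<Longrightarrow> of_real (LINT x:{1..}|lborel. f x * x powr (- c - 1)) * Q (of_real c)
                   = of_real \<kappa> / (of_real c - 1 / 4) * Q (of_real c) + P (of_real c)"
    and P: "P holomorphic_on {s. Re s > 1 / 8}" and Q: "Q holomorphic_on {s. Re s > 1 / 8}"
    and reg: "\<And>x. x \<ge> 1 / 4 \<Longrightarrow> \<exists>h. h analytic_on {of_real x} \<and>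
                (\<forall>\<^sub>F s in at (of_real x). Q s \<noteq> 0 \<and> h s = P s / Q s)"
    and t0: "t0 > 0" and e: "e > 0"
  shows "\<forall>\<^sub>F d in at_right 0.
           d * norm (P (Complex (1 / 4 + d) t0) / Q (Complex (1 / 4 + d) t0)) \<le> \<kappa> + e"
proof -
  define fp where "fp x = max 0 (f x)" for x
  define fm where "fm x = max 0 (- f x)" for x
  \<comment> \<open>The truncation at 0 makes \<open>L\<close> nonnegative everywhere; the measures
    \<open>mu g\<close> live on [1, infinity), where exp(-s L) is x^(-s).\<close>
  define L :: "real \<Rightarrow> real" where "L x = max 0 (ln x)" for x
  define mu where "mu g = density lborel (\<lambda>x. ennreal (indicator {1..} x * g x / x))" for g :: "real \<Rightarrow> real"
  define F where "F g s = (\<integral>x. exp (- s * of_real (L x)) \<partial>mu g)" for g and s :: complex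
  have [measurable]: "fp \<in> borel_measurable borel" "fm \<in> borel_measurable borel"
    "L \<in> borel_measurable borel"
    unfolding fp_def fm_def L_def by measurable
  have L0: "L x \<ge> 0" for x by (simp add: L_def)
  have Lmu: "L \<in> borel_measurable (mu g)" for g by (simp add: mu_def)
  have w: "(indicator {1..} x * g x / x) *\<^sub>R exp (- c * L x) = indicator {1..} x * (g x * x powr (- c - 1))"
    for g :: "real \<Rightarrow> real" and c x :: real
    by (auto simp: indicator_def L_def powr_def field_simps exp_diff exp_minus)
  have pos: "AE x in lborel. 0 \<le> indicator {1..} x * g x / x" if "\<And>x. g x \<ge> 0" for g :: "real \<Rightarrow> real"
    using that by (auto simp: indicator_def)
  have int_iff: "integrable (mu g) (\<lambda>x. exp (- c * L x)) \<longleftrightarrow>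
      integrable lborel (\<lambda>x. indicator {1..} x * (g x * x powr (- c - 1)))"
    if [measurable]: "g \<in> borel_measurable borel" and g: "\<And>x. g x \<ge> 0" for g c
    unfolding mu_def w[symmetric] by (rule integrable_density[OF _ _ pos[OF g]]) measurable
  have F_real: "F g (of_real c) = of_real (\<integral>x. indicator {1..} x * (g x * x powr (- c - 1)) \<partial>lborel)"
    if [measurable]: "g \<in> borel_measurable borel" and g: "\<And>x. g x \<ge> 0" for g c
  proof -
    have "F g (of_real c) = (\<integral>x. complex_of_real (exp (- c * L x)) \<partial>mu g)"
      unfolding F_def by (simp flip: exp_of_real)
    also have "\<dots> = of_real (\<integral>x. exp (- c * L x) \<partial>mu g)"
      by (rule integral_complex_of_real)
    also have "(\<integral>x. exp (- c * L x) \<partial>mu g) = (\<integral>x. indicator {1..} x * (g x * x powr (- c - 1)) \<partial>lborel)"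
      unfolding mu_def w[symmetric] by (rule integral_density[OF _ _ pos[OF g]]) measurable
    finally show ?thesis .
  qed
  have fp0: "fp x \<ge> 0" and fm0: "fm x \<ge> 0" for x by (auto simp: fp_def fm_def)

  define A where "A = {x. x \<ge> 1 \<and> f x < 0}"
  have [measurable]: "A \<in> sets borel" unfolding A_def by measurable
  obtain C where C: "C \<ge> 0" "\<And>x. x \<ge> 1 \<Longrightarrow> f x \<ge> - C * x powr (5 / 8)"
    by (rule sparse_negative_set_lower_bound[OF \<open>f \<in> _\<close> B \<sigma> slope local sparse]) auto
  have fm_int: "integrable (mu fm) (\<lambda>x. exp (- c * L x))" if c: "c > 1 / 8" for c
    unfolding int_iff[OF \<open>fm \<in> _\<close> fm0]
  proof (rule Bochner_Integration.integrable_bound)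
    \<comment> \<open>5/8 - c - 1 = -(c + 3/8), and c + 3/8 > 1/2 is exactly c > 1/8.\<close>
    show "integrable lborel (\<lambda>x. C * (indicator A x * x powr - (c + 3 / 8)))"
      using c sparse by (intro integrable_mult_right sparse_set_powr_integrable[where K = K])
        (auto simp: A_def)
    have "norm (indicator {1..} x * (fm x * x powr (- c - 1)))
        \<le> norm (C * (indicator A x * x powr - (c + 3 / 8)))" for x
    proof (cases "x \<in> A")
      case True
      hence x: "x \<ge> 1" "f x < 0" by (auto simp: A_def)
      have "fm x * x powr (- c - 1) \<le> C * x powr (5 / 8) * x powr (- c - 1)"
        using C(2)[OF x(1)] x by (intro mult_right_mono) (auto simp: fm_def)
      also have "\<dots> = C * x powr - (c + 3 / 8)"
        by (simp add: algebra_simps flip: powr_add)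
      finally show ?thesis using True x C(1) fm0[of x] by simp
    next
      case False
      thus ?thesis by (auto simp: A_def fm_def indicator_def)
    qed
    thus "AE x in lborel. norm (indicator {1..} x * (fm x * x powr (- c - 1)))
        \<le> norm (C * (indicator A x * x powr - (c + 3 / 8)))" by blast
  qed measurable
  have Fm_hol: "F fm holomorphic_on {s. Re s > 1 / 8}"
    unfolding F_def by (rule laplace_holomorphic[OF Lmu L0 fm_int])

  have f_split: "indicator {1..} x * (fp x * x powr (- c - 1)) =
      indicator {1..} x *\<^sub>R (f x * x powr (- c - 1)) + indicator {1..} x * (fm x * x powr (- c - 1))" for x c
    by (auto simp: fp_def fm_def indicator_def max_def algebra_simps)
  have fm_int': "integrable lborel (\<lambda>x. indicator {1..} x * (fm x * x powr (- c - 1)))" if "c > 1" for c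
    using fm_int[of c] that unfolding int_iff[OF \<open>fm \<in> _\<close> fm0] by simp
  have f_int': "integrable lborel (\<lambda>x. indicator {1..} x *\<^sub>R (f x * x powr (- c - 1)))" if "c > 1" for c
    using int[OF that] by (simp add: set_integrable_def)
  have fp_int: "integrable (mu fp) (\<lambda>x. exp (- c * L x))" if c: "c > 1" for c
    unfolding int_iff[OF \<open>fp \<in> _\<close> fp0] f_split
    by (intro Bochner_Integration.integrable_add fm_int' f_int' c)
  define N where "N s = (F fm s + of_real \<kappa> / (s - 1 / 4)) * Q s + P s" for s
  have eq: "F fp (of_real c) * Q (of_real c) = N (of_real c)" if c: "c > 1" for c
  proof -
    have "F fp (of_real c) = of_real (LINT x:{1..}|lborel. f x * x powr (- c - 1)) + F fm (of_real c)"
      unfolding F_real[OF \<open>fp \<in> _\<close> fp0] F_real[OF \<open>fm \<in> _\<close> fm0] f_split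
      by (subst Bochner_Integration.integral_add[OF f_int'[OF c] fm_int'[OF c]])
        (simp add: set_lebesgue_integral_def)
    thus ?thesis using mellin[OF c] by (simp add: N_def algebra_simps)
  qed
  have half: "{s::complex. 1 / 4 < Re s} \<subseteq> {s. 1 / 8 < Re s}" by auto
  have quarter: "s - 1 / 4 \<noteq> 0" if "Re s > 1 / 4" for s :: complex
    using that by (auto simp: complex_eq_iff)
  have N_hol: "N holomorphic_on {s. Re s > 1 / 4}" unfolding N_def
    by (intro holomorphic_intros holomorphic_on_subset[OF Fm_hol half] holomorphic_on_subset[OF P half]
        holomorphic_on_subset[OF Q half]) (use quarter in blast)
  have Q_hol: "Q holomorphic_on {s. Re s > 1 / 4}"
    by (rule holomorphic_on_subset[OF Q half])
  have Fm_an: "F fm analytic_on {s}" if "Re s > 1 / 8" for s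
    using Fm_hol that analytic_on_open[OF open_halfspace_Re_gt] analytic_on_subset by blast
  \<comment> \<open>Near real x > 1/4 the quotient N/Q is the sum of the transform of
    \<open>fm\<close>, the pole term \<open>\<kappa>\<close>/(s - 1/4) and P/Q; each is regular
    there, so Landau's theorem brings \<open>fp\<close> down to 1/4.\<close>
  have regN: "\<exists>h. h analytic_on {of_real x} \<and>
      (\<forall>\<^sub>F s in at (of_real x). Q s \<noteq> 0 \<and> h s = N s / Q s)" if x: "x > 1 / 4" for x
  proof -
    obtain h where h: "h analytic_on {of_real x}"
        "\<forall>\<^sub>F s in at (of_real x). Q s \<noteq> 0 \<and> h s = P s / Q s"
      using reg[of x] x by auto
    have "(\<lambda>s. F fm s + of_real \<kappa> / (s - 1 / 4) + h s) analytic_on {of_real x}"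
    proof (intro analytic_intros h Fm_an)
      show "\<And>z. z \<in> {complex_of_real x} \<Longrightarrow> z - 1 / 4 \<noteq> 0" using quarter x by auto
    qed (use x in auto)
    moreover have "\<forall>\<^sub>F s in at (of_real x). Q s \<noteq> 0 \<and>
        F fm s + of_real \<kappa> / (s - 1 / 4) + h s = N s / Q s"
      using h(2) by eventually_elim (auto simp: N_def field_simps)
    ultimately show ?thesis by blast
  qed
  have fp_int_all: "integrable (mu fp) (\<lambda>x. exp (- c * L x))" if c: "c > 1 / 4" for c
    by (rule landau_laplace[OF Lmu L0 fp_int N_hol Q_hol eq[unfolded F_def] regN c])
  have Fp_hol: "F fp holomorphic_on {s. Re s > 1 / 4}"
    unfolding F_def by (rule laplace_holomorphic[OF Lmu L0 fp_int_all])
  have FQ: "F fp s * Q s = N s" if "Re s > 1 / 4" for s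
    by (rule holomorphic_quotient_identity[OF Fp_hol Q_hol N_hol eq that])
  have Fp_le: "norm (F fp s) \<le> norm (F fp (of_real (Re s)))" if "Re s > 1 / 4" for s
  proof -
    have "norm (F fp s) \<le> (\<integral>x. norm (exp (- s * of_real (L x))) \<partial>mu fp)"
      unfolding F_def by (rule integral_norm_bound)
    also have "(\<lambda>x. norm (exp (- s * of_real (L x)))) = (\<lambda>x. exp (- Re s * L x))"
      by (simp add: fun_eq_iff)
    also have "(\<integral>x. exp (- Re s * L x) \<partial>mu fp) = norm (of_real (\<integral>x. exp (- Re s * L x) \<partial>mu fp) :: complex)"
      by (subst norm_of_real) (auto intro!: Bochner_Integration.integral_nonneg)
    also have "of_real (\<integral>x. exp (- Re s * L x) \<partial>mu fp) = (\<integral>x. complex_of_real (exp (- Re s * L x)) \<partial>mu fp)"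
      by (rule integral_complex_of_real[symmetric])
    also have "\<dots> = F fp (of_real (Re s))"
      unfolding F_def by (simp flip: exp_of_real)
    finally show ?thesis .
  qed

  define s where "s d = Complex (1 / 4 + d) t0" for d
  define u where "u d = complex_of_real (1 / 4 + d)" for d
  have s_lim: "(s \<longlongrightarrow> s 0) (at_right 0)" and u_lim: "(u \<longlongrightarrow> u 0) (at_right 0)"
    unfolding s_def u_def by (auto intro!: tendsto_eq_intros tendsto_Complex)
  have u_at: "filterlim u (at (u 0)) (at_right 0)"
    unfolding filterlim_at using u_lim
    by (auto simp: u_def eventually_at_filter complex_eq_iff)
  obtain h where h: "h analytic_on {of_real (1 / 4)}"
      "\<forall>\<^sub>F s in at (of_real (1 / 4)). Q s \<noteq> 0 \<and> h s = P s / Q s"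
    using reg[of "1 / 4"] by auto
  have hu: "((\<lambda>d. h (u d)) \<longlongrightarrow> h (u 0)) (at_right 0)"
    by (rule isCont_tendsto_compose[OF analytic_at_imp_isCont u_lim]) (use h in \<open>simp add: u_def\<close>)
  have Fu: "((\<lambda>d. F fm (u d)) \<longlongrightarrow> F fm (u 0)) (at_right 0)"
    by (rule isCont_tendsto_compose[OF analytic_at_imp_isCont u_lim]) (simp add: Fm_an u_def)
  have Fs: "((\<lambda>d. F fm (s d)) \<longlongrightarrow> F fm (s 0)) (at_right 0)"
    by (rule isCont_tendsto_compose[OF analytic_at_imp_isCont s_lim]) (simp add: Fm_an s_def)
  have s0_ne: "s 0 - 1 / 4 \<noteq> 0" using t0 by (simp add: s_def complex_eq_iff)

  \<comment> \<open>\<open>R\<close> bounds d |P/Q| at \<open>s d\<close>: its first term is d F(u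
    d), which dominates d |F(s d)|, and the others are the remaining parts of N/Q. Everything
    multiplied by d vanishes in the limit and leaves the absolute value of
    \<open>\<kappa>\<close>.\<close>
  define R where "R d = norm (of_real d * F fm (u d) + of_real \<kappa> + of_real d * h (u d))
      + norm (of_real d * F fm (s d)) + norm (of_real d * (of_real \<kappa> / (s d - 1 / 4)))" for d
  have "(R \<longlongrightarrow> norm (of_real 0 * F fm (u 0) + of_real \<kappa> + of_real 0 * h (u 0))
      + norm (of_real 0 * F fm (s 0)) + norm (of_real 0 * (of_real \<kappa> / (s 0 - 1 / 4)))) (at_right 0)"
    unfolding R_def by (intro tendsto_intros Fu hu Fs s_lim s0_ne)
  hence R_lim: "(R \<longlongrightarrow> \<bar>\<kappa>\<bar>) (at_right 0)" by simp
  have evR: "\<forall>\<^sub>F d in at_right 0. R d < \<bar>\<kappa>\<bar> + e"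
    by (rule order_tendstoD(2)[OF R_lim]) (use e in simp)
  define G where "G d = of_real d * F fm (u d) + of_real \<kappa> + of_real d * h (u d)" for d
  have G_lim: "((\<lambda>d. Re (G d)) \<longlongrightarrow> Re (of_real 0 * F fm (u 0) + of_real \<kappa> + of_real 0 * h (u 0))) (at_right 0)"
    unfolding G_def by (intro tendsto_intros Fu hu)
  have dpos: "\<forall>\<^sub>F d in at_right (0::real). d > 0"
    by (rule eventually_at_right_less)
  have dsmall: "\<forall>\<^sub>F d in at_right (0::real). d < 1"
    by (rule order_tendstoD(2)[OF tendsto_ident_at]) simp
  have Gu: "\<forall>\<^sub>F d in at_right 0. of_real d * F fp (u d) = G d"
  proof -
    have "\<forall>\<^sub>F d in at_right 0. Q (u d) \<noteq> 0 \<and> h (u d) = P (u d) / Q (u d)"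
      using h(2) u_at unfolding filterlim_iff by (auto simp: u_def)
    thus ?thesis using dpos
    proof eventually_elim
      case (elim d)
      have "F fp (u d) * Q (u d) = N (u d)" using elim by (intro FQ) (simp add: u_def)
      hence "F fp (u d) = F fm (u d) + of_real \<kappa> / (u d - 1 / 4) + h (u d)"
        using elim by (auto simp: N_def field_simps)
      moreover have "u d - 1 / 4 = of_real d" by (simp add: u_def complex_eq_iff)
      ultimately show ?case using elim by (simp add: G_def field_simps)
    qed
  qed
  have \<kappa>0: "\<kappa> \<ge> 0"
  proof (rule tendsto_lowerbound[OF G_lim[simplified]])
    show "\<forall>\<^sub>F d in at_right 0. 0 \<le> Re (G d)"
      using Gu dpos
    proof eventually_elim
      case (elim d)
      have "F fp (u d) = of_real (\<integral>x. indicator {1..} x * (fp x * x powr (- (1 / 4 + d) - 1)) \<partial>lborel)"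
        unfolding u_def by (rule F_real) (auto simp: fp0)
      moreover have "(\<integral>x. indicator {1..} x * (fp x * x powr (- (1 / 4 + d) - 1)) \<partial>lborel) \<ge> 0"
        using fp0 by (intro Bochner_Integration.integral_nonneg) auto
      ultimately show ?case using elim(2) unfolding elim(1)[symmetric] by simp
    qed
  qed auto
  show ?thesis
    using evR Gu dpos
  proof eventually_elim
    case (elim d)
    show ?case
    proof (cases "Q (s d) = 0")
      \<comment> \<open>Division by zero yields 0, so the claim reduces to 0 <=
        \<open>\<kappa>\<close> + e.\<close>
      case True
      thus ?thesis using \<kappa>0 e by (simp flip: s_def)
    next
      case False
      have "F fp (s d) * Q (s d) = N (s d)" using elim by (intro FQ) (simp add: s_def)
      hence PQ: "P (s d) / Q (s d) = F fp (s d) - F fm (s d) - of_real \<kappa> / (s d - 1 / 4)"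
        using False by (auto simp: N_def field_simps)
      have "d * norm (P (s d) / Q (s d)) = norm (of_real d * (P (s d) / Q (s d)))"
        using elim unfolding norm_mult by simp
      also have "of_real d * (P (s d) / Q (s d)) = of_real d * F fp (s d) - of_real d * F fm (s d)
          - of_real d * (of_real \<kappa> / (s d - 1 / 4))"
        unfolding PQ by (simp add: algebra_simps)
      also have "norm \<dots> \<le> norm (of_real d * F fp (s d)) + norm (of_real d * F fm (s d))
          + norm (of_real d * (of_real \<kappa> / (s d - 1 / 4)))"
        by (intro order_trans[OF norm_triangle_ineq4] add_right_mono norm_triangle_ineq4)
      also have "norm (of_real d * F fp (s d)) \<le> norm (of_real d * F fp (u d))"
        using Fp_le[of "s d"] elim unfolding norm_mult
        by (intro mult_left_mono) (auto simp: s_def u_def)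
      also have "of_real d * F fp (u d) = G d" using elim by simp
      also have "norm (G d) + norm (of_real d * F fm (s d)) + norm (of_real d * (of_real \<kappa> / (s d - 1 / 4))) = R d"
        by (simp add: R_def G_def)
      also have "R d \<le> \<kappa> + e" using elim \<kappa>0 by simp
      finally show ?thesis by (simp add: s_def)
    qed
  qed
qed

section \<open>Continuation of the zeta function\<close>

lemma norm_of_nat_powr: "norm (of_nat (Suc n) powr s :: complex) = real (Suc n) powr Re s"
  by (simp add: norm_powr_real_powr)

lemma summable_Suc_powr:
  assumes "x < - 1"
  shows "summable (\<lambda>n. real (Suc n) powr x)"
  using assms summable_real_powr_iff[of x] by (subst summable_Suc_iff) simp

lemma dirichlet_one_sums:
  assumes "Re s > 1"
  shows "(\<lambda>n. of_nat (Suc n) powr - s) sums dirichlet_series (\<lambda>_. 1) s"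
proof -
  have "summable (\<lambda>n. of_nat (Suc n) powr - s :: complex)"
    by (rule summable_norm_cancel) (use assms in \<open>simp only: norm_of_nat_powr, intro summable_Suc_powr, simp\<close>)
  thus ?thesis
    unfolding dirichlet_series_def by (simp add: powr_minus_divide summable_sums)
qed

text \<open>Taylor remainder of degree m of z^(1 - s) from z = n + 1 to z = n + 2, indices being
  shifted so that sums start at n = 0. It is O(n^(-Re s - m)), so raising m by one moves the
  half-plane of summability one unit to the left.\<close>

definition taylor_remainder :: "nat \<Rightarrow> nat \<Rightarrow> complex \<Rightarrow> complex" where
  "taylor_remainder m n s = of_nat (Suc (Suc n)) powr (1 - s)
     - (\<Sum>k\<le>m. ((1 - s) gchoose k) * of_nat (Suc n) powr (1 - s - of_nat k))"

text \<open>The derivative of order m + 1 is the product times z^(-s - m). The hypothesis makes its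
  modulus decrease along the real segment, so the left endpoint gives the maximum; the factor 1/m!
  is dropped.\<close>

lemma taylor_remainder_bound:
  assumes "Re s + real m \<ge> 0"
  shows "norm (taylor_remainder m n s)
      \<le> norm (\<Prod>i\<le>m. 1 - s - of_nat i) * real (Suc n) powr (- Re s - real m)"
proof -
  define ff where "ff i = (\<Prod>j<i. 1 - s - of_nat j)" for i
  define f where "f i z = ff i * z powr (1 - s - of_nat i)" for i and z :: complex
  define w where "w = complex_of_real (real (Suc n))"
  define z where "z = complex_of_real (real (Suc (Suc n)))"
  define S where "S = closed_segment w z"
  have S: "\<exists>t. x = of_real t \<and> real (Suc n) \<le> t \<and> t \<le> real (Suc (Suc n))" if "x \<in> S" for x
    using that unfolding S_def w_def z_def closed_segment_of_real
    by (auto simp: closed_segment_eq_real_ivl)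
  have "norm (f 0 z - (\<Sum>i\<le>m. f i w * (z - w) ^ i / fact i))
      \<le> norm (ff (Suc m)) * real (Suc n) powr (- Re s - real m) * norm (z - w) ^ Suc m / fact m"
  proof (rule complex_Taylor[where S = S and f = f and n = m and w = w and z = z and
        B = "norm (ff (Suc m)) * real (Suc n) powr (- Re s - real m)"])
    show "convex S" "w \<in> S" "z \<in> S" by (auto simp: S_def)
    show "(f i has_field_derivative f (Suc i) x) (at x within S)" if x: "x \<in> S" "i \<le> m" for i x
    proof -
      obtain t where t: "x = of_real t" "real (Suc n) \<le> t" using S[OF x(1)] by blast
      have "real (Suc n) > 0" by simp
      hence "t > 0" using t(2) by linarith
      hence "x \<notin> \<real>\<^sub>\<le>\<^sub>0" using t(1) by (simp add: complex_nonpos_Reals_iff)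
      hence "((\<lambda>x. x powr (1 - s - of_nat i)) has_field_derivative
          (1 - s - of_nat i) * x powr (1 - s - of_nat i - 1)) (at x within S)"
        by (rule has_field_derivative_powr[THEN has_field_derivative_at_within])
      from DERIV_cmult[OF this, of "ff i"]
      have "(f i has_field_derivative ff i * ((1 - s - of_nat i) * x powr (1 - s - of_nat i - 1))) (at x within S)"
        unfolding f_def .
      moreover have "1 - s - of_nat i - 1 = 1 - s - of_nat (Suc i)" by simp
      ultimately show ?thesis
        by (simp only: f_def ff_def prod.lessThan_Suc mult.assoc)
    qed
    show "norm (f (Suc m) x) \<le> norm (ff (Suc m)) * real (Suc n) powr (- Re s - real m)" if x: "x \<in> S" for x
    proof -
      obtain t where t: "x = of_real t" "real (Suc n) \<le> t" using S[OF x] by blast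
      have "norm (x powr (1 - s - of_nat (Suc m))) = t powr (- Re s - real m)"
        using t by (simp add: norm_powr_real_powr)
      also have "\<dots> \<le> real (Suc n) powr (- Re s - real m)"
        using t assms by (intro powr_mono2') auto
      finally show ?thesis by (simp add: f_def norm_mult mult_left_mono)
    qed
  qed
  also have "z - w = 1" by (simp add: z_def w_def)
  also have "f 0 z - (\<Sum>i\<le>m. f i w * 1 ^ i / fact i) = taylor_remainder m n s"
  proof -
    have "f i w * 1 ^ i / fact i = ((1 - s) gchoose i) * of_nat (Suc n) powr (1 - s - of_nat i)" for i
    proof -
      have "(1 - s) gchoose i = ff i / fact i"
        by (simp add: ff_def gbinomial_prod_rev atLeast0LessThan)
      thus ?thesis by (simp add: f_def w_def)
    qed
    thus ?thesis by (simp add: f_def ff_def taylor_remainder_def z_def)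
  qed
  also have "norm (ff (Suc m)) * real (Suc n) powr (- Re s - real m) * norm (1::complex) ^ Suc m / fact m
      \<le> norm (ff (Suc m)) * real (Suc n) powr (- Re s - real m) / 1"
    unfolding norm_one power_one mult_1_right by (intro divide_left_mono fact_ge_1) auto
  finally show ?thesis by (simp only: ff_def lessThan_Suc_atMost div_by_1)
qed

lemma holomorphic_taylor_remainder: "taylor_remainder m n holomorphic_on A"
proof -
  have "(\<lambda>s::complex. (1 - s) gchoose k) holomorphic_on A" for k
    unfolding gbinomial_prod_rev by (intro holomorphic_intros) auto
  thus ?thesis unfolding taylor_remainder_def[abs_def]
    by (intro holomorphic_intros) (auto simp del: of_nat_Suc)
qed

definition taylor_remainder_sum :: "nat \<Rightarrow> complex \<Rightarrow> complex" where
  "taylor_remainder_sum m s = (\<Sum>n. taylor_remainder m n s)"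

lemma taylor_remainder_sum:
  shows taylor_remainder_sums: "Re s > 1 - real m \<Longrightarrow>
          (\<lambda>n. taylor_remainder m n s) sums taylor_remainder_sum m s"
    and holomorphic_taylor_remainder_sum:
          "taylor_remainder_sum m holomorphic_on {s. Re s > 1 - real m}"
proof -
  let ?S = "{s::complex. Re s > 1 - real m}"
  have op: "open ?S" by (rule open_halfspace_Re_gt)
  obtain g where g: "\<And>x. x \<in> ?S \<Longrightarrow> (\<lambda>n. taylor_remainder m n x) sums g x"
    "\<And>x. x \<in> ?S \<Longrightarrow> g field_differentiable (at x)"
  proof (rule series_differentiable_comparison_complex[OF op, of "taylor_remainder m"])
    show "taylor_remainder m n field_differentiable at x" for n x
      using holomorphic_taylor_remainder[of m n UNIV] by (auto simp: holomorphic_on_def)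
  next
    fix x assume x: "x \<in> ?S"
    \<comment> \<open>Half of the distance to the boundary line: on the disc of this radius Re y + m
      > 1 + d, which leaves the summable majorant with exponent -1 - d.\<close>
    define d where "d = (Re x - (1 - real m)) / 2"
    have d: "d > 0" using x by (simp add: d_def)
    have "compact ((\<lambda>s. \<Prod>i\<le>m. 1 - s - of_nat i) ` cball x d)"
      by (intro compact_continuous_image continuous_intros) auto
    then obtain K where K: "\<And>s. s \<in> cball x d \<Longrightarrow> norm (\<Prod>i\<le>m. 1 - s - of_nat i) \<le> K"
      by (meson bounded_iff compact_imp_bounded imageI)
    define h where "h n = complex_of_real (K * real (Suc n) powr (- 1 - d))" for n
    have K0: "K \<ge> 0" using K[of x] d order_trans[OF norm_ge_zero] by auto
    have "summable h" unfolding h_def using d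
      by (intro summable_of_real summable_mult summable_Suc_powr) auto
    moreover have "range h \<subseteq> \<real>\<^sub>\<ge>\<^sub>0" using K0 by (auto simp: h_def)
    moreover have "norm (taylor_remainder m n y) \<le> norm (h n)" if y: "y \<in> ball x d \<inter> ?S" for n y
    proof -
      have "\<bar>Re (x - y)\<bar> < d" using y abs_Re_le_cmod[of "x - y"] by (simp add: dist_norm)
      hence "Re y > Re x - d" by auto
      hence Re: "Re y + real m > 1 + d" by (simp add: d_def field_simps)
      have "norm (taylor_remainder m n y)
          \<le> norm (\<Prod>i\<le>m. 1 - y - of_nat i) * real (Suc n) powr (- Re y - real m)"
        using Re d by (intro taylor_remainder_bound) auto
      also have "\<dots> \<le> K * real (Suc n) powr (- 1 - d)"
        using Re y K[of y] K0 by (intro mult_mono powr_mono) auto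
      also have "\<dots> = norm (h n)" using K0 by (simp add: h_def norm_mult)
      finally show ?thesis .
    qed
    ultimately show "\<exists>d h. 0 < d \<and> summable h \<and> range h \<subseteq> \<real>\<^sub>\<ge>\<^sub>0 \<and>
        (\<forall>\<^sub>F n in sequentially. \<forall>y\<in>ball x d \<inter> ?S. cmod (taylor_remainder m n y) \<le> cmod (h n))"
      using d by (intro exI[of _ d] exI[of _ h]) auto
  qed auto
  have eq: "taylor_remainder_sum m x = g x" if "x \<in> ?S" for x
    unfolding taylor_remainder_sum_def using g(1)[OF that] by (rule sums_unique[symmetric])
  show "Re s > 1 - real m \<Longrightarrow> (\<lambda>n. taylor_remainder m n s) sums taylor_remainder_sum m s"
    using g(1)[of s] eq[of s] by simp
  have "g holomorphic_on ?S"
    unfolding holomorphic_on_open[OF op] using g(2) by (auto simp: field_differentiable_def)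
  thus "taylor_remainder_sum m holomorphic_on ?S"
    by (rule holomorphic_transform) (auto simp: eq)
qed

text \<open>Summing the Taylor expansion of \<open>(n + 1)\<^bsup>1 - s\<^esup> - n\<^bsup>1 - s\<^esup>\<close> over \<open>n\<close> telescopes on the left.\<close>

lemma dirichlet_one_taylor:
  assumes s: "Re s > 1" and m: "m > 0"
  defines "z \<equiv> \<lambda>s. (s - 1) * dirichlet_series (\<lambda>_. 1) s"
  shows "z s = 1 + taylor_remainder_sum m s
           - (\<Sum>k=2..m. ((1 - s) gchoose (k - 1)) / of_nat k * z (s + of_nat k - 1))"
proof -
  let ?\<zeta> = "dirichlet_series (\<lambda>_. 1)"
  have lim: "(\<lambda>n. of_nat (Suc n) powr (1 - s) :: complex) \<longlonglongrightarrow> 0"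
  proof (rule tendsto_norm_zero_cancel)
    have "(\<lambda>n. real (Suc n) powr Re (1 - s)) \<longlonglongrightarrow> 0"
      using s by (intro tendsto_neg_powr filterlim_compose[OF filterlim_real_sequentially]
          filterlim_Suc) auto
    thus "(\<lambda>n. norm (of_nat (Suc n) powr (1 - s) :: complex)) \<longlonglongrightarrow> 0"
      unfolding norm_of_nat_powr .
  qed
  have tele: "(\<lambda>n. of_nat (Suc (Suc n)) powr (1 - s) - of_nat (Suc n) powr (1 - s)) sums (0 - 1 :: complex)"
    using telescope_sums[OF lim] by simp
  have zs: "(\<lambda>n. ((1 - s) gchoose k) * of_nat (Suc n) powr (1 - s - of_nat k)) sums
      (((1 - s) gchoose k) * ?\<zeta> (s + of_nat k - 1))" if "k \<ge> 1" for k
  proof -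
    have "Re (s + of_nat k - 1) > 1" using s that by simp
    from dirichlet_one_sums[OF this] show ?thesis
      by (intro sums_mult) (simp add: algebra_simps)
  qed
  have "(\<lambda>n. (of_nat (Suc (Suc n)) powr (1 - s) - of_nat (Suc n) powr (1 - s))
      - (\<Sum>k=1..m. ((1 - s) gchoose k) * of_nat (Suc n) powr (1 - s - of_nat k))) sums
      ((0 - 1) - (\<Sum>k=1..m. ((1 - s) gchoose k) * ?\<zeta> (s + of_nat k - 1)))"
    by (intro sums_diff tele sums_sum zs) auto
  moreover have "{..m} = insert 0 {1..m}" by auto
  hence "taylor_remainder m n s = (of_nat (Suc (Suc n)) powr (1 - s) - of_nat (Suc n) powr (1 - s))
      - (\<Sum>k=1..m. ((1 - s) gchoose k) * of_nat (Suc n) powr (1 - s - of_nat k))" for n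
    unfolding taylor_remainder_def by simp
  ultimately have "(\<lambda>n. taylor_remainder m n s) sums
      ((0 - 1) - (\<Sum>k=1..m. ((1 - s) gchoose k) * ?\<zeta> (s + of_nat k - 1)))"
    by presburger
  hence "taylor_remainder_sum m s =
      (0 - 1) - (\<Sum>k=1..m. ((1 - s) gchoose k) * ?\<zeta> (s + of_nat k - 1))"
    unfolding taylor_remainder_sum_def by (rule sums_unique[symmetric])
  \<comment> \<open>The term k = 1 is (1 - s) zeta(s) = -z(s); isolating it turns the telescoped sum
    into a formula for z(s).\<close>
  also have "(\<Sum>k=1..m. ((1 - s) gchoose k) * ?\<zeta> (s + of_nat k - 1))
      = - z s + (\<Sum>k=2..m. ((1 - s) gchoose k) * ?\<zeta> (s + of_nat k - 1))"
    using m by (subst sum.atLeast_Suc_atMost) (auto simp: z_def numeral_2_eq_2 algebra_simps)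
  \<comment> \<open>For k >= 2 the binomial coefficient contains the factor s + k - 2, which is what
    removes the pole of zeta(s + k - 1).\<close>
  also have "(\<Sum>k=2..m. ((1 - s) gchoose k) * ?\<zeta> (s + of_nat k - 1))
      = - (\<Sum>k=2..m. ((1 - s) gchoose (k - 1)) / of_nat k * z (s + of_nat k - 1))"
    unfolding sum_negf[symmetric]
  proof (rule sum.cong)
    fix k assume "k \<in> {2..m}"
    then obtain j where k: "k = Suc j" by (cases k) auto
    have "((1 - s) gchoose k) * of_nat k = ((1 - s) gchoose j) * (1 - s - of_nat j)"
      unfolding k using gbinomial_mult_1[of "1 - s" j] by (simp add: algebra_simps)
    hence "((1 - s) gchoose k) = ((1 - s) gchoose j) * (1 - s - of_nat j) / of_nat k"
      by (simp add: k field_simps del: of_nat_Suc)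
    also have "1 - s - of_nat j = - (s + of_nat k - 1 - 1)" by (simp add: k)
    finally have *: "((1 - s) gchoose k) = ((1 - s) gchoose (k - 1)) * - (s + of_nat k - 1 - 1) / of_nat k"
      by (simp add: k)
    show "((1 - s) gchoose k) * ?\<zeta> (s + of_nat k - 1)
        = - (((1 - s) gchoose (k - 1)) / of_nat k * z (s + of_nat k - 1))"
      unfolding z_def * by (simp only: mult_minus_left mult_minus_right times_divide_eq_left minus_divide_left mult.assoc)
  qed simp
  finally show ?thesis by simp
qed


lemma dirichlet_one_holomorphic:
  "(\<lambda>s. (s - 1) * dirichlet_series (\<lambda>_. 1) s) holomorphic_on {s. Re s > 1}"
proof (rule holomorphic_transform)
  show "(\<lambda>s. 1 + taylor_remainder_sum 1 s) holomorphic_on {s. Re s > 1}"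
    by (intro holomorphic_intros holomorphic_on_subset[OF holomorphic_taylor_remainder_sum]) auto
qed (use dirichlet_one_taylor[where m = 1] in auto)

text \<open>The expansion of order m + 1 expresses z(s) through z(s + 1), ..., z(s + m), which all
  lie in the half-plane already reached, and a remainder sum that is holomorphic one unit further
  left.\<close>

lemma zeta_continuation_step:
  "\<exists>g. g holomorphic_on {s. Re s > 1 - real m} \<and>
       (\<forall>s. Re s > 1 \<longrightarrow> g s = (s - 1) * dirichlet_series (\<lambda>_. 1) s)"
proof (induction m)
  case 0
  show ?case using dirichlet_one_holomorphic by auto
next
  case (Suc m)
  then obtain g where g: "g holomorphic_on {s. Re s > 1 - real m}"
    "\<And>s. Re s > 1 \<Longrightarrow> g s = (s - 1) * dirichlet_series (\<lambda>_. 1) s" by blast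
  define h where "h s = 1 + taylor_remainder_sum (Suc m) s
      - (\<Sum>k=2..Suc m. ((1 - s) gchoose (k - 1)) / of_nat k * g (s + of_nat k - 1))" for s
  have "(\<lambda>s. g (s + of_nat k - 1)) holomorphic_on {s. Re s > 1 - real (Suc m)}" if "k \<ge> 2" for k
    by (rule holomorphic_on_compose_gen[OF _ g(1), unfolded o_def])
      (use that in \<open>auto intro!: holomorphic_intros\<close>)
  moreover have "(\<lambda>s::complex. (1 - s) gchoose k) holomorphic_on A" for k A
    unfolding gbinomial_prod_rev by (intro holomorphic_intros) auto
  ultimately have "h holomorphic_on {s. Re s > 1 - real (Suc m)}"
    unfolding h_def[abs_def]
    by (intro holomorphic_intros holomorphic_taylor_remainder_sum) auto
  moreover have "h s = (s - 1) * dirichlet_series (\<lambda>_. 1) s" if s: "Re s > 1" for s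
  proof -
    have "g (s + of_nat k - 1) = (s + of_nat k - 1 - 1) * dirichlet_series (\<lambda>_. 1) (s + of_nat k - 1)"
      if "k \<in> {2..Suc m}" for k using s that by (intro g(2)) auto
    thus ?thesis unfolding h_def dirichlet_one_taylor[OF s, of "Suc m", simplified]
      by (intro arg_cong2[where f = "(-)"] sum.cong) auto
  qed
  ultimately show ?case by blast
qed

lemma half_plane_identity:
  assumes "f holomorphic_on {s. Re s > a}" "g holomorphic_on {s. Re s > a}"
    and "\<And>s. Re s > b \<Longrightarrow> f s = g s" and "Re s > a"
  shows "f s = g s"
proof (rule analytic_continuation_open[of "{s. Re s > max a b}" "{s. Re s > a}" f g])
  show "{s. Re s > max a b} \<noteq> {}"
    by (auto intro: exI[of _ "of_real (max a b + 1)"])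
  show "open {s. Re s > max a b}" by (rule open_halfspace_Re_gt)
  show "connected {s. Re s > a}" by (intro convex_connected convex_halfspace_Re_gt)
qed (use assms open_halfspace_Re_gt in auto)

lemma ex_zeta_pole_removed:
  "\<exists>Z. Z holomorphic_on UNIV \<and>
       (\<forall>s. Re s > 1 \<longrightarrow> Z s = (s - 1) * dirichlet_series (\<lambda>_. 1) s)"
proof -
  obtain G where G: "\<And>m. G m holomorphic_on {s. Re s > 1 - real m}"
    "\<And>m s. Re s > 1 \<Longrightarrow> G m s = (s - 1) * dirichlet_series (\<lambda>_. 1) s"
    using zeta_continuation_step by metis
  \<comment> \<open>Any index whose half-plane contains \<open>s\<close> would do: by the identity
    theorem the continuations \<open>G m\<close> agree wherever two of them are defined.\<close>
  define k where "k s = nat \<lceil>2 + \<bar>Re s\<bar>\<rceil>" for s :: complex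
  have k: "Re s > 1 - real (k s)" for s
  proof -
    have "real (k s) \<ge> 2 + \<bar>Re s\<bar>" unfolding k_def by linarith
    thus ?thesis by linarith
  qed
  define Z where "Z s = G (k s) s" for s
  have eq: "Z s = G m s" if "Re s > 1 - real m" for m s
  proof -
    define a where "a = max (1 - real m) (1 - real (k s))"
    show ?thesis unfolding Z_def
      by (rule half_plane_identity[of "G (k s)" a "G m" 1])
        (use that k[of s] in \<open>auto simp: a_def G intro!: holomorphic_on_subset[OF G(1)]\<close>)
  qed
  have "Z holomorphic_on UNIV"
  proof (rule holomorphic_onI)
    fix s :: complex
    let ?H = "{z. Re z > 1 - real (k s)}"
    have "Z holomorphic_on ?H"
      by (rule holomorphic_transform[OF G(1)[of "k s"]]) (auto simp: eq)
    thus "Z field_differentiable at s within UNIV"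
      using k[of s] by (auto simp: holomorphic_on_open[OF open_halfspace_Re_gt] field_differentiable_def)
  qed
  moreover have "Z s = (s - 1) * dirichlet_series (\<lambda>_. 1) s" if "Re s > 1" for s
    unfolding Z_def using that by (rule G(2))
  ultimately show ?thesis by blast
qed

text \<open>The entire function \<open>(s - 1) \<zeta>(s)\<close>; its value at \<open>1\<close> is \<open>1\<close>.\<close>

definition zeta_pole_removed :: "complex \<Rightarrow> complex" where
  "zeta_pole_removed = (SOME Z. Z holomorphic_on UNIV \<and>
     (\<forall>s. Re s > 1 \<longrightarrow> Z s = (s - 1) * dirichlet_series (\<lambda>_. 1) s))"

lemma holomorphic_zeta_pole_removed: "zeta_pole_removed holomorphic_on UNIV"
  and zeta_pole_removed_eq:
    "Re s > 1 \<Longrightarrow> zeta_pole_removed s = (s - 1) * dirichlet_series (\<lambda>_. 1) s"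
  using someI_ex[OF ex_zeta_pole_removed] unfolding zeta_pole_removed_def by auto

lemma holomorphic_zeta_pole_removed' [holomorphic_intros]:
  assumes "f holomorphic_on A"
  shows "(\<lambda>s. zeta_pole_removed (f s)) holomorphic_on A"
  using holomorphic_on_compose_gen[OF assms holomorphic_zeta_pole_removed] by (simp add: o_def)

lemma analytic_zeta_pole_removed [analytic_intros]:
  assumes "f analytic_on A"
  shows "(\<lambda>s. zeta_pole_removed (f s)) analytic_on A"
  using analytic_on_compose_gen[OF assms, of zeta_pole_removed UNIV] holomorphic_zeta_pole_removed
  by (simp add: o_def analytic_on_open)

lemma zeta_pole_removed_pos:
  assumes "Re s > 0"
  shows "zeta_pole_removed s = 1 + taylor_remainder_sum 1 s"
  by (rule half_plane_identity[where a = 0 and b = 1])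
    (use assms dirichlet_one_taylor[where m = 1] holomorphic_taylor_remainder_sum[of 1]
     in \<open>auto intro!: holomorphic_intros simp: zeta_pole_removed_eq\<close>)

section \<open>Nonvanishing of zeta for Re s >= 2 and of (s - 1) zeta(s) on the positive real
  axis\<close>

lemma taylor_remainder_1:
  "taylor_remainder 1 n s = of_nat (Suc (Suc n)) powr (1 - s) - of_nat (Suc n) powr (1 - s)
     - (1 - s) * of_nat (Suc n) powr - s"
  by (simp add: taylor_remainder_def del: of_nat_Suc) simp

text \<open>The terms with n >= 2 add up to less than 1 in modulus, so they cannot cancel the
  leading term 1.\<close>

lemma dirichlet_one_nonzero:
  assumes "Re s \<ge> 2"
  shows "dirichlet_series (\<lambda>_. 1) s \<noteq> 0"
proof
  assume 0: "dirichlet_series (\<lambda>_. 1) s = 0"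
  have "(\<lambda>n. of_nat (Suc n) powr - s) sums (0::complex)"
    using dirichlet_one_sums[of s] assms 0 by simp
  hence *: "(\<lambda>n. of_nat (Suc (Suc n)) powr - s) sums (- 1::complex)"
    using sums_Suc_iff[of "\<lambda>n. of_nat (Suc n) powr - s" "- 1::complex"] by simp
  have lim: "(\<lambda>n. inverse (real (Suc n))) \<longlonglongrightarrow> 0"
    by (rule LIMSEQ_inverse_real_of_nat)
  have tele: "(\<lambda>n. inverse (real (Suc n)) - inverse (real (Suc (Suc n)))) sums 1"
    using telescope_sums'[OF lim] by simp
  \<comment> \<open>The telescoping majorant of the squares sums to exactly 1, which is not enough;
    replacing its first value 1/2 by the true 1/4 brings the total down to 3/4.\<close>
  define e where "e n = inverse (real (Suc n)) - inverse (real (Suc (Suc n)))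
      - (if n = 0 then 1 / 4 else 0)" for n
  have e: "e sums (1 - 1 / 4)"
    unfolding e_def by (intro sums_diff tele) (use sums_single[of 0 "\<lambda>_. 1 / 4 :: real"] in simp)
  have le: "norm (of_nat (Suc (Suc n)) powr - s :: complex) \<le> e n" for n
  proof -
    have "norm (of_nat (Suc (Suc n)) powr - s :: complex) \<le> real (Suc (Suc n)) powr - 2"
      unfolding norm_of_nat_powr using assms by (intro powr_mono) auto
    also have "\<dots> = inverse ((real (Suc (Suc n)))\<^sup>2)"
      by (simp add: powr_minus powr_numeral)
    also have "\<dots> \<le> e n"
    proof (cases n)
      case (Suc k)
      define x where "x = real (Suc n)"
      have x: "x > 0" by (simp add: x_def)
      have "inverse ((x + 1)\<^sup>2) = 1 / ((x + 1) * (x + 1))"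
        by (simp add: power2_eq_square inverse_eq_divide)
      also have "\<dots> \<le> 1 / (x * (x + 1))"
        using x by (intro divide_left_mono mult_right_mono mult_pos_pos) auto
      also have "\<dots> = inverse x - inverse (x + 1)" using x by (simp add: field_simps)
      finally show ?thesis using Suc by (simp add: e_def x_def algebra_simps)
    qed (simp add: e_def power2_eq_square)
    finally show ?thesis .
  qed
  have "norm (- 1 :: complex) \<le> 1 - 1 / 4"
    unfolding sums_unique[OF *] sums_unique[OF e] using sums_summable[OF e] le
    by (intro norm_suminf_le) auto
  thus False by simp
qed

lemma zeta_pole_removed_nonzero:
  assumes "Re s \<ge> 2"
  shows "zeta_pole_removed s \<noteq> 0"
  using assms dirichlet_one_nonzero[of s] by (auto simp: zeta_pole_removed_eq)

lemma powr_step_ge: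
  fixes x a :: real
  assumes "x > 0" "0 \<le> a" "a \<le> 1"
  shows "a * (x + 1) powr (a - 1) \<le> (x + 1) powr a - x powr a"
proof -
  have "\<exists>z. x < z \<and> z < x + 1 \<and> (x + 1) powr a - x powr a = (x + 1 - x) * (a * z powr (a - 1))"
    by (rule MVT2) (use assms in \<open>auto intro!: derivative_eq_intros\<close>)
  then obtain z where z: "x < z" "z < x + 1" "(x + 1) powr a - x powr a = a * z powr (a - 1)"
    by auto
  have "a * (x + 1) powr (a - 1) \<le> a * z powr (a - 1)"
    using z assms by (intro mult_left_mono powr_mono2') auto
  thus ?thesis using z by simp
qed

text \<open>This makes s = 1 the only real singularity of D(s)/s to the right of 0, as Landau's
  theorem requires. For s in (0, 1] the value is at least s by an estimate of partial sums; for s >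
  1 the Dirichlet series is positive.\<close>

lemma zeta_pole_removed_real_nonzero:
  assumes "\<sigma> > 0"
  shows "zeta_pole_removed (of_real \<sigma>) \<noteq> 0"
proof (cases "\<sigma> \<le> 1")
  case True
  define a where "a = 1 - \<sigma>"
  have a: "0 \<le> a" "a \<le> 1" using assms True by (auto simp: a_def)
  define t where "t n = real (Suc (Suc n)) powr a - real (Suc n) powr a - a * real (Suc n) powr (a - 1)" for n
  have t: "taylor_remainder 1 n (of_real \<sigma>) = of_real (t n)" for n
  proof -
    have p: "complex_of_nat (Suc m) powr of_real y = of_real (real (Suc m) powr y)" for m y
      using powr_of_real[of "real (Suc m)" y] by simp
    have a': "(1 :: complex) - of_real \<sigma> = of_real a" "- complex_of_real \<sigma> = of_real (a - 1)"
      by (auto simp: a_def)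
    show ?thesis
      unfolding taylor_remainder_1 a' p t_def by (simp only: of_real_diff of_real_mult)
  qed
  have csums: "(\<lambda>n. complex_of_real (t n)) sums taylor_remainder_sum 1 (of_real \<sigma>)"
    using taylor_remainder_sums[where m = 1 and s = "of_real \<sigma>", unfolded t] assms by simp
  hence "summable (\<lambda>n. complex_of_real (t n))"
    by (rule sums_summable)
  hence ts: "t sums suminf t"
    unfolding summable_of_real_iff by (rule summable_sums)
  have eq: "zeta_pole_removed (of_real \<sigma>) = of_real (1 + suminf t)"
    unfolding zeta_pole_removed_pos[of "of_real \<sigma>", simplified, OF assms] of_real_add of_real_1
    by (intro arg_cong2[where f = "(+)"] refl sums_unique2[OF csums[unfolded One_nat_def] sums_of_real[OF ts]])
  \<comment> \<open>Carrying the difference (N+2)^a - (N+1)^a along lets the induction close: by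
    concavity it pays for the next term -a (N+2)^(a-1).\<close>
  have part: "1 + (\<Sum>n<Suc N. t n) \<ge> \<sigma> + real (Suc (Suc N)) powr a - real (Suc N) powr a" for N
  proof (induction N)
    case 0
    show ?case by (simp add: t_def a_def)
  next
    case (Suc N)
    have "a * real (Suc (Suc N)) powr (a - 1) \<le> real (Suc (Suc N)) powr a - real (Suc N) powr a"
      using powr_step_ge[of "real (Suc N)" a] a by (simp add: add.commute)
    thus ?case using Suc.IH by (simp add: t_def)
  qed
  have "1 + (\<Sum>n<Suc N. t n) \<ge> \<sigma>" for N
    using part[of N] powr_mono2[of a "real (Suc N)" "real (Suc (Suc N))"] a by simp
  moreover have "(\<lambda>N. 1 + (\<Sum>n<Suc N. t n)) \<longlonglongrightarrow> 1 + suminf t"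
    using ts unfolding sums_def by (intro tendsto_intros LIMSEQ_Suc)
  ultimately have "1 + suminf t \<ge> \<sigma>" by (intro tendsto_lowerbound) auto
  thus ?thesis unfolding eq using assms by (metis not_le of_real_eq_0_iff)
next
  case False
  have p: "complex_of_nat (Suc m) powr - of_real y = of_real (real (Suc m) powr - y)" for m y
    using powr_of_real[of "real (Suc m)" "- y"] by simp
  have *: "(\<lambda>n. complex_of_real (real (Suc n) powr - \<sigma>)) sums dirichlet_series (\<lambda>_. 1) (of_real \<sigma>)"
    using dirichlet_one_sums[of "of_real \<sigma>"] False by (simp only: p Re_complex_of_real not_le)
  hence "summable (\<lambda>n. complex_of_real (real (Suc n) powr - \<sigma>))"
    by (rule sums_summable)
  hence sm: "summable (\<lambda>n. real (Suc n) powr - \<sigma>)"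
    by (simp only: summable_of_real_iff)
  have "(\<Sum>n\<in>{0}. real (Suc n) powr - \<sigma>) \<le> (\<Sum>n. real (Suc n) powr - \<sigma>)"
    by (rule sum_le_suminf[OF sm]) auto
  hence "(\<Sum>n. real (Suc n) powr - \<sigma>) \<noteq> 0" by simp
  moreover have "dirichlet_series (\<lambda>_. 1) (of_real \<sigma>) = of_real (\<Sum>n. real (Suc n) powr - \<sigma>)"
    using sums_unique2[OF * sums_of_real[OF summable_sums[OF sm]]] .
  ultimately have "dirichlet_series (\<lambda>_. 1) (complex_of_real \<sigma>) \<noteq> 0"
    by (simp only: of_real_eq_0_iff not_False_eq_True)
  moreover have "complex_of_real \<sigma> - 1 \<noteq> 0"
    using False by (simp add: complex_eq_iff)
  ultimately show ?thesis
    using False zeta_pole_removed_eq[of "of_real \<sigma>"] by simp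
qed

section \<open>Ramanujan's formula\<close>

lemma has_sum_product_complex:
  fixes f :: "'a \<Rightarrow> complex" and g :: "'b \<Rightarrow> complex"
  assumes f: "(f has_sum a) A" "Infinite_Sum.abs_summable_on f A" and g: "(g has_sum b) B" "Infinite_Sum.abs_summable_on g B"
  shows "((\<lambda>(x, y). f x * g y) has_sum (a * b)) (A \<times> B)"
    and "Infinite_Sum.abs_summable_on (\<lambda>(x, y). f x * g y) (A \<times> B)"
proof -
  show abs: "Infinite_Sum.abs_summable_on (\<lambda>(x, y). f x * g y) (A \<times> B)"
    unfolding Infinite_Sum.abs_summable_on_Sigma_iff
  proof (intro conjI ballI)
    show "(\<lambda>y. norm ((\<lambda>(x, y). f x * g y) (x, y))) summable_on B" for x
      unfolding prod.case norm_mult by (rule summable_on_cmult_right[OF g(2)])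
    have "(\<lambda>x. norm (f x) * (\<Sum>\<^sub>\<infinity>y\<in>B. norm (g y))) summable_on A"
      by (rule summable_on_cmult_left[OF f(2)])
    moreover have "norm (\<Sum>\<^sub>\<infinity>y\<in>B. norm ((\<lambda>(x, y). f x * g y) (x, y)))
        = norm (f x) * (\<Sum>\<^sub>\<infinity>y\<in>B. norm (g y))" for x
      unfolding prod.case norm_mult infsum_cmult_right'
      by (simp only: norm_mult real_norm_def abs_norm_cancel abs_of_nonneg[OF infsum_nonneg] norm_ge_zero)
    ultimately show "(\<lambda>x. norm (\<Sum>\<^sub>\<infinity>y\<in>B. norm ((\<lambda>(x, y). f x * g y) (x, y)))) summable_on A"
      by presburger
  qed
  show "((\<lambda>(x, y). f x * g y) has_sum (a * b)) (A \<times> B)"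
  proof (rule has_sum_SigmaI)
    show "((\<lambda>y. (\<lambda>(x, y). f x * g y) (x, y)) has_sum (f x * b)) B" for x
      using has_sum_cmult_right[OF g(1), of "f x"] by simp
    show "((\<lambda>x. f x * b) has_sum a * b) A"
      by (rule has_sum_cmult_left[OF f(1)])
    show "(\<lambda>(x, y). f x * g y) summable_on A \<times> B"
      by (rule abs_summable_summable[OF abs])
  qed
qed

lemma of_nat_powr_mult: "of_nat (m * n) powr z = (of_nat m powr z * of_nat n powr z :: complex)"
  by (simp add: powr_times_real)

lemma has_sum_dirichlet_one:
  assumes "Re s > 1"
  shows "((\<lambda>n. of_nat n powr - s) has_sum dirichlet_series (\<lambda>_. 1) s) {0<..}"
    and "Infinite_Sum.abs_summable_on (\<lambda>n::nat. of_nat n powr - s :: complex) {0<..}"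
proof -
  have bij: "bij_betw Suc UNIV {0<..}"
    by (rule bij_betwI[of _ _ _ "\<lambda>n. n - 1"]) auto
  have sm: "summable (\<lambda>n. norm (of_nat (Suc n) powr - s :: complex))"
    using assms by (simp only: norm_of_nat_powr, intro summable_Suc_powr, simp)
  show "((\<lambda>n. of_nat n powr - s) has_sum dirichlet_series (\<lambda>_. 1) s) {0<..}"
    using norm_summable_imp_has_sum[OF sm dirichlet_one_sums[OF assms]]
    by (rule iffD1[OF has_sum_reindex_bij_betw[OF bij, of "\<lambda>n. of_nat n powr - s"]])
  have "(\<lambda>n. norm (of_nat (Suc n) powr - s :: complex)) summable_on UNIV"
    by (rule norm_summable_imp_summable_on) (use sm in simp)
  thus "Infinite_Sum.abs_summable_on (\<lambda>n::nat. of_nat n powr - s :: complex) {0<..}"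
    by (rule iffD1[OF summable_on_reindex_bij_betw[OF bij, of "\<lambda>n. norm (of_nat n powr - s :: complex)"]])
qed

text \<open>Writing \<open>g = gcd a b\<close>, both the pairs \<open>(a, b)\<close> of positive integers and
  the triples \<open>(n, a, b)\<close> with \<open>a, b\<close> dividing \<open>n\<close> are parametrised by coprime pairs
  \<open>(a/g, b/g)\<close>, with the additional free parameters \<open>g\<close>, respectively \<open>g\<close> and \<open>n/lcm a b\<close>.\<close>

theorem ramanujan_tau:
  fixes \<theta> :: real and s :: complex
  assumes s: "Re s > 1"
  defines "a \<equiv> \<lambda>n. complex_of_real ((cmod (tau n \<theta>))\<^sup>2)" and "\<zeta> \<equiv> dirichlet_series (\<lambda>_. 1)"
  shows "dirichlet_series a s * \<zeta> (2 * s) = \<zeta> s ^ 2 * \<zeta> (s + \<i> * \<theta>) * \<zeta> (s - \<i> * \<theta>)"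
    and "(\<lambda>n. a (Suc n) * of_nat (Suc n) powr - s) sums dirichlet_series a s"
proof -
  define P where "P = {0::nat<..}"
  define Cop where "Cop = {(d, e). d \<in> P \<and> e \<in> P \<and> coprime d e}"
  define h where "h = (\<lambda>(d, e). of_nat d powr - (s - \<i> * \<theta>) * of_nat e powr - (s + \<i> * \<theta>) :: complex)"
  have re: "Re (s - \<i> * \<theta>) > 1" "Re (s + \<i> * \<theta>) > 1" "Re (2 * s) > 1"
    using s by auto
  have h: "(h has_sum (\<zeta> (s - \<i> * \<theta>) * \<zeta> (s + \<i> * \<theta>))) (P \<times> P)" "Infinite_Sum.abs_summable_on h (P \<times> P)"
    unfolding h_def P_def \<zeta>_def
    by (rule has_sum_product_complex[OF has_sum_dirichlet_one[OF re(1)] has_sum_dirichlet_one[OF re(2)]])+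
  have Cop_sub: "Cop \<subseteq> P \<times> P" by (auto simp: Cop_def)
  have h_cop: "Infinite_Sum.abs_summable_on h Cop"
    by (rule summable_on_subset_banach[OF h(2) Cop_sub])
  \<comment> \<open>The sum over coprime pairs is the common unknown: \<open>eq1\<close> evaluates C
    zeta(2s), the second reindexing gives the Dirichlet series as zeta(s)^2 C, and C is then
    eliminated.\<close>
  define C where "C = infsum h Cop"
  have C: "(h has_sum C) Cop"
    unfolding C_def by (rule has_sum_infsum[OF abs_summable_summable[OF h_cop]])
  note z = has_sum_dirichlet_one[folded \<zeta>_def P_def]

  have "((\<lambda>(m, de). of_nat m powr - (2 * s) * h de) has_sum (\<zeta> (2 * s) * C)) (P \<times> Cop)"
    by (rule has_sum_product_complex(1)[OF z[OF re(3)] C h_cop])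
  also have "?this \<longleftrightarrow> (h has_sum (\<zeta> (2 * s) * C)) (P \<times> P)"
  proof (rule has_sum_reindex_bij_witness[where
        j = "\<lambda>(m, d, e). (m * d, m * e)" and i = "\<lambda>(a, b). (gcd a b, a div gcd a b, b div gcd a b)"])
    show "h ((\<lambda>(m, d, e). (m * d, m * e)) x) = (case x of (m, de) \<Rightarrow> of_nat m powr - (2 * s) * h de)" for x
    proof -
      obtain m d e where x: "x = (m, d, e)" by (cases x)
      have "of_nat m powr - (s - \<i> * \<theta>) * of_nat m powr - (s + \<i> * \<theta>) = (of_nat m powr - (2 * s) :: complex)"
        by (simp flip: powr_add)
      thus ?thesis unfolding x h_def prod.case of_nat_powr_mult by (simp add: mult_ac)
    qed
  next
    show "(\<lambda>(a, b). (gcd a b, a div gcd a b, b div gcd a b)) ((\<lambda>(m, d, e). (m * d, m * e)) x) = x"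
      if hx: "x \<in> P \<times> Cop" for x
    proof -
      obtain m d e where x: "x = (m, d, e)" "m > 0" "coprime d e"
        using hx by (auto simp: P_def Cop_def)
      have "gcd (m * d) (m * e) = m"
        using x(3) gcd_mult_distrib_nat[of m d e] by simp
      thus ?thesis using x by simp
    qed
  qed (auto simp: P_def Cop_def div_gcd_coprime div_greater_zero_iff dvd_imp_le)
  finally have eq1: "\<zeta> (2 * s) * C = \<zeta> (s - \<i> * \<theta>) * \<zeta> (s + \<i> * \<theta>)"
    using h(1) has_sum_unique by blast

  define B where "B n = {a. a dvd n} \<times> {b. b dvd n}" for n :: nat
  \<comment> \<open>These are the terms of |tau(n)|^2 n^(-s) after opening the square as a double
    sum over divisors a, b of n; conjugation turns b^(i theta) into b^(-i theta).\<close>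
  define w where "w = (\<lambda>(n, a, b). of_nat n powr - s * (of_nat a powr (\<i> * \<theta>) * of_nat b powr - (\<i> * \<theta>)) :: complex)"
  have gk: "((\<lambda>(g, k). of_nat g powr - s * of_nat k powr - s) has_sum (\<zeta> s * \<zeta> s)) (P \<times> P)"
    "Infinite_Sum.abs_summable_on (\<lambda>(g::nat, k::nat). of_nat g powr - s * of_nat k powr - s :: complex) (P \<times> P)"
    by (rule has_sum_product_complex[OF z[OF s] z[OF s]])+
  have "((\<lambda>(gk, de). (case gk of (g, k) \<Rightarrow> of_nat g powr - s * of_nat k powr - s) * h de)
      has_sum (\<zeta> s * \<zeta> s * C)) ((P \<times> P) \<times> Cop)"
    by (rule has_sum_product_complex(1)[OF gk C h_cop])
  also have "?this \<longleftrightarrow> (w has_sum (\<zeta> s * \<zeta> s * C)) (Sigma P B)"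
  proof (rule has_sum_reindex_bij_witness[where
        j = "\<lambda>((g, k), d, e). (g * k * d * e, g * d, g * e)" and
        i = "\<lambda>(n, a, b). ((gcd a b, n div lcm a b), a div gcd a b, b div gcd a b)"])
    fix x assume x: "x \<in> (P \<times> P) \<times> Cop"
    then obtain g k d e where x_eq: "x = ((g, k), d, e)" and
      pos: "g > 0" "k > 0" "d > 0" "e > 0" and cop: "coprime d e"
      by (auto simp: P_def Cop_def)
    have gcd: "gcd (g * d) (g * e) = g"
      using cop gcd_mult_distrib_nat[of g d e] by simp
    have lcm: "lcm (g * d) (g * e) = g * d * e"
      using cop by (simp add: lcm_nat_def gcd pos)
    show "(\<lambda>(n, a, b). ((gcd a b, n div lcm a b), a div gcd a b, b div gcd a b))
            ((\<lambda>((g, k), d, e). (g * k * d * e, g * d, g * e)) x) = x"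
      using pos by (simp add: x_eq gcd lcm)
    show "(\<lambda>((g, k), d, e). (g * k * d * e, g * d, g * e)) x \<in> Sigma P B"
      using pos by (auto simp: x_eq P_def B_def)
    \<comment> \<open>The common factor g cancels between a^(i theta) and b^(-i theta), so it enters
      only through n^(-s).\<close>
    have g1: "of_nat g powr (\<i> * \<theta>) * of_nat g powr - (\<i> * \<theta>) = (1 :: complex)"
      using pos by (simp flip: powr_add)
    have de: "of_nat d powr - (s - \<i> * \<theta>) = of_nat d powr - s * (of_nat d powr (\<i> * \<theta>) :: complex)"
      "of_nat e powr - (s + \<i> * \<theta>) = of_nat e powr - s * (of_nat e powr - (\<i> * \<theta>) :: complex)"
      by (simp_all flip: powr_add)
    have "w (g * k * d * e, g * d, g * e) = (of_nat g powr (\<i> * \<theta>) * of_nat g powr - (\<i> * \<theta>)) *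
        (of_nat g powr - s * of_nat k powr - s * h (d, e))"
      unfolding w_def h_def prod.case of_nat_powr_mult de by (simp only: mult_ac)
    thus "w ((\<lambda>((g, k), d, e). (g * k * d * e, g * d, g * e)) x) =
        (case x of (gk, de) \<Rightarrow> (case gk of (g, k) \<Rightarrow> of_nat g powr - s * of_nat k powr - s) * h de)"
      unfolding g1 by (simp add: x_eq)
  next
    fix y assume "y \<in> Sigma P B"
    then obtain n a b where y: "y = (n, a, b)" and n: "n > 0" and dvd: "a dvd n" "b dvd n"
      by (auto simp: P_def B_def)
    have pos: "a > 0" "b > 0" using n dvd by (auto intro: dvd_pos_nat)
    have "gcd a b * (n div lcm a b) * (a div gcd a b) * (b div gcd a b)
        = (n div lcm a b) * (gcd a b * (a div gcd a b) * (b div gcd a b))"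
      by (simp only: mult_ac)
    also have "gcd a b * (a div gcd a b) * (b div gcd a b) = lcm a b"
      by (simp add: lcm_nat_def div_mult_swap)
    also have "n div lcm a b * lcm a b = n"
      using dvd by (intro dvd_div_mult_self) (auto intro: lcm_least)
    finally have prod: "gcd a b * (n div lcm a b) * (a div gcd a b) * (b div gcd a b) = n" .
    show "(\<lambda>((g, k), d, e). (g * k * d * e, g * d, g * e))
            ((\<lambda>(n, a, b). ((gcd a b, n div lcm a b), a div gcd a b, b div gcd a b)) y) = y"
      using prod by (simp add: y)
    have "n div lcm a b > 0" "a div gcd a b > 0" "b div gcd a b > 0"
      using n prod by (metis gr0I mult_0 mult_0_right)+
    thus "(\<lambda>(n, a, b). ((gcd a b, n div lcm a b), a div gcd a b, b div gcd a b)) y \<in> (P \<times> P) \<times> Cop"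
      using pos by (auto simp: y P_def Cop_def div_gcd_coprime)
  qed simp
  finally have w_sum: "(w has_sum (\<zeta> s * \<zeta> s * C)) (Sigma P B)" .
  have inner: "((\<lambda>y. w (n, y)) has_sum (a n * of_nat n powr - s)) (B n)" if n: "n \<in> P" for n
  proof (rule has_sum_finiteI)
    show "finite (B n)" using n by (auto simp: B_def P_def)
    have cnj: "cnj (of_nat b powr (\<i> * \<theta>)) = of_nat b powr - (\<i> * \<theta>)" for b :: nat
      by (subst cnj_powr) (auto simp: complex_nonpos_Reals_iff)
    have "a n = tau n \<theta> * cnj (tau n \<theta>)"
      unfolding a_def by (rule complex_norm_square)
    also have "\<dots> = (\<Sum>a | a dvd n. \<Sum>b | b dvd n. of_nat a powr (\<i> * \<theta>) * of_nat b powr - (\<i> * \<theta>))"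
      unfolding tau_def cnj_sum cnj sum_product ..
    also have "\<dots> = (\<Sum>(a, b)\<in>B n. of_nat a powr (\<i> * \<theta>) * of_nat b powr - (\<i> * \<theta>))"
      unfolding B_def by (rule sum.cartesian_product)
    finally show "a n * of_nat n powr - s = (\<Sum>y\<in>B n. w (n, y))"
      unfolding w_def by (simp add: sum_distrib_left case_prod_unfold mult_ac)
  qed
  have "((\<lambda>n. a n * of_nat n powr - s) has_sum (\<zeta> s * \<zeta> s * C)) P"
    by (rule has_sum_SigmaD[OF w_sum inner])
  moreover have bij: "bij_betw Suc UNIV P"
    by (rule bij_betwI[of _ _ _ "\<lambda>n. n - 1"]) (auto simp: P_def)
  ultimately have "((\<lambda>n. a (Suc n) * of_nat (Suc n) powr - s) has_sum (\<zeta> s * \<zeta> s * C)) UNIV"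
    by (intro iffD2[OF has_sum_reindex_bij_betw[OF bij, of "\<lambda>n. a n * of_nat n powr - s"]])
  hence sums: "(\<lambda>n. a (Suc n) * of_nat (Suc n) powr - s) sums (\<zeta> s * \<zeta> s * C)"
    by (rule has_sum_imp_sums)
  hence D: "dirichlet_series a s = \<zeta> s * \<zeta> s * C"
    unfolding dirichlet_series_def by (simp add: powr_minus_divide sums_iff)
  show "(\<lambda>n. a (Suc n) * of_nat (Suc n) powr - s) sums dirichlet_series a s"
    using sums D by simp
  show "dirichlet_series a s * \<zeta> (2 * s) = \<zeta> s ^ 2 * \<zeta> (s + \<i> * \<theta>) * \<zeta> (s - \<i> * \<theta>)"
    using eq1 unfolding D by (simp add: power2_eq_square mult_ac)
qed

section \<open>Mellin transforms\<close>

text \<open>Integrability and value travel together, so sums and multiples of transforms need no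
  separate side conditions.\<close>

definition has_mellin :: "(real \<Rightarrow> real) \<Rightarrow> real \<Rightarrow> real \<Rightarrow> bool" where
  "has_mellin g c v \<longleftrightarrow>
     has_bochner_integral lborel (\<lambda>x. indicator {1..} x * (g x * x powr (- c - 1))) v"

lemma has_mellin_add:
  "has_mellin f c v \<Longrightarrow> has_mellin g c w \<Longrightarrow> has_mellin (\<lambda>x. f x + g x) c (v + w)"
  unfolding has_mellin_def by (drule (1) has_bochner_integral_add) (simp add: algebra_simps)

lemma has_mellin_cmult: "has_mellin g c v \<Longrightarrow> has_mellin (\<lambda>x. a * g x) c (a * v)"
  unfolding has_mellin_def
  using has_bochner_integral_mult_right[where c = a] by (simp only: mult.assoc mult.left_commute[of _ a])

lemma has_mellinD:
  assumes "has_mellin g c v"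
  shows "set_integrable lborel {1..} (\<lambda>x. g x * x powr (- c - 1))"
    and "(LINT x:{1..}|lborel. g x * x powr (- c - 1)) = v"
  using assms by (simp_all add: has_mellin_def has_bochner_integral_iff set_integrable_def
      set_lebesgue_integral_def)

text \<open>Nonnegativity is what lets an antiderivative vanishing at infinity yield absolute
  integrability. The lower limit \<open>m\<close> is free because each term of a summatory function
  starts at its own integer.\<close>

lemma has_mellin_FTC:
  assumes [measurable]: "g \<in> borel_measurable borel"
    and nonneg: "\<And>x. x \<ge> 1 \<Longrightarrow> g x \<ge> 0" and m: "m \<ge> 1"
    and F: "\<And>x. x \<ge> m \<Longrightarrow> (F has_real_derivative g x * x powr (- c - 1)) (at x)"
    and lim: "(F \<longlongrightarrow> 0) at_top"
  shows "has_bochner_integral lborel (\<lambda>x. indicator {m..} x * (g x * x powr (- c - 1))) (- F m)"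
proof (rule has_bochner_integral_nn_integral)
  have "F m \<le> 0"
  proof (rule tendsto_lowerbound[OF lim])
    show "\<forall>\<^sub>F x in at_top. F m \<le> F x" using eventually_ge_at_top[of m]
    proof eventually_elim
      case (elim x)
      show ?case
        by (rule DERIV_nonneg_imp_nondecreasing[OF elim])
          (use F nonneg m in \<open>fastforce intro!: mult_nonneg_nonneg\<close>)
    qed
  qed simp
  thus "0 \<le> - F m" by simp
  define h where "h x = (if x \<ge> m then g x * x powr (- c - 1) else 0)" for x
  have "(\<integral>\<^sup>+x. ennreal (h x) * indicator {m..} x \<partial>lborel) = ennreal (0 - F m)"
  proof (rule nn_integral_FTC_atLeast[OF _ _ _ lim])
    show "h \<in> borel_measurable borel" unfolding h_def by measurable
    show "(F has_real_derivative h x) (at x)" if "m \<le> x" for x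
      using F[OF that] that by (simp add: h_def)
    show "0 \<le> h x" if "m \<le> x" for x using that nonneg m by (simp add: h_def)
  qed
  also have "(\<lambda>x. ennreal (h x) * indicator {m..} x)
      = (\<lambda>x. ennreal (indicator {m..} x * (g x * x powr (- c - 1))))"
    by (auto simp: fun_eq_iff indicator_def h_def)
  finally show "(\<integral>\<^sup>+x. ennreal (indicator {m..} x * (g x * x powr (- c - 1))) \<partial>lborel) = ennreal (- F m)"
    by simp
qed (use nonneg m in \<open>auto simp: indicator_def\<close>)

lemma has_bochner_integral_powr_tail:
  fixes a c m :: real
  assumes "a < c" "m \<ge> 1"
  shows "has_bochner_integral lborel (\<lambda>x. indicator {m..} x * (x powr a * x powr (- c - 1)))
           (m powr (a - c) / (c - a))"
proof -
  define F where "F x = - (x powr (a - c) / (c - a))" for x :: real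
  have "has_bochner_integral lborel (\<lambda>x. indicator {m..} x * (x powr a * x powr (- c - 1))) (- F m)"
  proof (rule has_mellin_FTC[OF _ _ assms(2)])
    show "(F has_real_derivative x powr a * x powr (- c - 1)) (at x)" if "x \<ge> m" for x
    proof -
      have x: "x > 0" using that assms by simp
      have "(F has_real_derivative - (((a - c) * x powr (a - c - 1)) / (c - a))) (at x)"
        unfolding F_def by (intro DERIV_minus DERIV_cdivide has_real_derivative_powr x)
      also have "- (((a - c) * x powr (a - c - 1)) / (c - a)) = x powr (a - c - 1)"
        using assms by (simp add: field_simps)
      also have "\<dots> = x powr a * x powr (- c - 1)"
        by (simp add: algebra_simps flip: powr_add)
      finally show ?thesis .
    qed
    have "((\<lambda>x::real. x powr (a - c)) \<longlongrightarrow> 0) at_top"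
      using assms by (intro tendsto_neg_powr filterlim_ident) auto
    from tendsto_minus[OF tendsto_divide[OF this tendsto_const[of "c - a"]]]
    show "(F \<longlongrightarrow> 0) at_top" unfolding F_def using assms by simp
  qed auto
  thus ?thesis by (simp add: F_def)
qed

lemma has_mellin_powr: "a < c \<Longrightarrow> has_mellin (\<lambda>x. x powr a) c (1 / (c - a))"
  using has_bochner_integral_powr_tail[of a c 1] by (simp add: has_mellin_def)

lemma has_mellin_id:
  assumes "c > 1"
  shows "has_mellin (\<lambda>x. x) c (1 / (c - 1))"
proof -
  have "(\<lambda>x::real. indicator {1..} x * (x * x powr (- c - 1)) :: real)
      = (\<lambda>x. indicator {1..} x * (x powr 1 * x powr (- c - 1)))"
    by (auto simp: fun_eq_iff indicator_def)
  thus ?thesis using has_mellin_powr[OF assms] unfolding has_mellin_def by (simp only:)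
qed

lemma has_mellin_x_ln:
  assumes "c > 1"
  shows "has_mellin (\<lambda>x. x * ln x) c (1 / (c - 1)\<^sup>2)"
proof -
  define \<delta> where "\<delta> = c - 1"
  have \<delta>: "\<delta> > 0" "- c - 1 = - \<delta> - 2" using assms by (auto simp: \<delta>_def)
  define F where "F x = - (x powr - \<delta> * (ln x / \<delta> + 1 / \<delta>\<^sup>2))" for x :: real
  have "has_bochner_integral lborel (\<lambda>x. indicator {1..} x * ((x * ln x) * x powr (- c - 1))) (- F 1)"
  proof (rule has_mellin_FTC)
    show "(F has_real_derivative (x * ln x) * x powr (- c - 1)) (at x)" if "x \<ge> 1" for x
    proof -
      have x: "x > 0" using that by simp
      have "(F has_real_derivative
          - ((- \<delta> * x powr (- \<delta> - 1)) * (ln x / \<delta> + 1 / \<delta>\<^sup>2) + (1 / x) / \<delta> * x powr - \<delta>)) (at x)"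
        unfolding F_def using x \<delta>
        by (intro DERIV_minus DERIV_mult has_real_derivative_powr) (auto intro!: derivative_eq_intros)
      also have "- ((- \<delta> * x powr (- \<delta> - 1)) * (ln x / \<delta> + 1 / \<delta>\<^sup>2) + (1 / x) / \<delta> * x powr - \<delta>)
          = (x * ln x) * x powr (- \<delta> - 2)"
      proof -
        have e: "x powr - \<delta> = x * (x * x powr (- \<delta> - 2))" "x powr (- \<delta> - 1) = x * x powr (- \<delta> - 2)"
          using x by (simp_all add: powr_diff power2_eq_square)
        show ?thesis unfolding e
          using x \<delta>(1) by (simp add: field_simps power2_eq_square)
      qed
      finally show ?thesis unfolding \<delta>(2) .
    qed
    show "(F \<longlongrightarrow> 0) at_top"
      unfolding F_def using \<delta>(1) by real_asymp
  qed auto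
  thus ?thesis unfolding has_mellin_def by (simp add: F_def \<delta>_def)
qed

text \<open>The integrands change sign, so the antiderivative argument for nonnegative functions
  does not apply. Instead the real formula 1/d is continued to complex s by the identity theorem,
  and real and imaginary parts are taken.\<close>

lemma has_mellin_trig:
  fixes c \<theta> :: real
  assumes c: "c > 1"
  shows "has_mellin (\<lambda>x. x * cos (\<theta> * ln x)) c ((c - 1) / ((c - 1)\<^sup>2 + \<theta>\<^sup>2))"
    and "has_mellin (\<lambda>x. x * sin (\<theta> * ln x)) c (\<theta> / ((c - 1)\<^sup>2 + \<theta>\<^sup>2))"
proof -
  define M where "M = density lborel (\<lambda>x. ennreal (indicator {1..} x / x))"
  define L :: "real \<Rightarrow> real" where "L x = max 0 (ln x)" for x
  have [measurable]: "L \<in> borel_measurable borel" unfolding L_def by measurable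
  have LM: "L \<in> borel_measurable M" by (simp add: M_def)
  have L0: "L x \<ge> 0" for x by (simp add: L_def)
  have pos: "AE x in lborel. 0 \<le> indicator {1..} x / (x::real)" by (auto simp: indicator_def)
  have real: "has_bochner_integral M (\<lambda>x. exp (- d * L x)) (1 / d)" if d: "d > 0" for d
    unfolding M_def
  proof (rule has_bochner_integral_density[OF _ _ pos])
    have "indicator {1..} x * (x powr 0 * x powr (- d - 1)) = (indicator {1..} x / x) *\<^sub>R exp (- d * L x)" for x :: real
      by (auto simp: indicator_def L_def powr_def exp_diff exp_minus field_simps)
    thus "has_bochner_integral lborel (\<lambda>x. (indicator {1..} x / x) *\<^sub>R exp (- d * L x)) (1 / d)"
      using has_bochner_integral_powr_tail[of 0 d 1] d by simp
  qed measurable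
  have int: "integrable M (\<lambda>x. exp (- d * L x))" if "d > 0" for d
    using real[OF that] by (simp add: has_bochner_integral_iff)
  \<comment> \<open>With this choice exp(-s ln x) = x^(1 - c) (cos(theta ln x) + i sin(theta ln
    x)).\<close>
  define s where "s = Complex (c - 1) (- \<theta>)"
  have s: "Re s > 0" using c by (simp add: s_def)
  have "(\<integral>x. exp (- s * of_real (L x)) \<partial>M) * s = 1"
  proof (rule holomorphic_quotient_identity[where b = 0 and c = 0 and N = "\<lambda>_. 1" and Q = "\<lambda>s. s"])
    show "(\<lambda>s. \<integral>x. exp (- s * of_real (L x)) \<partial>M) holomorphic_on {s. 0 < Re s}"
      by (rule laplace_holomorphic[OF LM L0 int])
    show "(\<integral>x. exp (- of_real d * of_real (L x)) \<partial>M) * of_real d = (1 :: complex)" if d: "d > 0" for d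
    proof -
      have "(\<integral>x. exp (- of_real d * of_real (L x)) \<partial>M) = (\<integral>x. complex_of_real (exp (- d * L x)) \<partial>M)"
        by (simp flip: exp_of_real)
      also have "\<dots> = of_real (1 / d)"
        unfolding integral_complex_of_real has_bochner_integral_integral_eq[OF real[OF d]] ..
      finally show ?thesis using d by simp
    qed
  qed (use s in auto)
  moreover have "s \<noteq> 0" using s by auto
  ultimately have val: "(\<integral>x. exp (- s * of_real (L x)) \<partial>M) = 1 / s"
    by (simp add: field_simps)
  have "integrable M (\<lambda>x. exp (- s * of_real (L x)))"
  proof (rule laplace_power_series(2)[OF LM L0])
    define r where "r = (c - 1) / 2"
    have r: "r > 0" "Re s = 2 * r" using c by (auto simp: r_def s_def)
    show "integrable M (\<lambda>x. exp (- r * L x))" by (rule int) (use r in simp)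
    show "norm (s - (s + of_real r)) \<le> Re (s + of_real r) - r" using r by simp
  qed
  hence cint: "has_bochner_integral M (\<lambda>x. exp (- s * of_real (L x))) (1 / s)"
    using val by (simp add: has_bochner_integral_iff)
  have "has_bochner_integral lborel (\<lambda>x. (indicator {1..} x / x) *\<^sub>R exp (- s * of_real (L x))) (1 / s)"
    using cint integrable_density[OF _ _ pos, of "\<lambda>x. exp (- s * of_real (L x))"]
      integral_density[OF _ _ pos, of "\<lambda>x. exp (- s * of_real (L x))"]
    unfolding M_def has_bochner_integral_iff by simp
  also have "(\<lambda>x. (indicator {1..} x / x) *\<^sub>R exp (- s * of_real (L x))) =
      (\<lambda>x. Complex (indicator {1..} x * ((x * cos (\<theta> * ln x)) * x powr (- c - 1)))
                   (indicator {1..} x * ((x * sin (\<theta> * ln x)) * x powr (- c - 1))))"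
  proof
    fix x :: real
    show "(indicator {1..} x / x) *\<^sub>R exp (- s * of_real (L x)) =
        Complex (indicator {1..} x * ((x * cos (\<theta> * ln x)) * x powr (- c - 1)))
                (indicator {1..} x * ((x * sin (\<theta> * ln x)) * x powr (- c - 1)))"
    proof (cases "x \<ge> 1")
      case True
      have e: "exp (- ((c - 1) * ln x)) = x * (x * x powr (- c - 1))"
        using True by (simp add: powr_def exp_diff exp_minus algebra_simps exp_add field_simps)
      show ?thesis
        using True by (simp add: complex_eq_iff s_def L_def Re_exp Im_exp e)
    qed (simp add: complex_eq_iff)
  qed
  finally have *: "has_bochner_integral lborel (\<lambda>x. Complex (indicator {1..} x * ((x * cos (\<theta> * ln x)) * x powr (- c - 1)))
                   (indicator {1..} x * ((x * sin (\<theta> * ln x)) * x powr (- c - 1)))) (1 / s)" .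
  have inv: "Re (1 / s) = (c - 1) / ((c - 1)\<^sup>2 + \<theta>\<^sup>2)" "Im (1 / s) = \<theta> / ((c - 1)\<^sup>2 + \<theta>\<^sup>2)"
    by (simp_all add: s_def Re_divide Im_divide)
  show "has_mellin (\<lambda>x. x * cos (\<theta> * ln x)) c ((c - 1) / ((c - 1)\<^sup>2 + \<theta>\<^sup>2))"
    using has_bochner_integral_bounded_linear[OF bounded_linear_Re *]
    unfolding has_mellin_def inv by simp
  show "has_mellin (\<lambda>x. x * sin (\<theta> * ln x)) c (\<theta> / ((c - 1)\<^sup>2 + \<theta>\<^sup>2))"
    using has_bochner_integral_bounded_linear[OF bounded_linear_Im *]
    unfolding has_mellin_def inv by simp
qed

section \<open>Mellin transforms of summatory functions\<close>

lemma mono_sum_star: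
  assumes "\<And>n. a n \<ge> 0"
  shows "mono (sum_star a)"
proof (rule monoI)
  fix x y :: real assume xy: "x \<le> y"
  have fin: "finite {n. 0 < n \<and> real n \<le> z}" for z
    by (rule finite_subset[of _ "{..nat \<lfloor>z\<rfloor>}"]) (auto simp: le_nat_floor)
  show "sum_star a x \<le> sum_star a y"
    unfolding sum_star_def
  proof (rule sum_le_included[OF fin fin, where i = "\<lambda>n. n"])
    show "\<forall>n\<in>{n. 0 < n \<and> real n \<le> x}. \<exists>k\<in>{n. 0 < n \<and> real n \<le> y}. k = n \<and>
        (if real n = x then 1 / 2 else 1) * a n \<le> (if real k = y then 1 / 2 else 1) * a k"
      using xy assms by (auto intro!: mult_right_mono)
  qed (use assms in auto)
qed

text \<open>The n-th coefficient contributes its multiple of the integral of x^(-c-1) over [n,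
  infinity), which is n^(-c)/c; nonnegativity permits interchanging sum and integral. The half
  weights change the function only at integers, a null set.\<close>

lemma has_mellin_sum_star:
  assumes nonneg: "\<And>n. a n \<ge> 0" and c: "c > 0"
    and sums: "(\<lambda>n. a (Suc n) * real (Suc n) powr - c) sums S"
  shows "has_mellin (sum_star a) c (S / c)"
proof -
  define f where "f k x = a (Suc k) * (indicator {real (Suc k)..} x * (x powr 0 * x powr (- c - 1)))"
    for k and x :: real
  have f: "has_bochner_integral lborel (f k) (a (Suc k) * (real (Suc k) powr - c / c))" for k
    unfolding f_def using has_bochner_integral_powr_tail[of 0 c "real (Suc k)"] c
    by (intro has_bochner_integral_mult_right) simp
  have f0: "f k x \<ge> 0" for k x using nonneg by (simp add: f_def)
  have fi: "integrable lborel (f k)" and fv: "integral\<^sup>L lborel (f k) = a (Suc k) * (real (Suc k) powr - c / c)" for k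
    using f[of k] by (auto simp: has_bochner_integral_iff)
  have fl: "k < nat \<lfloor>x\<rfloor> \<longleftrightarrow> real (Suc k) \<le> x" for k x
    by (simp add: zless_nat_eq_int_zless less_floor_iff add.commute)
  have zero: "f k x = 0" if "k \<notin> {..<nat \<lfloor>x\<rfloor>}" for k x
  proof -
    have "\<not> real (Suc k) \<le> x" using that by (simp add: fl del: of_nat_Suc)
    thus ?thesis by (simp add: f_def)
  qed
  have Sc: "(\<lambda>k. a (Suc k) * (real (Suc k) powr - c / c)) sums (S / c)"
    using sums_divide[OF sums, of c] by simp
  have ae: "AE x in lborel. summable (\<lambda>k. norm (f k x))"
    using zero by (intro AE_I2 summable_finite[of "{..<nat \<lfloor>x\<rfloor>}" for x]) auto
  have sm: "summable (\<lambda>k. \<integral>x. norm (f k x) \<partial>lborel)"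
    using sums_summable[OF Sc] f0 by (simp add: fv)
  have total: "has_bochner_integral lborel (\<lambda>x. \<Sum>k. f k x) (S / c)"
    using integrable_suminf[OF fi ae sm] sums_unique2[OF sums_integral[OF fi ae sm] Sc[folded fv]]
    by (simp add: has_bochner_integral_iff)
  have ae_eq: "AE x in lborel. (\<Sum>k. f k x) = indicator {1..} x * (sum_star a x * x powr (- c - 1))"
  proof -
    have "countable (range real)" by simp
    hence "AE x in lborel. x \<notin> range real"
      by (intro AE_not_in countable_imp_null_set_lborel)
    thus ?thesis
    proof eventually_elim
      case (elim x)
      show ?case
      proof (cases "x \<ge> 1")
        case True
        have "(\<Sum>k. f k x) = (\<Sum>k<nat \<lfloor>x\<rfloor>. f k x)"
          by (rule suminf_finite) (use zero in auto)
        also have "\<dots> = (\<Sum>k<nat \<lfloor>x\<rfloor>. a (Suc k) * x powr (- c - 1))"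
          using True by (intro sum.cong) (auto simp: f_def fl simp del: of_nat_Suc)
        also have "\<dots> = (\<Sum>n | 0 < n \<and> real n \<le> x. a n * x powr (- c - 1))"
          by (rule sum.reindex_bij_witness[of _ "\<lambda>n. n - 1" Suc])
            (auto simp: fl simp del: of_nat_Suc)
        also have "\<dots> = sum_star a x * x powr (- c - 1)"
          unfolding sum_star_def sum_distrib_right using elim
          by (intro sum.cong) auto
        finally show ?thesis using True by simp
      next
        case False
        hence "f k x = 0" for k by (simp add: f_def)
        thus ?thesis using False by simp
      qed
    qed
  qed
  have [measurable]: "sum_star a \<in> borel_measurable borel"
    by (rule borel_measurable_mono[OF mono_sum_star[OF nonneg]])
  have [measurable]: "f k \<in> borel_measurable borel" for k unfolding f_def by measurable
  show ?thesis unfolding has_mellin_def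
    by (rule has_bochner_integral_cong_AE[THEN iffD1, OF _ _ ae_eq total]) measurable
qed

section \<open>Residues of the Dirichlet series\<close>

text \<open>With \<open>D_den\<close> this writes D as a quotient of entire functions: every zeta
  factor is replaced by its pole-free version, the factors s - 1 and s +- i theta - 1 collect in the
  denominator, and 2s - 1 comes from zeta(2s).\<close>

definition D_num :: "real \<Rightarrow> complex \<Rightarrow> complex" where
  "D_num \<theta> s = zeta_pole_removed s ^ 2 * zeta_pole_removed (s + \<i> * of_real \<theta>)
     * zeta_pole_removed (s - \<i> * of_real \<theta>) * (2 * s - 1)"

definition D_den :: "real \<Rightarrow> complex \<Rightarrow> complex" where
  "D_den \<theta> s = (s - 1) ^ 2 * ((s - 1) ^ 2 + of_real \<theta> ^ 2) * zeta_pole_removed (2 * s)"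

lemma quadratic_factor:
  "(s - 1) ^ 2 + of_real \<theta> ^ 2 = (s - (1 + \<i> * of_real \<theta>)) * (s - (1 - \<i> * of_real \<theta>))"
  by (simp add: algebra_simps power2_eq_square)

lemma quadratic_nonzero:
  assumes "Re s \<noteq> 1"
  shows "(s - 1) ^ 2 + of_real \<theta> ^ 2 \<noteq> 0"
proof -
  have "s - (1 + \<i> * of_real \<theta>) \<noteq> 0" "s - (1 - \<i> * of_real \<theta>) \<noteq> 0"
    using assms by (auto simp: complex_eq_iff)
  thus ?thesis unfolding quadratic_factor by simp
qed

lemma holomorphic_D_num: "D_num \<theta> holomorphic_on A"
  unfolding D_num_def[abs_def] by (intro holomorphic_intros)

lemma holomorphic_D_den: "D_den \<theta> holomorphic_on A"
  unfolding D_den_def[abs_def] by (intro holomorphic_intros)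

lemma D_den_nonzero:
  assumes "Re s > 1"
  shows "D_den \<theta> s \<noteq> 0"
proof -
  have "zeta_pole_removed (2 * s) \<noteq> 0" by (rule zeta_pole_removed_nonzero) (use assms in simp)
  moreover have "s - 1 \<noteq> 0" using assms by auto
  ultimately show ?thesis using quadratic_nonzero[of s \<theta>] assms by (simp add: D_den_def)
qed

lemma dirichlet_series_tau:
  assumes s: "Re s > 1"
  shows "dirichlet_series (\<lambda>n. of_real ((cmod (tau n \<theta>))\<^sup>2)) s = D_num \<theta> s / D_den \<theta> s"
proof -
  let ?D = "dirichlet_series (\<lambda>n. of_real ((cmod (tau n \<theta>))\<^sup>2)) s"
  let ?\<zeta> = "dirichlet_series (\<lambda>_. 1)"
  have "D_num \<theta> s = (s - 1) ^ 2 * ((s + \<i> * \<theta> - 1) * (s - \<i> * \<theta> - 1)) * (2 * s - 1) *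
      (?\<zeta> s ^ 2 * ?\<zeta> (s + \<i> * \<theta>) * ?\<zeta> (s - \<i> * \<theta>))"
    using s by (simp add: D_num_def zeta_pole_removed_eq power_mult_distrib mult_ac)
  also have "(s + \<i> * \<theta> - 1) * (s - \<i> * \<theta> - 1) = (s - 1) ^ 2 + of_real \<theta> ^ 2"
    unfolding quadratic_factor by (simp add: algebra_simps)
  also have "?\<zeta> s ^ 2 * ?\<zeta> (s + \<i> * \<theta>) * ?\<zeta> (s - \<i> * \<theta>) = ?D * ?\<zeta> (2 * s)"
    using ramanujan_tau(1)[OF s, of \<theta>] by simp
  finally have "D_num \<theta> s = ?D * D_den \<theta> s"
    using s by (simp add: D_den_def zeta_pole_removed_eq mult_ac)
  thus ?thesis using D_den_nonzero[OF s, of \<theta>] by simp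
qed

lemma meromorphic_D_quotient: "(\<lambda>s. D_num \<theta> s / D_den \<theta> s) meromorphic_on A"
  using holomorphic_D_num[of \<theta> UNIV] holomorphic_D_den[of \<theta> UNIV]
  by (intro meromorphic_on_divide analytic_on_imp_meromorphic_on)
     (auto simp: analytic_on_open intro: analytic_on_subset[of _ UNIV])

text \<open>\<open>remove_sings\<close> supplies the normalisation built into
  \<open>halfplane_continuation\<close>: limits at removable points and 0 at poles. Residues are
  unaffected by it.\<close>

lemma D_eq: "D \<theta> = remove_sings (\<lambda>s. D_num \<theta> s / D_den \<theta> s)"
  unfolding D_def
proof (rule halfplane_continuation_eqI)
  show "remove_sings (\<lambda>s. D_num \<theta> s / D_den \<theta> s) nicely_meromorphic_on UNIV"
    by (intro remove_sings_nicely_meromorphic meromorphic_D_quotient)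
  show "remove_sings (\<lambda>s. D_num \<theta> s / D_den \<theta> s) s
      = dirichlet_series (\<lambda>n. of_real ((cmod (tau n \<theta>))\<^sup>2)) s" if s: "Re s > 1" for s
  proof -
    have "(\<lambda>s. D_num \<theta> s / D_den \<theta> s) holomorphic_on {s. Re s > 1}"
      using D_den_nonzero by (intro holomorphic_intros holomorphic_D_num holomorphic_D_den) auto
    hence "(\<lambda>s. D_num \<theta> s / D_den \<theta> s) analytic_on {s}"
      using s by (auto simp: analytic_on_open[OF open_halfspace_Re_gt, symmetric] intro: analytic_on_subset)
    thus ?thesis using dirichlet_series_tau[OF s, of \<theta>] by (simp only: remove_sings_at_analytic)
  qed
qed

lemma isolated_singularity_D_quotient: "isolated_singularity_at (\<lambda>s. D_num \<theta> s / D_den \<theta> s) z"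
  and not_essential_D_quotient: "not_essential (\<lambda>s. D_num \<theta> s / D_den \<theta> s) z"
  using meromorphic_D_quotient[of \<theta> "{z}"] by (auto simp: meromorphic_at_iff)

lemma residue_D: "residue (D \<theta>) z = residue (\<lambda>s. D_num \<theta> s / D_den \<theta> s) z"
  unfolding D_eq by (rule residue_remove_sings[OF isolated_singularity_D_quotient])

lemma residue_D_kernel:
  "residue (\<lambda>s. D \<theta> s * of_real x powr s / s) \<rho>
     = residue (\<lambda>s. D_num \<theta> s / D_den \<theta> s * of_real x powr s / s) \<rho>"
proof (rule residue_cong)
  show "\<forall>\<^sub>F s in at \<rho>. D \<theta> s * of_real x powr s / s = D_num \<theta> s / D_den \<theta> s * of_real x powr s / s"
    using eventually_remove_sings_eq_at[OF isolated_singularity_D_quotient[of \<theta> \<rho>]]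
    by eventually_elim (simp add: D_eq)
qed simp

section \<open>Real coefficients and the explicit main term\<close>

lemma D_quotient_real:
  assumes c: "c > 1"
  obtains S where "(\<lambda>n. (cmod (tau (Suc n) \<theta>))\<^sup>2 * real (Suc n) powr - c) sums S"
    and "D_num \<theta> (of_real c) / D_den \<theta> (of_real c) = of_real S"
proof -
  define t where "t n = (cmod (tau (Suc n) \<theta>))\<^sup>2 * real (Suc n) powr - c" for n
  have p: "complex_of_nat (Suc m) powr - of_real y = of_real (real (Suc m) powr - y)" for m y
    using powr_of_real[of "real (Suc m)" "- y"] by simp
  have "(\<lambda>n. complex_of_real (t n)) sums (D_num \<theta> (of_real c) / D_den \<theta> (of_real c))"
    using ramanujan_tau(2)[of "of_real c" \<theta>, unfolded p] c dirichlet_series_tau[of "of_real c" \<theta>]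
    by (simp only: t_def of_real_mult Re_complex_of_real)
  moreover from sums_summable[OF this] have "t sums suminf t"
    unfolding summable_of_real_iff by (rule summable_sums)
  ultimately show ?thesis
    using that[of "suminf t"] sums_unique2[OF _ sums_of_real[of t "suminf t"]] unfolding t_def by blast
qed

text \<open>This is (s - 1)^2 D(s)/s with the double pole at 1 cancelled; its value and derivative
  at 1 are the coefficients of the polar part of D(s)/s there.\<close>

definition D_reg :: "real \<Rightarrow> complex \<Rightarrow> complex" where
  "D_reg \<theta> s = D_num \<theta> s / (((s - 1) ^ 2 + of_real \<theta> ^ 2) * zeta_pole_removed (2 * s) * s)"

lemma analytic_D_num: "D_num \<theta> analytic_on A"
  using holomorphic_D_num[of \<theta> UNIV] by (auto simp: analytic_on_open intro: analytic_on_subset[of _ UNIV])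

lemma analytic_D_reg:
  assumes "\<theta> \<noteq> 0"
  shows "D_reg \<theta> analytic_on {1}"
  unfolding D_reg_def[abs_def] using assms zeta_pole_removed_nonzero[of 2]
  by (intro analytic_intros analytic_D_num) auto

text \<open>Both the value and the derivative are limits of real quantities along real points
  approaching from the right, and the reals are closed. Only the right side is accessible, since the
  Dirichlet series converges there.\<close>

lemma real_on_right_imp_real:
  fixes f :: "complex \<Rightarrow> complex"
  assumes f: "f analytic_on {of_real a}" and real: "\<And>x. x > a \<Longrightarrow> f (of_real x) \<in> \<real>"
  shows "f (of_real a) \<in> \<real>" "deriv f (of_real a) \<in> \<real>"
proof -
  define u where "u n = complex_of_real (a + inverse (real (Suc n)))" for n
  have "(\<lambda>n. a + inverse (real (Suc n))) \<longlonglongrightarrow> a + 0"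
    by (intro tendsto_intros LIMSEQ_inverse_real_of_nat)
  hence u: "u \<longlonglongrightarrow> of_real a" unfolding u_def by (intro tendsto_of_real) simp
  have u_ne: "u n \<noteq> of_real a" for n
    unfolding u_def of_real_eq_iff by (simp del: of_nat_Suc)
  have fu: "f (u n) \<in> \<real>" for n unfolding u_def by (rule real) simp
  have "isCont f (of_real a)" using f by (rule analytic_at_imp_isCont)
  hence "(\<lambda>n. f (u n)) \<longlonglongrightarrow> f (of_real a)" using u by (rule isCont_tendsto_compose)
  thus fa: "f (of_real a) \<in> \<real>"
    by (rule Lim_in_closed_set[OF closed_complex_Reals, rotated 2]) (use fu in auto)
  have "(f has_field_derivative deriv f (of_real a)) (at (of_real a))"
    using f analytic_on_imp_differentiable_at field_differentiable_derivI by blast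
  hence "((\<lambda>y. (f y - f (of_real a)) / (y - of_real a)) \<longlongrightarrow> deriv f (of_real a)) (at (of_real a))"
    by (simp add: has_field_derivative_iff)
  moreover have "filterlim u (at (of_real a)) sequentially"
    unfolding filterlim_at using u u_ne by simp
  ultimately have "(\<lambda>n. (f (u n) - f (of_real a)) / (u n - of_real a)) \<longlonglongrightarrow> deriv f (of_real a)"
    by (rule filterlim_compose)
  moreover have "u n \<in> \<real>" for n by (simp add: u_def del: of_real_add)
  ultimately show "deriv f (of_real a) \<in> \<real>"
    by (intro Lim_in_closed_set[OF closed_complex_Reals _ _ \<open>(\<lambda>n. _ n / _ n) \<longlonglongrightarrow> _\<close>])
      (use fu fa in \<open>auto intro!: Reals_divide Reals_diff\<close>)
qed

lemma D_reg_real: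
  assumes "\<theta> \<noteq> 0"
  shows "D_reg \<theta> 1 \<in> \<real>" "deriv (D_reg \<theta>) 1 \<in> \<real>"
proof -
  have "D_reg \<theta> (of_real x) \<in> \<real>" if x: "x > 1" for x
  proof -
    obtain S where S: "D_num \<theta> (of_real x) / D_den \<theta> (of_real x) = of_real S"
      using D_quotient_real[OF x] by blast
    have "D_reg \<theta> (of_real x) = (D_num \<theta> (of_real x) / D_den \<theta> (of_real x)) * (of_real x - 1) ^ 2 / of_real x"
    proof -
      have "complex_of_real x - 1 \<noteq> 0" using x by (simp add: complex_eq_iff)
      thus ?thesis by (simp add: D_reg_def D_den_def)
    qed
    also have "\<dots> \<in> \<real>" unfolding S by (intro Reals_divide Reals_mult Reals_power Reals_diff) auto
    finally show ?thesis .
  qed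
  thus "D_reg \<theta> 1 \<in> \<real>" "deriv (D_reg \<theta>) 1 \<in> \<real>"
    using real_on_right_imp_real[of "D_reg \<theta>" 1] analytic_D_reg[OF assms] by auto
qed

text \<open>At a double pole the residue is the derivative of \<open>D_reg\<close> times x^s; the
  logarithm comes from differentiating x^s.\<close>

lemma residue_D_kernel_1:
  assumes \<theta>: "\<theta> \<noteq> 0" and x: "x > 0"
  shows "residue (\<lambda>s. D \<theta> s * of_real x powr s / s) 1
           = deriv (D_reg \<theta>) 1 * of_real x + D_reg \<theta> 1 * of_real (x * ln x)"
proof -
  define f where "f s = D_reg \<theta> s * of_real x powr s" for s
  obtain A where A: "open A" "1 \<in> A" "D_reg \<theta> holomorphic_on A"
    using analytic_D_reg[OF \<theta>] by (auto simp: analytic_at)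
  have f: "f holomorphic_on A" unfolding f_def
    using x by (intro holomorphic_intros A) auto
  have "residue (\<lambda>s. D_num \<theta> s / D_den \<theta> s * of_real x powr s / s) 1 = residue (\<lambda>s. f s / (s - 1) ^ Suc 1) 1"
    by (simp add: f_def D_reg_def D_den_def power2_eq_square mult_ac)
  also have "\<dots> = deriv f 1"
    using residue_holomorphic_over_power[OF A(1,2) f, of 1] by simp
  also have "deriv f 1 = deriv (D_reg \<theta>) 1 * of_real x powr 1 + D_reg \<theta> 1 * (of_real x powr 1 * Ln (of_real x))"
  proof (rule DERIV_imp_deriv)
    have "(D_reg \<theta> has_field_derivative deriv (D_reg \<theta>) 1) (at 1)"
      using A holomorphic_derivI by blast
    moreover have "((\<lambda>s. of_real x powr s) has_field_derivative of_real x powr 1 * Ln (of_real x)) (at (1::complex))"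
      using x by (auto intro!: derivative_eq_intros)
    ultimately show "(f has_field_derivative deriv (D_reg \<theta>) 1 * of_real x powr 1 + D_reg \<theta> 1 * (of_real x powr 1 * Ln (of_real x))) (at 1)"
      unfolding f_def by (rule DERIV_mult'[THEN DERIV_cong]) (simp add: mult_ac)
  qed
  finally show ?thesis unfolding residue_D_kernel using x by (simp add: Ln_of_real)
qed

lemma residue_D_kernel_conj:
  fixes \<theta> t :: real
  assumes \<theta>: "\<theta> \<noteq> 0" and t: "t = \<theta> \<or> t = - \<theta>"
  shows "\<exists>q. \<forall>x>0. residue (\<lambda>s. D \<theta> s * of_real x powr s / s) (1 + \<i> * of_real t)
                     = q * of_real x powr (1 + \<i> * of_real t)"
proof -
  define \<rho> where "\<rho> = 1 + \<i> * of_real t"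
  define q where "q s = D_num \<theta> s / ((s - 1) ^ 2 * (s - (1 - \<i> * of_real t)) * zeta_pole_removed (2 * s) * s)" for s
  have t0: "t \<noteq> 0" using \<theta> t by auto
  have \<rho>: "\<rho> - 1 \<noteq> 0" "\<rho> - (1 - \<i> * of_real t) \<noteq> 0" "\<rho> \<noteq> 0"
    using t0 by (auto simp: \<rho>_def complex_eq_iff)
  have "zeta_pole_removed (2 * \<rho>) \<noteq> 0"
    by (rule zeta_pole_removed_nonzero) (simp add: \<rho>_def)
  with \<rho> have "q analytic_on {\<rho>}" unfolding q_def
    by (intro analytic_intros analytic_D_num) auto
  then obtain A where A: "open A" "\<rho> \<in> A" "q holomorphic_on A"
    by (auto simp: analytic_at)
  have "residue (\<lambda>s. D_num \<theta> s / D_den \<theta> s * of_real x powr s / s) \<rho> = q \<rho> * of_real x powr \<rho>" if "x > 0" for x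
  proof -
    have "of_real \<theta> ^ 2 = (of_real t ^ 2 :: complex)" using t by auto
    hence "D_num \<theta> s / D_den \<theta> s * of_real x powr s / s = (q s * of_real x powr s) / (s - \<rho>)" for s
      unfolding D_den_def q_def \<rho>_def by (simp add: quadratic_factor mult_ac)
    moreover have "(\<lambda>s. q s * of_real x powr s) holomorphic_on A"
      using that by (intro holomorphic_intros A) auto
    ultimately show ?thesis using residue_simple[OF A(1,2)] by simp
  qed
  thus ?thesis unfolding residue_D_kernel \<rho>_def by blast
qed

text \<open>\<open>A\<close> and \<open>B\<close> are left undetermined: the transforms of x
  cos(theta ln x) and x sin(theta ln x) are regular on the real axis whatever their coefficients.
  Only \<open>p0\<close> and \<open>p1\<close> are tied to \<open>D_reg\<close>, because the pole at
  1 has to cancel.\<close>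

lemma Delta_explicit:
  assumes \<theta>: "\<theta> \<noteq> 0"
  shows "\<exists>p0 p1 A B. D_reg \<theta> 1 = of_real p0 \<and> deriv (D_reg \<theta>) 1 = of_real p1 \<and>
    (\<forall>x>0. Delta \<theta> x = sum_star (\<lambda>n. (cmod (tau n \<theta>))\<^sup>2) x
        - (p1 * x + p0 * (x * ln x) + A * (x * cos (\<theta> * ln x)) + B * (x * sin (\<theta> * ln x))))"
proof -
  obtain p0 p1 where p: "D_reg \<theta> 1 = of_real p0" "deriv (D_reg \<theta>) 1 = of_real p1"
    using D_reg_real[OF \<theta>] by (auto elim!: Reals_cases)
  obtain q where q: "\<And>x. x > 0 \<Longrightarrow> residue (\<lambda>s. D \<theta> s * of_real x powr s / s) (1 + \<i> * of_real \<theta>)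
                     = q * of_real x powr (1 + \<i> * of_real \<theta>)"
    using residue_D_kernel_conj[OF \<theta>, of \<theta>] by blast
  obtain q' where q': "\<And>x. x > 0 \<Longrightarrow> residue (\<lambda>s. D \<theta> s * of_real x powr s / s) (1 - \<i> * of_real \<theta>)
                     = q' * of_real x powr (1 - \<i> * of_real \<theta>)"
    using residue_D_kernel_conj[OF \<theta>, of "- \<theta>"] by auto
  have distinct: "1 \<noteq> 1 + \<i> * complex_of_real \<theta>" "1 \<noteq> 1 - \<i> * complex_of_real \<theta>"
    "1 + \<i> * complex_of_real \<theta> \<noteq> 1 - \<i> * complex_of_real \<theta>"
    using \<theta> by (auto simp: complex_eq_iff)
  have pw: "of_real x powr (1 + \<i> * of_real t) = Complex (x * cos (t * ln x)) (x * sin (t * ln x))"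
    if "x > 0" for x t :: real
    using that by (simp add: powr_def complex_eq_iff Re_exp Im_exp Ln_of_real)
  have "Delta \<theta> x = sum_star (\<lambda>n. (cmod (tau n \<theta>))\<^sup>2) x
      - (p1 * x + p0 * (x * ln x) + (Re q + Re q') * (x * cos (\<theta> * ln x))
         + (Im q' - Im q) * (x * sin (\<theta> * ln x)))" if x: "x > 0" for x
  proof -
    have "Re (q * of_real x powr (1 + \<i> * of_real \<theta>)) = Re q * (x * cos (\<theta> * ln x)) - Im q * (x * sin (\<theta> * ln x))"
      "Re (q' * of_real x powr (1 - \<i> * of_real \<theta>)) = Re q' * (x * cos (\<theta> * ln x)) + Im q' * (x * sin (\<theta> * ln x))"
      using pw[OF x, of \<theta>] pw[OF x, of "- \<theta>"] by simp_all
    thus ?thesis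
      using distinct by (simp add: Delta_def residue_D_kernel_1[OF \<theta> x] q[OF x] q'[OF x] p algebra_simps)
  qed
  with p show ?thesis by blast
qed

text \<open>Forming the difference quotient twice at z divides off the constant and the linear
  Taylor term and stays holomorphic each time.\<close>

lemma double_pole_removable:
  fixes p :: "complex \<Rightarrow> complex"
  assumes "p analytic_on {z}"
  shows "\<exists>h. h analytic_on {z} \<and>
           (\<forall>\<^sub>F s in at z. h s = p s / (s - z) ^ 2 - p z / (s - z) ^ 2 - deriv p z / (s - z))"
proof -
  obtain A where A: "open A" "z \<in> A" "p holomorphic_on A"
    using assms by (auto simp: analytic_at)
  define g where "g = (\<lambda>s. if s = z then deriv p z else (p s - p z) / (s - z))"
  define h where "h = (\<lambda>s. if s = z then deriv g z else (g s - g z) / (s - z))"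
  have "g holomorphic_on A" unfolding g_def by (rule pole_lemma_open[OF A(3,1)])
  hence "h holomorphic_on A" unfolding h_def by (rule pole_lemma_open[OF _ A(1)])
  hence "h analytic_on {z}" using A by (auto simp: analytic_at)
  moreover have "\<forall>\<^sub>F s in at z. h s = p s / (s - z) ^ 2 - p z / (s - z) ^ 2 - deriv p z / (s - z)"
    by (auto simp: eventually_at_filter h_def g_def power2_eq_square diff_divide_distrib)
  ultimately show ?thesis by blast
qed

text \<open>A bound along one ray suffices. If (w - z) g(w) has a limit, that limit is the residue;
  if it had a pole, its modulus would be unbounded along the ray. This covers a pole of unknown
  order.\<close>

lemma residue_norm_bound:
  assumes iso: "isolated_singularity_at g z" and ness: "not_essential g z"
    and bound: "\<forall>\<^sub>F d in at_right 0. d * norm (g (z + of_real d)) \<le> K"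
  shows "norm (residue g z) \<le> K"
proof -
  define G where "G w = g w * (w - z)" for w
  define u where "u d = z + complex_of_real d" for d
  have u: "filterlim u (at z) (at_right 0)"
    unfolding filterlim_at u_def by (auto simp: eventually_at_filter intro!: tendsto_eq_intros)
  have bG: "\<forall>\<^sub>F d in at_right 0. norm (G (u d)) \<le> K"
    using bound eventually_at_right_less[of 0]
    by eventually_elim (simp add: G_def u_def norm_mult mult.commute)
  have "g meromorphic_on {z}" using iso ness by (simp add: meromorphic_at_iff)
  hence "G meromorphic_on {z}" unfolding G_def by (intro meromorphic_intros)
  hence "not_essential G z" by (simp add: meromorphic_at_iff)
  then consider c where "G \<midarrow>z\<rightarrow> c" | "is_pole G z"
    by (auto simp: not_essential_def)
  thus ?thesis
  proof cases
    case 1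
    obtain r where r: "r > 0" "g analytic_on ball z r - {z}"
      using iso by (auto simp: isolated_singularity_at_def)
    have "residue g z = c"
      by (rule residue_simple'[OF open_ball[of z r] _ analytic_imp_holomorphic[OF r(2)]]) (use 1 r(1) in \<open>simp_all add: G_def[abs_def]\<close>)
    moreover have "((\<lambda>d. norm (G (u d))) \<longlongrightarrow> norm c) (at_right 0)"
      by (intro tendsto_norm filterlim_compose[OF 1 u])
    hence "norm c \<le> K" by (rule tendsto_upperbound[OF _ bG]) simp
    ultimately show ?thesis by simp
  next
    case 2
    hence "filterlim (\<lambda>d. G (u d)) at_infinity (at_right 0)"
      unfolding is_pole_def using u by (rule filterlim_compose)
    hence "filterlim (\<lambda>d. norm (G (u d))) at_top (at_right 0)"
      by (rule filterlim_at_infinity_imp_norm_at_top)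
    hence "\<forall>\<^sub>F d in at_right 0. norm (G (u d)) > K"
      by (rule filterlim_at_top_dense[THEN iffD1, rule_format])
    with bG have "\<forall>\<^sub>F d in at_right (0::real). False" by eventually_elim simp
    thus ?thesis by simp
  qed
qed

section \<open>Oscillation of the error term\<close>

definition main_term :: "real \<Rightarrow> real \<Rightarrow> real \<Rightarrow> real \<Rightarrow> real \<Rightarrow> real \<Rightarrow> real \<Rightarrow> real" where
  "main_term k p1 p0 A B \<theta> x = k * x powr (1 / 4)
     + (p1 * x + p0 * (x * ln x) + A * (x * cos (\<theta> * ln x)) + B * (x * sin (\<theta> * ln x)))"

lemma main_term_deriv:
  assumes x: "x > 0"
  shows "(main_term k p1 p0 A B \<theta> has_real_derivative
      k * (1 / 4 * x powr (- 3 / 4)) + (p1 + p0 * (ln x + 1)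
        + A * (cos (\<theta> * ln x) - \<theta> * sin (\<theta> * ln x)) + B * (sin (\<theta> * ln x) + \<theta> * cos (\<theta> * ln x)))) (at x)"
proof -
  have "((\<lambda>x. x powr (1 / 4)) has_real_derivative 1 / 4 * x powr (1 / 4 - 1)) (at x)"
    by (rule has_real_derivative_powr[OF x])
  hence "((\<lambda>x. x powr (1 / 4)) has_real_derivative 1 / 4 * x powr (- 3 / 4)) (at x)" by simp
  moreover have "((\<lambda>x. x * ln x) has_real_derivative ln x + 1) (at x)"
    "((\<lambda>x. x * cos (\<theta> * ln x)) has_real_derivative cos (\<theta> * ln x) - \<theta> * sin (\<theta> * ln x)) (at x)"
    "((\<lambda>x. x * sin (\<theta> * ln x)) has_real_derivative sin (\<theta> * ln x) + \<theta> * cos (\<theta> * ln x)) (at x)"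
    using x by (auto intro!: derivative_eq_intros)
  ultimately show ?thesis unfolding main_term_def[abs_def]
    using DERIV_cmult[OF DERIV_ident, of p1] by (intro DERIV_add DERIV_cmult) auto
qed

text \<open>The derivative is O(1 + ln x), and the logarithm is absorbed into x^(1/8); this is where
  that exponent enters.\<close>

lemma main_term_slope:
  "\<exists>b>0. \<forall>x y. x \<ge> 2 \<longrightarrow> x / 2 \<le> y \<longrightarrow> y \<le> 2 * x \<longrightarrow>
     \<bar>main_term k p1 p0 A B \<theta> y - main_term k p1 p0 A B \<theta> x\<bar> \<le> b * x powr (1 / 8) * \<bar>y - x\<bar>"
proof -
  define C where "C = \<bar>k\<bar> + \<bar>p1\<bar> + \<bar>p0\<bar> + \<bar>A\<bar> * (1 + \<bar>\<theta>\<bar>) + \<bar>B\<bar> * (1 + \<bar>\<theta>\<bar>)"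
  define b where "b = C + 16 * \<bar>p0\<bar> + 1"
  have C0: "C \<ge> 0" by (simp add: C_def)
  let ?d = "\<lambda>u. k * (1 / 4 * u powr (- 3 / 4)) + (p1 + p0 * (ln u + 1)
        + A * (cos (\<theta> * ln u) - \<theta> * sin (\<theta> * ln u)) + B * (sin (\<theta> * ln u) + \<theta> * cos (\<theta> * ln u)))"
  have bound: "\<bar>?d u\<bar> \<le> b * x powr (1 / 8)" if x: "x \<ge> 2" and u: "1 \<le> u" "u \<le> 2 * x" for x u
  proof -
    have 1: "\<bar>k * (1 / 4 * u powr (- 3 / 4))\<bar> \<le> \<bar>k\<bar> * 1"
    proof -
      have "u powr (- 3 / 4) \<le> 1 powr (- 3 / 4)" using u by (intro powr_mono2') auto
      thus ?thesis unfolding abs_mult by (intro mult_left_mono) auto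
    qed
    have trig: "\<bar>cos v - \<theta> * sin v\<bar> \<le> 1 + \<bar>\<theta>\<bar>" "\<bar>sin v + \<theta> * cos v\<bar> \<le> 1 + \<bar>\<theta>\<bar>" for v
    proof -
      have "\<bar>\<theta> * sin v\<bar> \<le> \<bar>\<theta>\<bar> * 1" "\<bar>\<theta> * cos v\<bar> \<le> \<bar>\<theta>\<bar> * 1"
        unfolding abs_mult by (intro mult_left_mono; simp)+
      thus "\<bar>cos v - \<theta> * sin v\<bar> \<le> 1 + \<bar>\<theta>\<bar>" "\<bar>sin v + \<theta> * cos v\<bar> \<le> 1 + \<bar>\<theta>\<bar>"
        using abs_cos_le_one[of v] abs_sin_le_one[of v] by linarith+
    qed
    have 2: "\<bar>A * (cos (\<theta> * ln u) - \<theta> * sin (\<theta> * ln u))\<bar> \<le> \<bar>A\<bar> * (1 + \<bar>\<theta>\<bar>)"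
      "\<bar>B * (sin (\<theta> * ln u) + \<theta> * cos (\<theta> * ln u))\<bar> \<le> \<bar>B\<bar> * (1 + \<bar>\<theta>\<bar>)"
      unfolding abs_mult using trig by (intro mult_left_mono; simp)+
    have 3: "\<bar>p0 * (ln u + 1)\<bar> \<le> \<bar>p0\<bar> * (16 * x powr (1 / 8) + 1)"
    proof -
      \<comment> \<open>The constant 16 arises as 8 from bounding the logarithm by the power 1/8 and
        2 from (2x)^(1/8) <= 2 x^(1/8).\<close>
      have "ln u \<le> u powr (1 / 8) / (1 / 8)" using u by (intro ln_powr_bound) auto
      also have "u powr (1 / 8) \<le> (2 * x) powr (1 / 8)" using u by (intro powr_mono2) auto
      also have "(2 * x) powr (1 / 8) = 2 powr (1 / 8) * x powr (1 / 8)" using x by (simp add: powr_mult)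
      also have "2 powr (1 / 8) \<le> (2 powr 1 :: real)" by (intro powr_mono) auto
      finally have "ln u \<le> 16 * x powr (1 / 8)" by (simp add: mult_right_mono)
      thus ?thesis unfolding abs_mult using u by (intro mult_left_mono) auto
    qed
    have one: "1 \<le> x powr (1 / 8)" using x by (intro ge_one_powr_ge_zero) auto
    have tri: "\<bar>v1 + (v2 + v3 + v4 + v5)\<bar> \<le> \<bar>v1\<bar> + \<bar>v2\<bar> + \<bar>v3\<bar> + \<bar>v4\<bar> + \<bar>v5\<bar>"
      for v1 v2 v3 v4 v5 :: real by linarith
    have "\<bar>?d u\<bar> \<le> \<bar>k\<bar> * 1 + \<bar>p1\<bar> + \<bar>p0\<bar> * (16 * x powr (1 / 8) + 1)
        + \<bar>A\<bar> * (1 + \<bar>\<theta>\<bar>) + \<bar>B\<bar> * (1 + \<bar>\<theta>\<bar>)"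
      by (rule order_trans[OF tri]) (intro add_mono 1 2 3 order_refl)
    also have "\<dots> = C + 16 * \<bar>p0\<bar> * x powr (1 / 8)"
      unfolding C_def by (simp add: algebra_simps)
    finally have "\<bar>?d u\<bar> \<le> C + 16 * \<bar>p0\<bar> * x powr (1 / 8)" .
    moreover have "C * 1 \<le> C * x powr (1 / 8)" using C0 one by (intro mult_left_mono)
    ultimately show ?thesis using one unfolding b_def distrib_right by linarith
  qed
  have "\<bar>main_term k p1 p0 A B \<theta> y - main_term k p1 p0 A B \<theta> x\<bar> \<le> b * x powr (1 / 8) * \<bar>y - x\<bar>"
    if x: "x \<ge> 2" and y: "x / 2 \<le> y" "y \<le> 2 * x" for x y
  proof -
    have "norm (main_term k p1 p0 A B \<theta> y - main_term k p1 p0 A B \<theta> x) \<le> b * x powr (1 / 8) * norm (y - x)"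
    proof (rule field_differentiable_bound[where S = "{x / 2..2 * x}" and f' = ?d])
      show "(main_term k p1 p0 A B \<theta> has_field_derivative ?d z) (at z within {x / 2..2 * x})"
        if "z \<in> {x / 2..2 * x}" for z
        using that x by (intro has_field_derivative_at_within[OF main_term_deriv]) auto
      show "norm (?d z) \<le> b * x powr (1 / 8)" if "z \<in> {x / 2..2 * x}" for z
        using bound[OF x, of z] that x by (simp only: real_norm_def) auto
    qed (use x y in auto)
    thus ?thesis by simp
  qed
  moreover have "b > 0" using C0 by (simp add: b_def add_nonneg_pos)
  ultimately show ?thesis by blast
qed

lemma has_mellin_main_term:
  assumes "c > 1"
  shows "has_mellin (main_term k p1 p0 A B \<theta>) c (k * (1 / (c - 1 / 4))
     + (p1 * (1 / (c - 1)) + p0 * (1 / (c - 1)\<^sup>2) + A * ((c - 1) / ((c - 1)\<^sup>2 + \<theta>\<^sup>2))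
         + B * (\<theta> / ((c - 1)\<^sup>2 + \<theta>\<^sup>2))))"
  unfolding main_term_def[abs_def] using assms
  by (intro has_mellin_add has_mellin_cmult has_mellin_powr has_mellin_id has_mellin_x_ln
      has_mellin_trig) auto

text \<open>A nonpositive limsup gives a ratio below 1 for large T, and from T >= e on the power of
  the logarithm is at most 1. Below the threshold \<open>T1\<close> the trivial bound T <=
  \<open>T1\<close> T^(1/2) serves, so one constant works for all T >= 1.\<close>

lemma not_is_Omega_bound:
  fixes X :: "real set"
  assumes "\<not> is_Omega (\<lambda>T. measure lebesgue (X \<inter> {T..2 * T})) (\<lambda>T. T powr (1 / 2) * ln T powr (- 12))"
    and X: "X \<in> sets borel"
  obtains K where "\<And>T. T \<ge> 1 \<Longrightarrow> measure lborel (X \<inter> {T..2 * T}) \<le> K * T powr (1 / 2)"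
proof -
  let ?m = "\<lambda>T. measure lborel (X \<inter> {T..2 * T})"
  have leb: "measure lebesgue (X \<inter> {T..2 * T}) = ?m T" for T
    using X by (intro measure_completion) auto
  have "Limsup at_top (\<lambda>T. ereal (?m T / (T powr (1 / 2) * ln T powr (- 12)))) < 1"
    using assms(1) unfolding is_Omega_def leb by (auto simp: not_less intro: le_less_trans[of _ 0])
  hence "\<forall>\<^sub>F T in at_top. ereal (?m T / (T powr (1 / 2) * ln T powr (- 12))) < 1"
    by (rule Limsup_lessD)
  then obtain T0 where T0: "\<And>T. T \<ge> T0 \<Longrightarrow> ?m T / (T powr (1 / 2) * ln T powr (- 12)) < 1"
    unfolding eventually_at_top_linorder by auto
  define T1 where "T1 = max T0 (exp 1)"
  have T1: "T1 \<ge> exp 1" "T1 \<ge> 1" using exp_ge_add_one_self[of 1] by (auto simp: T1_def)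
  have "?m T \<le> T1 * T powr (1 / 2)" if T: "T \<ge> 1" for T
  proof -
    have half: "T powr (1 / 2) \<ge> 1" using T by (intro ge_one_powr_ge_zero) auto
    show ?thesis
    proof (cases "T \<ge> T1")
      case True
      have "ln T \<ge> ln (exp 1)" using True T T1 by (subst ln_le_cancel_iff) auto
      hence ln: "ln T \<ge> 1" by simp
      have "?m T < T powr (1 / 2) * ln T powr (- 12)"
      proof -
        have "T \<noteq> 0" "ln T \<noteq> 0" using T ln by linarith+
        hence "T powr (1 / 2) * ln T powr (- 12) > 0"
          by (intro mult_pos_pos) (simp_all only: powr_gt_zero not_False_eq_True)
        moreover have "?m T / (T powr (1 / 2) * ln T powr (- 12)) < 1"
          using True by (intro T0) (simp add: T1_def)
        ultimately show ?thesis by (simp only: pos_divide_less_eq mult_1_left)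
      qed
      also have "\<dots> \<le> T powr (1 / 2) * 1"
        using ln powr_mono2'[of "- 12" 1 "ln T"] by (intro mult_left_mono) auto
      also have "\<dots> \<le> T1 * T powr (1 / 2)" using T1 half by (simp add: mult_le_cancel_right1)
      finally show ?thesis by simp
    next
      case False
      have "?m T \<le> measure lborel {T..2 * T}"
        by (rule measure_mono_fmeasurable) (use X T in \<open>auto simp: fmeasurable_def\<close>)
      also have "\<dots> = T" using T by simp
      also have "T \<le> T1 * T powr (1 / 2)"
        using False half T1 mult_mono[of T T1 1 "T powr (1 / 2)"] by simp
      finally show ?thesis .
    qed
  qed
  thus ?thesis by (rule that)
qed

text \<open>Both sets are treated at once: \<open>\<tau>\<close> = 1 gives large positive values of
  \<open>Delta\<close> and \<open>\<tau>\<close> = -1 large negative ones.\<close>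

theorem Omega_one_sided:
  fixes \<theta> \<epsilon> \<tau> :: real and s0 :: complex
  assumes \<theta>: "\<theta> \<noteq> 0" and s0: "Re s0 = 1 / 4" "Im s0 > 0" and \<epsilon>: "\<epsilon> > 0"
    and \<tau>: "\<tau> = 1 \<or> \<tau> = - 1"
  defines "X \<equiv> {x. x \<ge> 1 \<and> (lambda s0 \<theta> - \<epsilon>) * x powr (1 / 4) - \<tau> * Delta \<theta> x < 0}"
  shows "is_Omega (\<lambda>T. measure lebesgue (X \<inter> {T..2 * T})) (\<lambda>T. T powr (1 / 2) * ln T powr (- 12))"
proof (rule ccontr)
  assume neg: "\<not> ?thesis"
  define \<kappa> where "\<kappa> = lambda s0 \<theta> - \<epsilon>"
  obtain p0 p1 A B where p: "D_reg \<theta> 1 = of_real p0" "deriv (D_reg \<theta>) 1 = of_real p1"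
    and Delta_eq: "\<And>x. x > 0 \<Longrightarrow> Delta \<theta> x = sum_star (\<lambda>n. (cmod (tau n \<theta>))\<^sup>2) x
        - (p1 * x + p0 * (x * ln x) + A * (x * cos (\<theta> * ln x)) + B * (x * sin (\<theta> * ln x)))"
    using Delta_explicit[OF \<theta>] by blast
  define S where "S = sum_star (\<lambda>n. (cmod (tau n \<theta>))\<^sup>2)"
  note Delta = Delta_eq[folded S_def]
  define M where "M = main_term \<kappa> (\<tau> * p1) (\<tau> * p0) (\<tau> * A) (\<tau> * B) \<theta>"
  define f where "f x = M x + - \<tau> * S x" for x
  have mono: "mono S" unfolding S_def by (rule mono_sum_star) simp
  have [measurable]: "S \<in> borel_measurable borel" by (rule borel_measurable_mono[OF mono])
  have [measurable]: "M \<in> borel_measurable borel" unfolding M_def main_term_def[abs_def] by measurable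
  have f_meas [measurable]: "f \<in> borel_measurable borel" unfolding f_def by measurable
  have fX: "X = {x. x \<ge> 1 \<and> f x < 0}"
  proof -
    have "f x = \<kappa> * x powr (1 / 4) - \<tau> * Delta \<theta> x" if "x \<ge> 1" for x
      using that unfolding f_def M_def main_term_def by (subst Delta) (simp_all add: algebra_simps)
    thus ?thesis unfolding X_def \<kappa>_def by auto
  qed
  have "X \<in> sets borel" unfolding fX by measurable
  then obtain K where K: "\<And>T. T \<ge> 1 \<Longrightarrow> measure lborel (X \<inter> {T..2 * T}) \<le> K * T powr (1 / 2)"
    using not_is_Omega_bound[OF neg] by blast
  obtain b where b: "b > 0" "\<And>x y. x \<ge> 2 \<Longrightarrow> x / 2 \<le> y \<Longrightarrow> y \<le> 2 * x \<Longrightarrow>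
       \<bar>M y - M x\<bar> \<le> b * x powr (1 / 8) * \<bar>y - x\<bar>"
    using main_term_slope[of \<kappa> "\<tau> * p1" "\<tau> * p0" "\<tau> * A" "\<tau> * B" \<theta>, folded M_def] by blast
  have slope: "f y \<le> f x + b * x powr (1 / 8) * \<bar>y - x\<bar>"
    if "x \<ge> 2" "x / 2 \<le> y" "y \<le> 2 * x" "\<tau> * (y - x) \<ge> 0" for x y
  proof -
    \<comment> \<open>The sign \<open>\<tau>\<close> also fixes the direction in which
      -\<open>\<tau>\<close> S falls, so the summatory part can only lower f and the main term alone
      controls its rise.\<close>
    have "\<tau> * (S y - S x) \<ge> 0"
      using \<tau> that(4) monoD[OF mono, of x y] monoD[OF mono, of y x] by auto
    thus ?thesis using b(2)[OF that(1-3)] unfolding f_def by (simp add: algebra_simps)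
  qed
  have local: "\<exists>C. \<forall>x\<in>{1..Y}. f x \<ge> - C" for Y
  proof -
    have "continuous_on {1..Y} M"
      unfolding M_def by (intro continuous_at_imp_continuous_on ballI DERIV_isCont[OF main_term_deriv]) auto
    hence "bounded (M ` {1..Y})" by (intro compact_imp_bounded compact_continuous_image) auto
    then obtain C where C: "\<forall>x\<in>{1..Y}. \<bar>M x\<bar> \<le> C" by (auto simp: bounded_iff)
    have "f x \<ge> - (C + \<bar>S 1\<bar> + \<bar>S Y\<bar>)" if x: "x \<in> {1..Y}" for x
    proof -
      have "S 1 \<le> S x" "S x \<le> S Y" using x by (auto intro: monoD[OF mono])
      thus ?thesis using bspec[OF C x] \<tau> unfolding f_def by auto
    qed
    thus ?thesis by blast
  qed

  define Q where "Q s = D_den \<theta> s * s" for s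
  define m where "m s = of_real p1 / (s - 1) + of_real p0 / (s - 1) ^ 2
      + (of_real A * (s - 1) + of_real (B * \<theta>)) / ((s - 1) ^ 2 + of_real \<theta> ^ 2)" for s :: complex
  \<comment> \<open>This is -\<open>\<tau>\<close> (D(s)/s - m(s)) Q(s) with all denominators
    multiplied out, hence entire.\<close>
  define P where "P s = - of_real \<tau> * (D_num \<theta> s - s * zeta_pole_removed (2 * s) *
      ((of_real p1 * (s - 1) + of_real p0) * ((s - 1) ^ 2 + of_real \<theta> ^ 2)
        + (of_real A * (s - 1) + of_real (B * \<theta>)) * (s - 1) ^ 2))" for s
  have Q_hol: "Q holomorphic_on Y" and P_hol: "P holomorphic_on Y" for Y
    unfolding Q_def[abs_def] P_def[abs_def]
    by (intro holomorphic_intros holomorphic_D_num holomorphic_D_den)+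
  have PQ: "P s = - of_real \<tau> * (D_num \<theta> s / D_den \<theta> s / s - m s) * Q s" if "Q s \<noteq> 0" for s
  proof -
    define q z where "q = (s - 1) ^ 2 + of_real \<theta> ^ 2" and "z = zeta_pole_removed (2 * s)"
    have nz: "D_den \<theta> s \<noteq> 0" "s \<noteq> 0" "s - 1 \<noteq> 0" "q \<noteq> 0" "z \<noteq> 0"
      using that by (auto simp: Q_def D_den_def q_def z_def)
    have Q_eq: "Q s = (s - 1) ^ 2 * q * z * s" by (simp add: Q_def D_den_def q_def z_def)
    have 1: "D_num \<theta> s / D_den \<theta> s / s * Q s = D_num \<theta> s"
      using nz by (simp add: Q_def)
    have 2: "m s * Q s = s * z * ((of_real p1 * (s - 1) + of_real p0) * q
        + (of_real A * (s - 1) + of_real (B * \<theta>)) * (s - 1) ^ 2)"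
    proof -
      have "of_real p1 / (s - 1) * Q s = s * z * (of_real p1 * (s - 1)) * q"
        using nz unfolding Q_eq by (simp add: power2_eq_square)
      moreover have "of_real p0 / (s - 1) ^ 2 * Q s = s * z * of_real p0 * q"
        using nz unfolding Q_eq by simp
      moreover have "(of_real A * (s - 1) + of_real (B * \<theta>)) / q * Q s
          = s * z * ((of_real A * (s - 1) + of_real (B * \<theta>)) * (s - 1) ^ 2)"
        using nz unfolding Q_eq by simp
      ultimately show ?thesis unfolding m_def q_def[symmetric] distrib_right by (simp add: algebra_simps)
    qed
    show ?thesis
      unfolding P_def q_def[symmetric] z_def[symmetric] mult.assoc left_diff_distrib 1 2
      by (simp add: mult.assoc)
  qed
  have Q_real: "Q (of_real x) \<noteq> 0" if "x \<ge> 1 / 4" "x \<noteq> 1" for x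
  proof -
    have "zeta_pole_removed (of_real (2 * x)) \<noteq> 0"
      by (rule zeta_pole_removed_real_nonzero) (use that in simp)
    moreover have "complex_of_real x - 1 \<noteq> 0" using that by (simp add: complex_eq_iff)
    ultimately show ?thesis
      using that quadratic_nonzero[of "of_real x" \<theta>] by (simp add: Q_def D_den_def)
  qed

  have int_mellin: "has_mellin f c (\<kappa> / (c - 1 / 4) +
        Re (- of_real \<tau> * (D_num \<theta> (of_real c) / D_den \<theta> (of_real c) / of_real c - m (of_real c))))"
    and real_E: "- of_real \<tau> * (D_num \<theta> (of_real c) / D_den \<theta> (of_real c) / of_real c - m (of_real c)) \<in> \<real>"
    if c: "c > 1" for c
  proof -
    obtain \<Sigma> where \<Sigma>: "(\<lambda>n. (cmod (tau (Suc n) \<theta>))\<^sup>2 * real (Suc n) powr - c) sums \<Sigma>"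
      "D_num \<theta> (of_real c) / D_den \<theta> (of_real c) = of_real \<Sigma>"
      using D_quotient_real[OF c] by blast
    define mr where "mr = p1 / (c - 1) + p0 / (c - 1) ^ 2 + (A * (c - 1) + B * \<theta>) / ((c - 1) ^ 2 + \<theta> ^ 2)"
    have mr: "m (of_real c) = of_real mr" unfolding m_def mr_def by simp
    have E: "- of_real \<tau> * (D_num \<theta> (of_real c) / D_den \<theta> (of_real c) / of_real c - m (of_real c))
        = complex_of_real (- \<tau> * (\<Sigma> / c - mr))" unfolding \<Sigma>(2) mr by simp
    show "- of_real \<tau> * (D_num \<theta> (of_real c) / D_den \<theta> (of_real c) / of_real c - m (of_real c)) \<in> \<real>"
      unfolding E by (rule Reals_of_real)
    have "has_mellin S c (\<Sigma> / c)"
      unfolding S_def by (rule has_mellin_sum_star[OF _ _ \<Sigma>(1)]) (use c in auto)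
    from has_mellin_add[OF has_mellin_main_term[OF c] has_mellin_cmult[OF this, of "- \<tau>"],
        of \<kappa> "\<tau> * p1" "\<tau> * p0" "\<tau> * A" "\<tau> * B" \<theta>]
    have "has_mellin f c (\<kappa> * (1 / (c - 1 / 4)) + (\<tau> * p1 * (1 / (c - 1)) + \<tau> * p0 * (1 / (c - 1)\<^sup>2)
        + \<tau> * A * ((c - 1) / ((c - 1)\<^sup>2 + \<theta>\<^sup>2)) + \<tau> * B * (\<theta> / ((c - 1)\<^sup>2 + \<theta>\<^sup>2))) + - \<tau> * (\<Sigma> / c))"
      unfolding f_def[abs_def] M_def .
    also have "\<kappa> * (1 / (c - 1 / 4)) + (\<tau> * p1 * (1 / (c - 1)) + \<tau> * p0 * (1 / (c - 1)\<^sup>2)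
        + \<tau> * A * ((c - 1) / ((c - 1)\<^sup>2 + \<theta>\<^sup>2)) + \<tau> * B * (\<theta> / ((c - 1)\<^sup>2 + \<theta>\<^sup>2))) + - \<tau> * (\<Sigma> / c)
        = \<kappa> / (c - 1 / 4) + - \<tau> * (\<Sigma> / c - mr)"
      unfolding mr_def divide_inverse by (simp add: algebra_simps)
    finally show "has_mellin f c (\<kappa> / (c - 1 / 4) +
        Re (- of_real \<tau> * (D_num \<theta> (of_real c) / D_den \<theta> (of_real c) / of_real c - m (of_real c))))"
      unfolding E Re_complex_of_real .
  qed
  have mellin: "of_real (LINT x:{1..}|lborel. f x * x powr (- c - 1)) * Q (of_real c)
      = of_real \<kappa> / (of_real c - 1 / 4) * Q (of_real c) + P (of_real c)" if c: "c > 1" for c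
  proof -
    have Q0: "Q (of_real c) \<noteq> 0" by (rule Q_real) (use c in auto)
    have "complex_of_real (\<kappa> / (c - 1 / 4)) = of_real \<kappa> / (of_real c - 1 / 4)" by simp
    thus ?thesis unfolding has_mellinD(2)[OF int_mellin[OF c]] of_real_add of_real_Re[OF real_E[OF c]]
        PQ[OF Q0] distrib_right by (simp only:)
  qed
  have analytic: "Q analytic_on {s}" "P analytic_on {s}" for s
    using Q_hol[of UNIV] P_hol[of UNIV] by (auto simp: analytic_on_open intro: analytic_on_subset[of _ UNIV])
  have reg: "\<exists>h. h analytic_on {of_real x} \<and>
      (\<forall>\<^sub>F s in at (of_real x). Q s \<noteq> 0 \<and> h s = P s / Q s)" if x: "x \<ge> 1 / 4" for x
  proof (cases "x = 1")
    case False
    have Q0: "Q (of_real x) \<noteq> 0" by (rule Q_real[OF x False])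
    have "\<forall>\<^sub>F s in at (of_real x). Q s \<noteq> 0"
      using tendsto_imp_eventually_ne[OF analytic_at_imp_isCont[OF analytic(1)[of "of_real x"], unfolded isCont_def] Q0] .
    hence "\<forall>\<^sub>F s in at (of_real x). Q s \<noteq> 0 \<and> P s / Q s = P s / Q s" by simp
    moreover have "(\<lambda>s. P s / Q s) analytic_on {of_real x}"
      using Q0 by (intro analytic_intros analytic) auto
    ultimately show ?thesis by blast
  next
    \<comment> \<open>At s = 1 the factor (s - 1)^2 of \<open>Q\<close> vanishes; regularity comes
      from the exact match of \<open>p0\<close> and \<open>p1\<close> with the double pole of
      D(s)/s.\<close>
    case True
    define R where "R s = ((s - 1) ^ 2 + of_real \<theta> ^ 2) * zeta_pole_removed (2 * s) * s" for s
    obtain h where h: "h analytic_on {1}" "\<forall>\<^sub>F s in at 1. h s = D_reg \<theta> s / (s - 1) ^ 2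
        - D_reg \<theta> 1 / (s - 1) ^ 2 - deriv (D_reg \<theta>) 1 / (s - 1)"
      using double_pole_removable[OF analytic_D_reg[OF \<theta>]] by blast
    define g where "g s = - of_real \<tau> * (h s - (of_real A * (s - 1) + of_real (B * \<theta>)) / ((s - 1) ^ 2 + of_real \<theta> ^ 2))" for s
    have "R analytic_on {1}" unfolding R_def[abs_def] by (intro analytic_intros)
    moreover have "R 1 \<noteq> 0" using \<theta> zeta_pole_removed_nonzero[of 2] by (simp add: R_def)
    ultimately have evR: "\<forall>\<^sub>F s in at 1. R s \<noteq> 0"
      using tendsto_imp_eventually_ne[OF analytic_at_imp_isCont[unfolded isCont_def]] by blast
    have "g analytic_on {1}" unfolding g_def[abs_def]
      using \<theta> by (intro analytic_intros h) auto
    moreover have "\<forall>\<^sub>F s in at 1. Q s \<noteq> 0 \<and> g s = P s / Q s"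
      using evR h(2) eventually_neq_at_within[of 1]
    proof eventually_elim
      case (elim s)
      have QR: "Q s = (s - 1) ^ 2 * R s" by (simp add: Q_def R_def D_den_def)
      hence Q0: "Q s \<noteq> 0" using elim by simp
      have "D_num \<theta> s / D_den \<theta> s / s = D_reg \<theta> s / (s - 1) ^ 2"
        by (simp add: D_reg_def D_den_def mult_ac)
      hence "g s = - of_real \<tau> * (D_num \<theta> s / D_den \<theta> s / s - m s)"
        unfolding g_def m_def elim(2) p by simp
      thus ?case using Q0 PQ[OF Q0] by simp
    qed
    ultimately show ?thesis using True by auto
  qed

  \<comment> \<open>One \<open>e\<close> is lost in the comparison of poles and one in the limit
    that removes m(s); the resulting \<open>\<kappa>\<close> + 2e is lambda - epsilon/2, which
    contradicts the lower bound.\<close>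
  define e where "e = \<epsilon> / 4"
  have e: "e > 0" using \<epsilon> by (simp add: e_def)
  define u where "u d = s0 + complex_of_real d" for d
  have u_eq: "Complex (1 / 4 + d) (Im s0) = u d" for d
    using s0 by (simp add: u_def complex_eq_iff)
  have core: "\<forall>\<^sub>F d in at_right 0. d * norm (P (u d) / Q (u d)) \<le> \<kappa> + e"
    using one_sided_pole_bound[OF f_meas b(1) \<tau> slope local K[unfolded fX]
        has_mellinD(1)[OF int_mellin] mellin P_hol Q_hol reg s0(2) e]
    unfolding u_eq .
  have u_lim: "(u \<longlongrightarrow> s0) (at_right 0)" unfolding u_def by (auto intro!: tendsto_eq_intros)
  have u_at: "filterlim u (at s0) (at_right 0)"
    unfolding filterlim_at using u_lim by (auto simp: eventually_at_filter u_def)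
  have s0_ne: "s0 - 1 \<noteq> 0" "(s0 - 1) ^ 2 + of_real \<theta> ^ 2 \<noteq> 0" "s0 \<noteq> 0"
    using s0 quadratic_nonzero[of s0 \<theta>] by auto
  have m_lim: "((\<lambda>d. m (u d)) \<longlongrightarrow> m s0) (at_right 0)"
    unfolding m_def by (intro tendsto_intros u_lim) (use s0_ne in auto)
  \<comment> \<open>The point \<open>s0\<close> itself may be a zero of \<open>Q\<close>; since
    \<open>Q\<close> does not vanish at 2, its zeros are isolated.\<close>
  have evQ: "\<forall>\<^sub>F d in at_right 0. Q (u d) \<noteq> 0"
  proof -
    have "\<forall>\<^sub>F s in at s0. Q s \<noteq> 0"
      using non_zero_neighbour_alt[OF Q_hol open_UNIV connected_UNIV UNIV_I UNIV_I, of "of_real 2" s0]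
        Q_real[of 2] by simp
    thus ?thesis using u_at unfolding filterlim_iff by blast
  qed
  define W where "W d = norm (u d) * (\<kappa> + e + d * norm (m (u d)))" for d
  have "(W \<longlongrightarrow> norm s0 * (\<kappa> + e + 0 * norm (m s0))) (at_right 0)"
    unfolding W_def by (intro tendsto_intros u_lim m_lim)
  hence evW: "\<forall>\<^sub>F d in at_right 0. W d < norm s0 * (\<kappa> + 2 * e)"
    by (rule order_tendstoD(2)) (use s0_ne e in simp)
  have "\<forall>\<^sub>F d in at_right 0. d * norm (D_num \<theta> (u d) / D_den \<theta> (u d)) \<le> norm s0 * (\<kappa> + 2 * e)"
    using core evQ evW eventually_at_right_less[of 0]
  proof eventually_elim
    case (elim d)
    let ?E = "D_num \<theta> (u d) / D_den \<theta> (u d)"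
    have u0: "u d \<noteq> 0" using elim by (auto simp: Q_def)
    have "norm (P (u d) / Q (u d)) = norm (?E / u d - m (u d))"
      unfolding PQ[OF elim(2)] using elim(2) \<tau> by (auto simp: norm_mult norm_minus_commute)
    hence "d * norm (?E / u d - m (u d)) \<le> \<kappa> + e" using elim by simp
    moreover have "d * norm (?E / u d) \<le> d * (norm (?E / u d - m (u d)) + norm (m (u d)))"
      using elim norm_triangle_sub[of "?E / u d" "m (u d)"] by (intro mult_left_mono) (auto simp: add.commute)
    ultimately have "d * norm (?E / u d) \<le> \<kappa> + e + d * norm (m (u d))"
      by (simp add: distrib_left)
    hence "norm (u d) * (d * norm (?E / u d)) \<le> W d"
      unfolding W_def by (intro mult_left_mono) auto
    moreover have "norm (u d) * (d * norm (?E / u d)) = d * norm ?E"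
      using u0 by (simp add: norm_divide norm_mult)
    ultimately show ?case using elim by linarith
  qed
  hence "norm (residue (D \<theta>) s0) \<le> norm s0 * (\<kappa> + 2 * e)"
    unfolding residue_D u_def
    by (rule residue_norm_bound[OF isolated_singularity_D_quotient not_essential_D_quotient])
  hence "lambda s0 \<theta> \<le> \<kappa> + 2 * e"
    using s0_ne by (simp add: lambda_def divide_le_eq mult.commute)
  thus False using \<epsilon> by (simp add: \<kappa>_def e_def)
qed

theorem mainTheorem4:
  fixes \<theta> \<epsilon> :: real and s0 :: complex
  assumes "\<theta> \<noteq> 0" and "lowest_nontrivial_zero (2 * s0)" and "\<epsilon> > 0"
  shows "is_Omega (\<lambda>T. measure lebesgue (A1 s0 \<theta> \<epsilon> \<inter> {T..2 * T}))
           (\<lambda>T. T powr (1 / 2) * ln T powr (- 12)) \<and>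
         is_Omega (\<lambda>T. measure lebesgue (A2 s0 \<theta> \<epsilon> \<inter> {T..2 * T}))
           (\<lambda>T. T powr (1 / 2) * ln T powr (- 12))"
proof
  have s0: "Re s0 = 1 / 4" "Im s0 > 0"
    using assms(2) by (auto simp: lowest_nontrivial_zero_def)
  have A1: "A1 s0 \<theta> \<epsilon> = {x. x \<ge> 1 \<and> (lambda s0 \<theta> - \<epsilon>) * x powr (1 / 4) - 1 * Delta \<theta> x < 0}"
    by (auto simp: A1_def)
  show "is_Omega (\<lambda>T. measure lebesgue (A1 s0 \<theta> \<epsilon> \<inter> {T..2 * T}))
           (\<lambda>T. T powr (1 / 2) * ln T powr (- 12))"
    unfolding A1 by (rule Omega_one_sided) (use assms s0 in auto)
  have A2: "A2 s0 \<theta> \<epsilon> = {x. x \<ge> 1 \<and> (lambda s0 \<theta> - \<epsilon>) * x powr (1 / 4) - (- 1) * Delta \<theta> x < 0}"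
    by (auto simp: A2_def algebra_simps)
  show "is_Omega (\<lambda>T. measure lebesgue (A2 s0 \<theta> \<epsilon> \<inter> {T..2 * T}))
           (\<lambda>T. T powr (1 / 2) * ln T powr (- 12))"
    unfolding A2 by (rule Omega_one_sided) (use assms s0 in auto)
qed

end
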